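(* Let $R=\Bbbk[z][x,y;\sigma,a]$ be a classical generalized Weyl algebra with $\sigma(z)=z-1$, where $a\in\Bbbk[z]$ is monic with $0$ as a root and $\deg_z(a)=2$. Let $G,H$ be finite cyclic subgroups of the group $\operatorname{Aut}_{\mathrm{fl}}(R)$ of filtered automorphisms of $R$. If $R^G\cong R^H$, then $G\cong H$. In particular, if $R^H\cong R$, then $H$ is trivial.
   Context: $\Bbbk$ is an algebraically closed field of characteristic zero; all algebras are $\Bbbk$-algebras, and isomorphisms of rings are isomorphisms of $\Bbbk$-algebras. Classical GWA: $R=\Bbbk[z][x,y;\sigma,a]$, with $\sigma(z)=z-1$, is the ring obtained by adjoining to $\Bbbk[z]$ the variables $x,y$ subject to $xy=\sigma(a)$, $yx=a$, $xd=\sigma(d)x$, $yd=\sigma^{-1}(d)y$ for all $d\in\Bbbk[z]$. Standard filtration: with $n=\deg_z(a)$ (here $n=2$), it is the filtration on $R$ defined by $\deg x=\deg y=n$, $\deg z=2$. A filtered automorphism is a $\Bbbk$-algebra automorphism $\phi$ with $\deg(\phi(r))=\deg(r)$ for all $r\in R$. $R^G$ denotes the fixed ring of $G$ acting on $R$. *)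

theory Defs
  imports
    "HOL-Algebra.Algebraic_Closure_Type"
    "HOL-Algebra.QuotRing"
    "HOL-Algebra.Bij"
    "HOL-Algebra.Elementary_Groups"
    "HOL-Library.Poly_Mapping"
begin

section \<open>The free algebra on x, y, z\<close>

datatype gwa_gen = Gen_x | Gen_y | Gen_z

datatype gwa_word = Word (letters: "gwa_gen list")

text \<open>Words are written additively so that the convolution product of
  \<^theory>\<open>HOL-Library.Poly_Mapping\<close> is the product of the free associative algebra.\<close>

instantiation gwa_word :: monoid_add
begin

definition zero_gwa_word :: gwa_word where "0 = Word []"

definition plus_gwa_word :: "gwa_word \<Rightarrow> gwa_word \<Rightarrow> gwa_word"
  where "u + v = Word (letters u @ letters v)"

instance
  by standard (simp_all add: zero_gwa_word_def plus_gwa_word_def)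

end

type_synonym 'k free_xyz = "gwa_word \<Rightarrow>\<^sub>0 'k"

abbreviation free_xyz :: "'k::field free_xyz ring"
  where "free_xyz \<equiv> ring_of_type_algebra"

definition free_gen :: "gwa_gen \<Rightarrow> 'k::field free_xyz"
  where "free_gen g = Poly_Mapping.single (Word [g]) 1"

definition free_scalar :: "'k::field \<Rightarrow> 'k free_xyz"
  where "free_scalar c = Poly_Mapping.single 0 c"

definition free_poly :: "'k::field poly \<Rightarrow> 'k free_xyz"
  where "free_poly d =
    (\<Sum>i\<le>Polynomial.degree d. free_scalar (Polynomial.coeff d i) * free_gen Gen_z ^ i)"


section \<open>Classical generalized Weyl algebras\<close>

definition gwa_sigma :: "'k::field poly \<Rightarrow> 'k poly"
  where "gwa_sigma d = pcompose d [:-1, 1:]"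

definition gwa_sigma_inv :: "'k::field poly \<Rightarrow> 'k poly"
  where "gwa_sigma_inv d = pcompose d [:1, 1:]"

definition gwa_relations :: "'k::field poly \<Rightarrow> 'k free_xyz set"
  where "gwa_relations a =
    (let x = free_gen Gen_x; y = free_gen Gen_y in
      {x * y - free_poly (gwa_sigma a), y * x - free_poly a}
      \<union> {x * free_poly d - free_poly (gwa_sigma d) * x | d. True}
      \<union> {y * free_poly d - free_poly (gwa_sigma_inv d) * y | d. True})"

definition gwa_ideal :: "'k::field poly \<Rightarrow> 'k free_xyz set"
  where "gwa_ideal a = genideal free_xyz (gwa_relations a)"

definition gwa :: "'k::field poly \<Rightarrow> 'k free_xyz set ring"
  where "gwa a = free_xyz Quot gwa_ideal a"

definition gwa_proj :: "'k::field poly \<Rightarrow> 'k free_xyz \<Rightarrow> 'k free_xyz set"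
  where "gwa_proj a p = gwa_ideal a +>\<^bsub>free_xyz\<^esub> p"

definition gwa_scalar :: "'k::field poly \<Rightarrow> 'k \<Rightarrow> 'k free_xyz set"
  where "gwa_scalar a c = gwa_proj a (free_scalar c)"


section \<open>Filtered automorphisms and fixed rings\<close>

text \<open>An algebra over \<open>'k\<close> is a ring together with its structure map from \<open>'k\<close>; for unital ring
  homomorphisms, linearity over \<open>'k\<close> is compatibility with the structure maps.\<close>

definition alg_iso ::
    "('k \<Rightarrow> 'a) \<Rightarrow> 'a ring \<Rightarrow> ('k \<Rightarrow> 'b) \<Rightarrow> 'b ring \<Rightarrow> ('a \<Rightarrow> 'b) set"
  where "alg_iso \<iota> R \<kappa> S = {h \<in> ring_iso R S. \<forall>c. h (\<iota> c) = \<kappa> c}"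

definition gwa_subalg_isomorphic ::
    "'k::field poly \<Rightarrow> 'k free_xyz set ring \<Rightarrow> 'k free_xyz set ring \<Rightarrow> bool"
  where "gwa_subalg_isomorphic a S T \<longleftrightarrow> alg_iso (gwa_scalar a) S (gwa_scalar a) T \<noteq> {}"

fun gen_weight :: "nat \<Rightarrow> gwa_gen \<Rightarrow> nat"
  where
    "gen_weight n Gen_x = n"
  | "gen_weight n Gen_y = n"
  | "gen_weight n Gen_z = 2"

definition word_weight :: "nat \<Rightarrow> gwa_word \<Rightarrow> nat"
  where "word_weight n w = (\<Sum>g\<leftarrow>letters w. gen_weight n g)"

text \<open>The standard filtration: level \<open>m\<close> is spanned by the monomials in \<open>x, y, z\<close> of weight at
  most \<open>m\<close>.\<close>

definition gwa_filtration :: "'k::field poly \<Rightarrow> nat \<Rightarrow> 'k free_xyz set set"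
  where "gwa_filtration a m =
    gwa_proj a ` {p. \<forall>w\<in>Poly_Mapping.keys p. word_weight (Polynomial.degree a) w \<le> m}"

text \<open>The zero element gets degree \<open>0\<close> rather than minus infinity. This does not affect the
  condition below, since automorphisms fix zero and map nonzero elements to nonzero elements.\<close>

definition gwa_degree :: "'k::field poly \<Rightarrow> 'k free_xyz set \<Rightarrow> nat"
  where "gwa_degree a r = (LEAST m. r \<in> gwa_filtration a m)"

definition Aut_fl :: "'k::field poly \<Rightarrow> ('k free_xyz set \<Rightarrow> 'k free_xyz set) monoid"
  where "Aut_fl a = (BijGroup (carrier (gwa a)))
    \<lparr>carrier := {\<phi> \<in> Bij (carrier (gwa a)).
        \<phi> \<in> alg_iso (gwa_scalar a) (gwa a) (gwa_scalar a) (gwa a)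
        \<and> (\<forall>r\<in>carrier (gwa a). gwa_degree a (\<phi> r) = gwa_degree a r)}\<rparr>"

definition gwa_fixed_ring ::
    "'k::field poly \<Rightarrow> ('k free_xyz set \<Rightarrow> 'k free_xyz set) set \<Rightarrow> 'k free_xyz set ring"
  where "gwa_fixed_ring a G = (gwa a)\<lparr>carrier := {r \<in> carrier (gwa a). \<forall>\<phi>\<in>G. \<phi> r = r}\<rparr>"

definition finite_cyclic_subgroup :: "'a set \<Rightarrow> ('a, 'b) monoid_scheme \<Rightarrow> bool"
  where "finite_cyclic_subgroup G A \<longleftrightarrow>
    subgroup G A \<and> finite G \<and> cyclic_group (A\<lparr>carrier := G\<rparr>)"

end

theory Submission
  imports Defs
begin

text \<open>Write \<open>\<sigma>\<close> for the automorphism \<open>z \<mapsto> z - 1\<close> of \<open>k[z]\<close>. Sending \<open>x\<close> to \<open>t\<close> and \<open>y\<close> to \<open>a t\<inverse>\<close>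
  identifies the generalized Weyl algebra \<open>R\<close> with a graded subring of the skew Laurent ring
  \<open>k[z][t, t\<inverse>; \<sigma>]\<close>: the component of degree \<open>i \<ge> 0\<close> is \<open>k[z] t^i\<close>, and the component of degree
  \<open>-m\<close> is \<open>k[z] y^m\<close> with \<open>y^m = a \<sigma>\<inverse>(a) \<dots> \<sigma>^(1-m)(a) t^(-m)\<close>. Injectivity follows from normal
  forms in the presentation (\<open>free_eval_std_gens_eq_0_iff\<close>), so everything can be computed in
  the graded model.

  A filtered automorphism preserves the span of \<open>1, x, y, z\<close>, hence also the span of the
  commutators of these elements. For quadratic \<open>a\<close> this is a copy \<open>W\<close> of the Lie algebra \<open>sl\<^sub>2\<close>,
  with basis \<open>x\<close>, \<open>y\<close> and \<open>h = z - \<kappa>\<close>. Let \<open>g\<close> be an automorphism of finite order \<open>n\<close>. It has an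
  eigenvector in \<open>W\<close>, because the polynomial \<open>X^n - 1\<close>, which annihilates \<open>g\<close>, splits into
  linear factors. Exponentials of multiples of \<open>ad x\<close>, together with the automorphism that
  interchanges \<open>x\<close> and \<open>y\<close>, move every nonzero vector of \<open>W\<close> to a multiple of \<open>x\<close> or of \<open>h\<close>
  (\<open>reach_normal\<close>), and inspection of these two cases shows that some conjugate of \<open>g\<close> fixes \<open>h\<close>
  (\<open>finite_order_aut_conj_fixes_h\<close>). Such a conjugate multiplies the component of degree \<open>i\<close> by
  \<open>\<zeta>^i\<close>, where \<open>\<zeta>\<close> is a root of unity of order \<open>n\<close>. So the fixed ring of a cyclic group of order
  \<open>n\<close> is isomorphic to the \<open>n\<close>-th Veronese subring \<open>S\<close> of \<open>R\<close>, the sum of the components whose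
  degree is divisible by \<open>n\<close> (\<open>fixed_ring_veronese\<close>).

  It remains to recover \<open>n\<close> from \<open>S\<close>. This is done by the dimension of \<open>S / [S, S]\<close>, where
  \<open>[S, S]\<close> is the span of the commutators. Commutators with \<open>z\<close> exhaust all components of
  nonzero degree. The part of degree zero of \<open>[S, S]\<close> consists of the polynomials
  \<open>P - \<sigma>^(-n)(P)\<close> with \<open>P\<close> divisible by \<open>\<sigma>(a) \<dots> \<sigma>^n(a)\<close>. In characteristic zero this space
  contains polynomials of every degree from \<open>n deg a - 1\<close> on, and no nonzero polynomial of
  smaller degree. Hence \<open>dim S / [S, S] = n deg a - 1\<close>, which determines \<open>n\<close>
  (\<open>veronese_iso_eq\<close>), and cyclic groups of the same order are isomorphic.\<close>

section \<open>The skew Laurent polynomial ring\<close>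

text \<open>An element \<open>\<Sum> F\<^sub>i t^i\<close> is stored as the family of its coefficients, which stand to the
  left of the powers of \<open>t\<close>.\<close>

typedef (overloaded) 'k skew = "{F :: int \<Rightarrow> 'k::field poly. finite {i. F i \<noteq> 0}}"
  morphisms skew_coeff Abs_skew
  by (rule exI[of _ "\<lambda>_. 0"]) simp

setup_lifting type_definition_skew

lemma finite_skew_coeff: "finite {i. skew_coeff F i \<noteq> 0}"
  using skew_coeff[of F] by simp

lemma skew_eqI: "(\<And>i. skew_coeff F i = skew_coeff G i) \<Longrightarrow> F = G"
  by (simp add: skew_coeff_inject[symmetric] fun_eq_iff)

definition sigma_pow :: "int \<Rightarrow> 'k::field poly \<Rightarrow> 'k poly"
  where "sigma_pow i p = pcompose p [:- of_int i, 1:]"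

lemma sigma_pow_simps [simp]:
  "sigma_pow i (p + q) = sigma_pow i p + sigma_pow i q" "sigma_pow i (p - q)
      = sigma_pow i p - sigma_pow i q" "sigma_pow i (- p) = - sigma_pow i p"
  "sigma_pow i (p * q) = sigma_pow i p * sigma_pow i q" "sigma_pow i 0 = 0" "sigma_pow i 1 = 1"
      "sigma_pow i [:c:] = [:c:]"
  "sigma_pow i (Polynomial.smult c p) = Polynomial.smult c (sigma_pow i p)"
  by (simp_all add: sigma_pow_def pcompose_add pcompose_diff pcompose_uminus pcompose_mult
      pcompose_smult
      pcompose_1)

lemma sigma_pow_zero [simp]: "sigma_pow 0 p = p"
  by (simp add: sigma_pow_def pcompose_idR)

lemma sigma_pow_sigma_pow [simp]: "sigma_pow i (sigma_pow j p) = sigma_pow (i + j) p"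
  by (simp add: sigma_pow_def pcompose_assoc [symmetric] pcompose_pCons algebra_simps)

lemma sigma_pow_eq_0_iff [simp]: "sigma_pow i p = 0 \<longleftrightarrow> p = 0"
  by (metis sigma_pow_simps(5) sigma_pow_sigma_pow sigma_pow_zero add.left_inverse)

lemma sigma_pow_sum: "sigma_pow i (sum f A) = (\<Sum>x\<in>A. sigma_pow i (f x))"
  by (induction A rule: infinite_finite_induct) auto

lemma sigma_pow_prod: "sigma_pow i (prod f A) = (\<Prod>x\<in>A. sigma_pow i (f x))"
  by (induction A rule: infinite_finite_induct) auto

lemma sigma_pow_dvd: "p dvd q \<Longrightarrow> sigma_pow i p dvd sigma_pow i q"
  by (auto elim!: dvdE)

lemma degree_sigma_pow [simp]: "Polynomial.degree (sigma_pow i p) = Polynomial.degree p"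
  by (simp add: sigma_pow_def degree_pcompose)

instantiation skew :: (field) ab_group_add
begin
lift_definition zero_skew :: "'a skew" is "\<lambda>_. 0" by simp
lift_definition plus_skew :: "'a skew \<Rightarrow> 'a skew \<Rightarrow> 'a skew" is "\<lambda>F G i. F i + G i"
  subgoal for F G by (rule finite_subset[of _ "{i. F i \<noteq> 0} \<union> {i. G i \<noteq> 0}"]) auto done
lift_definition uminus_skew :: "'a skew \<Rightarrow> 'a skew" is "\<lambda>F i. - F i" by simp
lift_definition minus_skew :: "'a skew \<Rightarrow> 'a skew \<Rightarrow> 'a skew" is "\<lambda>F G i. F i - G i"
  subgoal for F G by (rule finite_subset[of _ "{i. F i \<noteq> 0} \<union> {i. G i \<noteq> 0}"]) auto done
instance by standard (transfer; simp add: fun_eq_iff)+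
end

lemma skew_coeff_simps [simp]:
  "skew_coeff 0 i = 0" "skew_coeff (F + G) i = skew_coeff F i + skew_coeff G i" "skew_coeff (- F) i
      = - skew_coeff F i"
  "skew_coeff (F - G) i = skew_coeff F i - skew_coeff G i"
  by (transfer; simp)+

lemma skew_coeff_sum: "skew_coeff (sum f A) i = (\<Sum>x\<in>A. skew_coeff (f x) i)"
  by (induction A rule: infinite_finite_induct) auto

definition skew_monom :: "int \<Rightarrow> 'k::field poly \<Rightarrow> 'k skew"
  where "skew_monom i p = Abs_skew (\<lambda>j. if j = i then p else 0)"

lemma skew_coeff_skew_monom [simp]: "skew_coeff (skew_monom i p) j = (if j = i then p else 0)"
  unfolding skew_monom_def by (subst Abs_skew_inverse) auto

lemma skew_monom_add: "skew_monom i (p + q) = skew_monom i p + skew_monom i q"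
  by (rule skew_eqI) auto

lemma skew_monom_0 [simp]: "skew_monom i 0 = 0"
  by (rule skew_eqI) auto

lemma sum_support:
  "finite A \<Longrightarrow> {i. skew_coeff F i \<noteq> 0} \<subseteq> A \<Longrightarrow>
   (\<Sum>i\<in>{i. skew_coeff F i \<noteq> 0}. skew_coeff F i * g i) = (\<Sum>i\<in>A. skew_coeff F i * g i)"
  by (rule sum.mono_neutral_left) auto

instantiation skew :: (field) ring_1
begin

lift_definition one_skew :: "'a skew" is "\<lambda>i. if i = 0 then 1 else 0" by simp

text \<open>Moving \<open>t^i\<close> past a coefficient applies \<open>\<sigma>^i\<close> to it; hence the twist in the convolution.\<close>

definition times_fun :: "'a skew \<Rightarrow> 'a skew \<Rightarrow> int \<Rightarrow> 'a poly" where
  "times_fun F G = (\<lambda>m. \<Sum>i | skew_coeff F i \<noteq> 0. skew_coeff F i * sigma_pow i (skew_coeff G (m - i)))"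

lemma finite_times_fun: "finite {m. times_fun F G m \<noteq> 0}"
proof (rule finite_subset)
  show "{m. times_fun F G m \<noteq> 0} \<subseteq> (\<lambda>(i,j). i + j) ` ({i. skew_coeff F i \<noteq> 0} \<times> {i. skew_coeff G i \<noteq>
      0})"
  proof
    fix m assume "m \<in> {m. times_fun F G m \<noteq> 0}"
    then obtain i where "skew_coeff F i * sigma_pow i (skew_coeff G (m - i)) \<noteq> 0"
      unfolding times_fun_def by (auto elim: sum.not_neutral_contains_not_neutral)
    then show "m \<in> (\<lambda>(i,j). i + j) ` ({i. skew_coeff F i \<noteq> 0} \<times> {i. skew_coeff G i \<noteq> 0})"
      by (auto intro!: image_eqI[of _ _ "(i, m - i)"])
  qed
qed (auto simp: finite_skew_coeff)

definition times_skew :: "'a skew \<Rightarrow> 'a skew \<Rightarrow> 'a skew" where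
  "F * G = Abs_skew (times_fun F G)"

lemma skew_coeff_times:
  "skew_coeff (F * G) m = (\<Sum>i | skew_coeff F i \<noteq> 0. skew_coeff F i * sigma_pow i (skew_coeff G (m -
      i)))"
proof -
  have "skew_coeff (F * G) = times_fun F G"
    unfolding times_skew_def by (rule Abs_skew_inverse) (simp add: finite_times_fun)
  then show ?thesis by (simp add: times_fun_def)
qed

lemma skew_coeff_times_superset:
  assumes "finite A" "{i. skew_coeff F i \<noteq> 0} \<subseteq> A"
  shows "skew_coeff (F * G) m = (\<Sum>i\<in>A. skew_coeff F i * sigma_pow i (skew_coeff G (m - i)))"
  unfolding skew_coeff_times using assms by (rule sum_support)

instance
proof
  fix F G H :: "'a skew"
  show "(F + G) * H = F * H + G * H"
  proof (rule skew_eqI)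
    fix m
    let ?A = "{i. skew_coeff F i \<noteq> 0} \<union> {i. skew_coeff G i \<noteq> 0}"
    have *: "finite ?A" by (simp add: finite_skew_coeff)
    show "skew_coeff ((F + G) * H) m = skew_coeff (F * H + G * H) m"
      by (subst skew_coeff_times_superset[OF *], force)
        (simp add: skew_coeff_times_superset[OF *] algebra_simps sum.distrib)
  qed
  show "F * (G + H) = F * G + F * H"
    by (rule skew_eqI) (simp add: skew_coeff_times algebra_simps sum.distrib)
  show "1 * F = F"
    by (rule skew_eqI, subst skew_coeff_times_superset[of "{0}"]) (auto simp: one_skew.rep_eq)
  show "F * 1 = F"
  proof (rule skew_eqI)
    fix m
    have "skew_coeff (F * 1) m = (\<Sum>i\<in>{i. skew_coeff F i \<noteq> 0}. if i = m then skew_coeff F i else 0)"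
      unfolding skew_coeff_times by (rule sum.cong) (auto simp: one_skew.rep_eq)
    also have "\<dots> = skew_coeff F m" by (simp add: finite_skew_coeff sum.delta)
    finally show "skew_coeff (F * 1) m = skew_coeff F m" .
  qed
  have "skew_coeff (1 :: 'a skew) 0 \<noteq> skew_coeff 0 0" by (simp add: one_skew.rep_eq)
  then show "(0 :: 'a skew) \<noteq> 1" by metis
  show "F * G * H = F * (G * H)"
  proof (rule skew_eqI)
    fix m
    let ?A = "{i. skew_coeff F i \<noteq> 0}" and ?B = "{i. skew_coeff G i \<noteq> 0}"
    let ?C = "(\<lambda>(i,j). i + j) ` (?A \<times> ?B)"
    have fin: "finite ?A" "finite ?B" by (simp_all add: finite_skew_coeff)
    have sub: "{i. skew_coeff (F * G) i \<noteq> 0} \<subseteq> ?C"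
      (is "?S \<subseteq> _")
    proof
      fix k assume "k \<in> ?S"
      then obtain i where "skew_coeff F i * sigma_pow i (skew_coeff G (k - i)) \<noteq> 0"
        unfolding skew_coeff_times by (auto elim: sum.not_neutral_contains_not_neutral)
      then show "k \<in> ?C" by (auto intro!: image_eqI[of _ _ "(i, k - i)"])
    qed
    \<comment> \<open>Both bracketings are the sum of all \<open>F\<^sub>i \<sigma>^i(G\<^sub>j) \<sigma>^(i+j)(H\<^sub>l)\<close> with \<open>i + j + l = m\<close>.\<close>
    have "skew_coeff (F * G * H) m = (\<Sum>k\<in>?C. skew_coeff (F * G) k * sigma_pow k (skew_coeff H (m - k)))"
      by (rule skew_coeff_times_superset) (use fin sub in auto)
    also have "\<dots> = (\<Sum>k\<in>?C. \<Sum>i\<in>?A. skew_coeff F i * sigma_pow i (skew_coeff G (k - i)) * sigma_pow k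
        (skew_coeff H (m - k)))"
      by (simp add: skew_coeff_times sum_distrib_right)
    also have "\<dots> = (\<Sum>i\<in>?A. \<Sum>k\<in>?C. skew_coeff F i * sigma_pow i (skew_coeff G (k - i)) * sigma_pow k
        (skew_coeff H (m - k)))"
      by (rule sum.swap)
    also have "\<dots> = (\<Sum>i\<in>?A. skew_coeff F i * sigma_pow i (skew_coeff (G * H) (m - i)))"
    proof (rule sum.cong[OF refl])
      fix i assume i: "i \<in> ?A"
      have "(\<Sum>k\<in>?C. skew_coeff F i * sigma_pow i (skew_coeff G (k - i)) * sigma_pow k (skew_coeff H
          (m - k)))
        = (\<Sum>k\<in>(\<lambda>j. i + j) ` ?B. skew_coeff F i * sigma_pow i (skew_coeff G (k - i)) * sigma_pow k
            (skew_coeff H (m - k)))"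
      proof (rule sum.mono_neutral_right)
        show "\<forall>k\<in>?C - (\<lambda>j. i + j) ` ?B.
          skew_coeff F i * sigma_pow i (skew_coeff G (k - i)) * sigma_pow k (skew_coeff H (m - k)) = 0"
        proof
          fix k assume "k \<in> ?C - (\<lambda>j. i + j) ` ?B"
          then have "k - i \<notin> ?B" by (force simp: image_iff)
          then show "skew_coeff F i * sigma_pow i (skew_coeff G (k - i)) * sigma_pow k (skew_coeff H
              (m - k)) = 0" by simp
        qed
      qed (use fin i in auto)
      also have "\<dots> = (\<Sum>j\<in>?B. skew_coeff F i * sigma_pow i (skew_coeff G j) * sigma_pow (i
          + j) (skew_coeff H (m - (i + j))))"
        by (subst sum.reindex) (auto simp: inj_on_def)
      also have "\<dots> = skew_coeff F i * sigma_pow i (skew_coeff (G * H) (m - i))"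
        by (simp add: skew_coeff_times sigma_pow_sum sum_distrib_left mult.assoc diff_diff_eq)
      finally show "(\<Sum>k\<in>?C. skew_coeff F i * sigma_pow i (skew_coeff G (k - i)) * sigma_pow k
          (skew_coeff H (m - k)))
        = skew_coeff F i * sigma_pow i (skew_coeff (G * H) (m - i))" .
    qed
    finally show "skew_coeff (F * G * H) m = skew_coeff (F * (G * H)) m" by (simp add: skew_coeff_times)
  qed
qed

end

lemma skew_coeff_one: "skew_coeff 1 i = (if i = 0 then 1 else 0)"
  by (transfer; simp)

lemma one_skew_monom: "1 = skew_monom 0 1"
  by (rule skew_eqI) (simp add: skew_coeff_one)

lemma skew_monom_mult [simp]:
  "skew_monom i p * skew_monom j q = skew_monom (i + j) (p * sigma_pow i q)"
  by (rule skew_eqI, subst skew_coeff_times_superset[of "{i}"]) auto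

lemma skew_coeff_skew_monom_times:
  "skew_coeff (skew_monom i p * F) m = p * sigma_pow i (skew_coeff F (m - i))"
  by (subst skew_coeff_times_superset[of "{i}"]) auto

lemma skew_coeff_times_skew_monom:
  "skew_coeff (F * skew_monom j q) m = skew_coeff F (m - j) * sigma_pow (m - j) q"
proof -
  have "skew_coeff (F * skew_monom j q) m = (\<Sum>i | skew_coeff F i \<noteq> 0. if i
      = m - j then skew_coeff F i * sigma_pow i q else 0)"
    unfolding skew_coeff_times by (rule sum.cong) auto
  then show ?thesis by (simp add: finite_skew_coeff)
qed

section \<open>Evaluation of the free algebra\<close>

text \<open>Polynomials are evaluated both in the free algebra and in the skew Laurent ring. Neither
  is commutative, but evaluation at one element only requires central scalars.\<close>

locale central_scalars =
  fixes s :: "'k::field \<Rightarrow> 'r::ring_1"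
  assumes s_add: "s (c + d) = s c + s d" and s_mult: "s (c * d) = s c * s d"
    and s_1: "s 1 = 1" and s_comm: "s c * r = r * s c"
begin

lemma s_left_comm: "r * (s c * r') = s c * (r * r')"
  by (metis mult.assoc s_comm)

lemma s_0: "s 0 = 0" using s_add[of 0 0] by simp

definition poly_at :: "'r \<Rightarrow> 'k poly \<Rightarrow> 'r"
  where "poly_at Z d = (\<Sum>i\<le>Polynomial.degree d. s (Polynomial.coeff d i) * Z ^ i)"

lemma poly_at_superset:
  "Polynomial.degree d \<le> n \<Longrightarrow> poly_at Z d = (\<Sum>i\<le>n. s (Polynomial.coeff d i) * Z ^ i)"
  unfolding poly_at_def by (rule sum.mono_neutral_left) (auto simp: s_0 coeff_eq_0)

lemma poly_at_add: "poly_at Z (p + q) = poly_at Z p + poly_at Z q"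
proof -
  let ?n = "max (Polynomial.degree p) (Polynomial.degree q)"
  have "Polynomial.degree (p + q) \<le> ?n" by (rule degree_add_le_max)
  then show ?thesis
    by (simp add: poly_at_superset[of _ ?n] s_add ring_distribs sum.distrib)
qed

lemma poly_at_0 [simp]: "poly_at Z 0 = 0" by (simp add: poly_at_def s_0)

lemma poly_at_const [simp]: "poly_at Z [:c:] = s c" by (simp add: poly_at_def)

lemma poly_at_1 [simp]: "poly_at Z 1 = 1" by (simp add: one_pCons s_1)

lemma poly_at_pCons: "poly_at Z (pCons c p) = s c + Z * poly_at Z p"
proof -
  have "poly_at Z (pCons c p) = (\<Sum>i\<le>Suc (Polynomial.degree p). s (Polynomial.coeff (pCons c p) i) *
      Z ^ i)"
    by (rule poly_at_superset) (rule degree_pCons_le)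
  also have "\<dots> = s c + (\<Sum>i\<le>Polynomial.degree p. s (Polynomial.coeff p i) * (Z * Z ^ i))"
    by (simp del: sum.atMost_Suc add: sum.atMost_Suc_shift)
  also have "(\<Sum>i\<le>Polynomial.degree p. s (Polynomial.coeff p i) * (Z * Z ^ i)) = Z * poly_at Z p"
    unfolding poly_at_def sum_distrib_left
    by (rule sum.cong) (simp_all add: s_left_comm)
  finally show ?thesis .
qed

lemma poly_at_smult: "poly_at Z (Polynomial.smult c p) = s c * poly_at Z p"
  by (induction p) (simp_all add: poly_at_pCons s_mult ring_distribs s_left_comm)

lemma poly_at_mult: "poly_at Z (p * q) = poly_at Z p * poly_at Z q"
  by (induction p) (auto simp: poly_at_pCons poly_at_add poly_at_smult ring_distribs mult.assoc s_0)

text \<open>A single commutation rule for \<open>z\<close> stands for the infinite family of rules for polynomials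
  in \<open>z\<close>.\<close>

lemma poly_at_shift_commute:
  assumes "U * Z = (Z + s c) * U"
  shows "U * poly_at Z d = poly_at Z (pcompose d [:c, 1:]) * U"
proof (induction d)
  case (pCons e d)
  have "U * poly_at Z (pCons e d) = U * s e + U * Z * poly_at Z d"
    by (simp add: poly_at_pCons ring_distribs mult.assoc)
  also have "\<dots> = s e * U + (Z + s c) * (U * poly_at Z d)"
    using assms by (simp add: s_comm[of e] mult.assoc)
  also have "\<dots> = poly_at Z (pcompose (pCons e d) [:c, 1:]) * U"
    unfolding pCons.IH
    by (simp add: pcompose_pCons poly_at_add poly_at_mult poly_at_pCons poly_at_smult s_0 s_1
        ring_distribs mult.assoc)
  finally show ?case .
qed simp

end

definition skew_poly :: "'k::field poly \<Rightarrow> 'k skew" where "skew_poly d = skew_monom 0 d"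

definition skew_scalar :: "'k::field \<Rightarrow> 'k skew" where "skew_scalar c = skew_poly [:c:]"

lemma skew_poly_simps:
  "skew_poly 0 = 0" "skew_poly 1 = 1" "skew_poly (p + q) = skew_poly p + skew_poly q"
      "skew_poly (p * q) = skew_poly p * skew_poly q"
  "skew_poly (p - q) = skew_poly p - skew_poly q" "skew_poly (- p) = - skew_poly p"
  by (auto simp: skew_poly_def one_skew_monom skew_monom_add intro!: skew_eqI)

lemma skew_coeff_skew_poly [simp]: "skew_coeff (skew_poly p) i = (if i = 0 then p else 0)"
  by (simp add: skew_poly_def)

lemma skew_coeff_skew_poly_times [simp]: "skew_coeff (skew_poly p * F) i = p * skew_coeff F i"
  by (simp add: skew_poly_def skew_coeff_skew_monom_times)

lemma skew_coeff_skew_scalar_times [simp]: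
  "skew_coeff (skew_scalar c * F) i = Polynomial.smult c (skew_coeff F i)"
  by (simp add: skew_scalar_def)

lemma skew_coeff_times_skew_scalar:
  "skew_coeff (F * skew_scalar c) i = Polynomial.smult c (skew_coeff F i)"
  by (simp add: skew_scalar_def skew_poly_def skew_coeff_times_skew_monom)

lemma central_scalars_skew_scalar: "central_scalars skew_scalar"
proof
  show "skew_scalar c * r = r * skew_scalar c" for c :: "'a::field" and r
    by (rule skew_eqI) (simp add: skew_coeff_times_skew_scalar)
qed (simp_all add: skew_scalar_def skew_poly_simps(3,4)[symmetric] skew_poly_simps(2) mult.commute
    flip: one_pCons)

interpretation sk: central_scalars skew_scalar by (rule central_scalars_skew_scalar)

lemma skew_scalar_simps:
  "skew_scalar 0 = 0" "skew_scalar 1 = 1" "skew_scalar (c + d) = skew_scalar c + skew_scalar d"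
      "skew_scalar (c * d) = skew_scalar c * skew_scalar d"
  "skew_scalar (c - d) = skew_scalar c - skew_scalar d" "skew_scalar (- c) = - skew_scalar c"
proof -
  show "skew_scalar (c - d) = skew_scalar c - skew_scalar d" "skew_scalar (- c) = - skew_scalar c"
    using skew_poly_simps(5)[of "[:c:]" "[:d:]"] skew_poly_simps(6)[of "[:c:]"]
        by (simp_all add: skew_scalar_def)
qed (simp_all add: sk.s_0 sk.s_1 sk.s_add sk.s_mult)

lemma free_expand:
  "p = (\<Sum>w\<in>Poly_Mapping.keys p. Poly_Mapping.single w (Poly_Mapping.lookup p w))" for p ::
      "'a \<Rightarrow>\<^sub>0 'b::comm_monoid_add"
proof (rule poly_mapping_eqI)
  fix k
  have "Poly_Mapping.lookup (\<Sum>w\<in>Poly_Mapping.keys p. Poly_Mapping.single w (Poly_Mapping.lookup p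
      w)) k = (\<Sum>w\<in>Poly_Mapping.keys p. if k = w then Poly_Mapping.lookup p w else 0)"
    by (auto simp: lookup_sum lookup_single when_def intro!: sum.cong)
  then show "Poly_Mapping.lookup p k = Poly_Mapping.lookup (\<Sum>w\<in>Poly_Mapping.keys p.
      Poly_Mapping.single w (Poly_Mapping.lookup p w)) k"
    by (simp add: in_keys_iff)
qed

lemma free_induct [case_names zero single add]:
  fixes p :: "'a \<Rightarrow>\<^sub>0 'b::comm_monoid_add"
  assumes "P 0" "\<And>w c. P (Poly_Mapping.single w c)" "\<And>p q. P p \<Longrightarrow> P q \<Longrightarrow> P (p + q)"
  shows "P p"
proof -
  have "P (\<Sum>w\<in>A. Poly_Mapping.single w (Poly_Mapping.lookup p w))" for A
    by (induction A rule: infinite_finite_induct) (use assms in auto)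
  then show ?thesis by (subst free_expand)
qed

lemma central_scalars_free_scalar: "central_scalars free_scalar"
proof
  show "free_scalar c * r = r * free_scalar c" for c :: "'a::field" and r
    by (induction r rule: free_induct)
      (auto simp: free_scalar_def mult_single mult.commute ring_distribs)
qed (simp_all add: free_scalar_def single_add mult_single)

interpretation fr: central_scalars free_scalar by (rule central_scalars_free_scalar)

lemma free_poly_poly_at: "free_poly d = fr.poly_at (free_gen Gen_z) d"
  by (simp add: free_poly_def fr.poly_at_def)

lemma poly_at_z: "sk.poly_at (skew_poly [:0, 1:]) d = skew_poly d"
proof (induction d)
  case (pCons c d)
  have "sk.poly_at (skew_poly [:0, 1:]) (pCons c d) = skew_poly [:c:] + skew_poly ([:0,1:] * d)"
    by (simp only: sk.poly_at_pCons pCons.IH skew_poly_simps skew_scalar_def)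
  also have "\<dots> = skew_poly (pCons c d)" by (simp flip: skew_poly_simps)
  finally show ?case .
qed (simp add: skew_poly_simps)

definition wordval :: "(gwa_gen \<Rightarrow> 'k::field skew) \<Rightarrow> gwa_word \<Rightarrow> 'k skew"
  where "wordval U w = prod_list (map U (letters w))"

lemma wordval_simps: "wordval U 0 = 1" "wordval U (u + v) = wordval U u * wordval U v"
  "wordval U (Word [g]) = U g"
  by (simp_all add: wordval_def zero_gwa_word_def plus_gwa_word_def)

definition free_eval :: "(gwa_gen \<Rightarrow> 'k::field skew) \<Rightarrow> 'k free_xyz \<Rightarrow> 'k skew"
  where "free_eval U p = (\<Sum>w\<in>Poly_Mapping.keys p. skew_scalar (Poly_Mapping.lookup p w) * wordval U w)"

lemma free_eval_superset:
  "finite A \<Longrightarrow> Poly_Mapping.keys p \<subseteq> A \<Longrightarrow> free_eval U p = (\<Sum>w\<in>A. skew_scalar (Poly_Mapping.lookup p w)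
      * wordval U w)"
  unfolding free_eval_def by (rule sum.mono_neutral_left) (auto simp: in_keys_iff skew_scalar_simps)

lemma free_eval_0 [simp]: "free_eval U 0 = 0" by (simp add: free_eval_def)

lemma free_eval_single: "free_eval U (Poly_Mapping.single w c) = skew_scalar c * wordval U w"
  by (subst free_eval_superset[of "{w}"]) auto

lemma free_eval_add: "free_eval U (p + q) = free_eval U p + free_eval U q"
proof -
  let ?A = "Poly_Mapping.keys p \<union> Poly_Mapping.keys q"
  have "free_eval U (p + q) = (\<Sum>w\<in>?A. skew_scalar (Poly_Mapping.lookup (p + q) w) * wordval U w)"
    by (rule free_eval_superset) (simp_all add: Poly_Mapping.keys_add)
  also have "\<dots> = (\<Sum>w\<in>?A. skew_scalar (Poly_Mapping.lookup p w) * wordval U w)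
      + (\<Sum>w\<in>?A. skew_scalar (Poly_Mapping.lookup q w) * wordval U w)"
    by (simp only: lookup_add skew_scalar_simps distrib_right sum.distrib)
  also have "\<dots> = free_eval U p + free_eval U q"
    by (subst (1 2) free_eval_superset[of ?A]) simp_all
  finally show ?thesis .
qed

lemma free_eval_diff: "free_eval U (p - q) = free_eval U p - free_eval U q"
  using free_eval_add[of U "p - q" q] by simp

lemma free_eval_mult: "free_eval U (p * q) = free_eval U p * free_eval U q"
proof (induction p rule: free_induct)
  case (single u c)
  show ?case
  proof (induction q rule: free_induct)
    case (single v d)
    then show ?case
      by (simp only: mult_single free_eval_single skew_scalar_simps(4) wordval_simps(2) mult.assoc
          sk.s_left_comm[of "wordval U u"])
  qed (simp_all add: free_eval_add ring_distribs)
qed (simp_all add: free_eval_add ring_distribs)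

lemma free_eval_scalar [simp]: "free_eval U (free_scalar c) = skew_scalar c"
  by (simp add: free_scalar_def free_eval_single wordval_simps)

lemma free_eval_gen [simp]: "free_eval U (free_gen g) = U g"
  by (simp add: free_gen_def free_eval_single wordval_simps skew_scalar_simps)

lemma free_eval_1 [simp]: "free_eval U 1 = 1"
  using free_eval_scalar[of U 1] by (simp add: fr.s_1 sk.s_1)

lemma free_eval_power: "free_eval U (p ^ n) = free_eval U p ^ n"
  by (induction n) (auto simp: free_eval_mult)

lemma free_eval_poly: "free_eval U (free_poly d) = sk.poly_at (U Gen_z) d"
  unfolding free_poly_poly_at by (induction d) (auto simp: fr.poly_at_pCons sk.poly_at_pCons
      free_eval_add free_eval_mult)

text \<open>Since normal forms are computed by multiplying with generators from the left, induction
  over the free algebra is needed in this one-sided form.\<close>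

lemma free_gen_induct [case_names one scalar add gen]:
  fixes p :: "'k::field free_xyz"
  assumes one: "P 1" and scalar: "\<And>c p. P p \<Longrightarrow> P (free_scalar c * p)"
    and add: "\<And>p q. P p \<Longrightarrow> P q \<Longrightarrow> P (p + q)" and gen: "\<And>g p. P p \<Longrightarrow> P (free_gen g * p)"
  shows "P p"
proof -
  have w: "P (Poly_Mapping.single (Word l) 1)" for l
  proof (induction l)
    case Nil
    have "Poly_Mapping.single (Word []) 1 = (1 :: 'k free_xyz)" by (simp flip: zero_gwa_word_def)
    with one show ?case by simp
  next
    case (Cons g l)
    have "Word (g # l) = Word [g] + Word l" by (simp add: plus_gwa_word_def)
    then have "Poly_Mapping.single (Word (g # l)) (1 :: 'k) = free_gen g * Poly_Mapping.single (Word
        l) 1"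
      by (simp add: free_gen_def mult_single)
    with gen[OF Cons] show ?case by simp
  qed
  have s: "P (Poly_Mapping.single v c)" for v c
    using scalar[OF w, of c "letters v"] by (simp add: free_scalar_def mult_single)
  have "P 0" using s[of 0 0] by simp
  then show ?thesis by (induction p rule: free_induct) (auto intro: s add)
qed

section \<open>Normal forms and the graded model\<close>


lemma ring_free: "ring (free_xyz :: 'k::field free_xyz ring)"
proof -
  have "\<exists>y. x + y = 0" for x :: "'k free_xyz"
    using add.right_inverse by blast
  thus ?thesis
    unfolding ring_of_type_algebra_def using add.right_inverse
    by unfold_locales (auto simp: algebra_simps Units_def)
qed

lemma free_sel [simp]: "carrier (free_xyz :: 'k::field free_xyz ring) = UNIV"
  "monoid.mult (free_xyz :: 'k free_xyz ring) = (*)" "ring.add (free_xyz :: 'k free_xyz ring) = (+)"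
  "monoid.one (free_xyz :: 'k free_xyz ring) = 1" "ring.zero (free_xyz :: 'k free_xyz ring) = 0"
  by (auto simp: ring_of_type_algebra_def)

lemma free_minus [simp]: "a_inv (free_xyz :: 'k::field free_xyz ring) p = - p"
proof -
  interpret ring "free_xyz :: 'k free_xyz ring" by (rule ring_free)
  show ?thesis by (rule minus_equality) auto
qed

lemma ideal_gwa: "ideal (gwa_ideal a) free_xyz"
  unfolding gwa_ideal_def using ring_free by (rule ring.genideal_ideal) simp

lemma gwa_ideal_closed:
  "0 \<in> gwa_ideal a" "p \<in> gwa_ideal a \<Longrightarrow> q \<in> gwa_ideal a \<Longrightarrow> p + q \<in> gwa_ideal a"
  "p \<in> gwa_ideal a \<Longrightarrow> - p \<in> gwa_ideal a"
  "p \<in> gwa_ideal a \<Longrightarrow> q \<in> gwa_ideal a \<Longrightarrow> p - q \<in> gwa_ideal a"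
  "p \<in> gwa_ideal a \<Longrightarrow> r * p \<in> gwa_ideal a" "p \<in> gwa_ideal a \<Longrightarrow> p * r \<in> gwa_ideal a"
proof -
  interpret ideal "gwa_ideal a" free_xyz by (rule ideal_gwa)
  show A: "0 \<in> gwa_ideal a" using additive_subgroup.zero_closed[OF additive_subgroup_axioms] by simp
  show B: "p \<in> gwa_ideal a \<Longrightarrow> q \<in> gwa_ideal a \<Longrightarrow> p + q \<in> gwa_ideal a" for p q
    using additive_subgroup.a_closed[OF additive_subgroup_axioms, of p q] by simp
  show C: "p \<in> gwa_ideal a \<Longrightarrow> - p \<in> gwa_ideal a" for p
    using additive_subgroup.a_inv_closed[OF additive_subgroup_axioms, of p] by simp
  show "p \<in> gwa_ideal a \<Longrightarrow> q \<in> gwa_ideal a \<Longrightarrow> p - q \<in> gwa_ideal a"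
    using B[OF _ C] by (metis diff_conv_add_uminus)
  show "p \<in> gwa_ideal a \<Longrightarrow> r * p \<in> gwa_ideal a" "p \<in> gwa_ideal a \<Longrightarrow> p * r \<in> gwa_ideal a"
    using I_l_closed[of p r] I_r_closed[of p r] by simp_all
qed

lemma gwa_relations_ideal: "p \<in> gwa_relations a \<Longrightarrow> p \<in> gwa_ideal a"
  unfolding gwa_ideal_def using ring.genideal_self[OF ring_free] by auto

text \<open>The commutation rules are demanded for \<open>z\<close> only; \<open>poly_at_shift_commute\<close> extends them to
  all polynomials in \<open>z\<close>.\<close>

definition gwa_triple :: "'k::field poly \<Rightarrow> (gwa_gen \<Rightarrow> 'k skew) \<Rightarrow> bool" where
  "gwa_triple a U \<longleftrightarrow> U Gen_x * U Gen_z = (U Gen_z - 1) * U Gen_x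
     \<and> U Gen_y * U Gen_z = (U Gen_z + 1) * U Gen_y
     \<and> U Gen_x * U Gen_y = sk.poly_at (U Gen_z) (gwa_sigma a)
     \<and> U Gen_y * U Gen_x = sk.poly_at (U Gen_z) a"

lemma ideal_ker_free_eval: "ideal {p. free_eval U p = 0} free_xyz"
proof (rule idealI[OF ring_free])
  have "subgroup {p. free_eval U p = 0} (add_monoid free_xyz)"
  proof (rule group.subgroupI)
    show "group (add_monoid (free_xyz :: 'a free_xyz ring))"
      using abelian_group.a_group[OF ring.is_abelian_group[OF ring_free]] .
    fix p assume p: "p \<in> {p. free_eval U p = 0}"
    have "inv\<^bsub>add_monoid free_xyz\<^esub> p = - p" by (metis a_inv_def free_minus)
    with p show "inv\<^bsub>add_monoid free_xyz\<^esub> p \<in> {p. free_eval U p = 0}"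
      using free_eval_diff[of U 0 p] by simp
  qed (auto simp: free_eval_add intro: exI[of _ 0])
  then show "subgroup {p. free_eval U p = 0} (add_monoid free_xyz)" .
qed (auto simp: free_eval_mult)

text \<open>This is the universal property of the presentation: the kernel of the evaluation is an
  ideal that contains the defining relations.\<close>

lemma free_eval_gwa_ideal:
  assumes "gwa_triple a U" "p \<in> gwa_ideal a"
  shows "free_eval U p = 0"
proof -
  have 1: "U Gen_x * sk.poly_at (U Gen_z) d = sk.poly_at (U Gen_z) (gwa_sigma d) * U Gen_x" for d
    unfolding gwa_sigma_def using assms(1)
    by (intro sk.poly_at_shift_commute) (simp add: gwa_triple_def skew_scalar_simps)
  have 2: "U Gen_y * sk.poly_at (U Gen_z) d = sk.poly_at (U Gen_z) (gwa_sigma_inv d) * U Gen_y" for d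
    unfolding gwa_sigma_inv_def using assms(1)
    by (intro sk.poly_at_shift_commute) (simp add: gwa_triple_def skew_scalar_simps)
  have "gwa_ideal a \<subseteq> {p. free_eval U p = 0}"
    unfolding gwa_ideal_def
    by (rule ring.genideal_minimal[OF ring_free ideal_ker_free_eval])
      (use assms(1) 1 2 in \<open>auto simp: gwa_relations_def free_eval_diff free_eval_mult
          free_eval_poly gwa_triple_def Let_def\<close>)
  with assms(2) show ?thesis by auto
qed

text \<open>The coefficient of \<open>y^m\<close> with respect to \<open>t^(-m)\<close>, extended by \<open>1\<close> to the powers of \<open>x\<close>.\<close>

definition lower_factor :: "'k::field poly \<Rightarrow> int \<Rightarrow> 'k poly" where
  "lower_factor a i = (\<Prod>j<nat (- i). sigma_pow (- int j) a)"

fun std_gens :: "'k::field poly \<Rightarrow> gwa_gen \<Rightarrow> 'k skew" where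
  "std_gens a Gen_x = skew_monom 1 1" | "std_gens a Gen_y = skew_monom (-1) a" | "std_gens a Gen_z
      = skew_poly [:0, 1:]"

lemma gwa_sigma_sigma_pow: "gwa_sigma d = sigma_pow 1 d" "gwa_sigma_inv d = sigma_pow (-1) d"
  by (simp_all add: gwa_sigma_def gwa_sigma_inv_def sigma_pow_def)

lemma sigma_pow_z: "sigma_pow i [:0, 1:] = [:- of_int i, 1:]"
  by (simp add: sigma_pow_def pcompose_pCons)

lemma gwa_triple_std_gens: "gwa_triple a (std_gens a)"
proof -
  have "skew_poly [:0, 1:] - 1 = skew_poly ([:0, 1:] - 1 :: 'a poly)" "skew_poly [:0, 1:] + 1
      = skew_poly ([:0, 1:] + 1 :: 'a poly)"
    by (simp_all only: skew_poly_simps)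
  then show ?thesis
    by (simp add: gwa_triple_def poly_at_z gwa_sigma_sigma_pow)
      (simp add: skew_poly_def sigma_pow_z one_pCons)
qed

lemma x_power: "skew_monom 1 1 ^ m = skew_monom (int m) 1"
  by (induction m) (auto simp: one_skew_monom)

lemma lower_factor_neg: "lower_factor a (- int m) = (\<Prod>j<m. sigma_pow (- int j) a)"
  by (simp add: lower_factor_def)

lemma y_power: "skew_monom (-1) a ^ m = skew_monom (- int m) (lower_factor a (- int m))"
proof (induction m)
  case (Suc m)
  have "- int m + - 1 = - int (Suc m)" by simp
  moreover have "lower_factor a (- int m) * sigma_pow (- int m) a = lower_factor a (- int (Suc m))"
    unfolding lower_factor_neg by simp
  ultimately show ?case
    by (simp only: Suc power_Suc2 skew_monom_mult)
qed (simp add: one_skew_monom lower_factor_def)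

definition xy_power :: "int \<Rightarrow> 'k::field free_xyz" where
  "xy_power i = (if 0 \<le> i then free_gen Gen_x ^ nat i else free_gen Gen_y ^ nat (- i))"

definition normal_form :: "nat \<Rightarrow> (int \<Rightarrow> 'k::field poly) \<Rightarrow> 'k free_xyz" where
  "normal_form k f = (\<Sum>i\<in>{- int k..int k}. free_poly (f i) * xy_power i)"

lemma xy_power_nat:
  "xy_power (int m) = free_gen Gen_x ^ m" "xy_power (- int m) = free_gen Gen_y ^ m"
  by (auto simp: xy_power_def)

lemma free_eval_xy_power: "free_eval (std_gens a) (xy_power i) = skew_monom i (lower_factor a i)"
  by (auto simp: xy_power_def free_eval_power x_power y_power lower_factor_def)

lemma free_eval_term:
  "free_eval (std_gens a) (free_poly d * xy_power i) = skew_monom i (d * lower_factor a i)"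
  by (simp add: free_eval_mult free_eval_poly free_eval_xy_power poly_at_z) (simp add: skew_poly_def)

lemma free_eval_sum: "free_eval U (sum f A) = (\<Sum>x\<in>A. free_eval U (f x))"
  by (induction A rule: infinite_finite_induct) (auto simp: free_eval_add)

lemma skew_coeff_free_eval_normal_form:
  "skew_coeff (free_eval (std_gens a) (normal_form k f)) i = (if i \<in> {- int k..int k} then f i *
      lower_factor a i else 0)"
proof -
  have "skew_coeff (free_eval (std_gens a) (normal_form k f)) i = (\<Sum>j\<in>{- int k..int k}. if i
      = j then f j * lower_factor a j else 0)"
    by (simp add: normal_form_def free_eval_sum free_eval_term skew_coeff_sum)
  then show ?thesis by (simp add: sum.delta')
qed

definition gwa_cong :: "'k::field poly \<Rightarrow> 'k free_xyz \<Rightarrow> 'k free_xyz \<Rightarrow> bool" where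
  "gwa_cong a p q \<longleftrightarrow> p - q \<in> gwa_ideal a"

lemma gwa_cong_refl [simp]: "gwa_cong a p p"
  by (simp add: gwa_cong_def gwa_ideal_closed)

lemma gwa_cong_trans [trans]:
  "gwa_cong a p q \<Longrightarrow> gwa_cong a q r \<Longrightarrow> gwa_cong a p r"
  unfolding gwa_cong_def using gwa_ideal_closed(2)[of "p - q" a "q - r"] by simp

lemma gwa_cong_add:
  "gwa_cong a p q \<Longrightarrow> gwa_cong a p' q' \<Longrightarrow> gwa_cong a (p + p') (q + q')"
  unfolding gwa_cong_def using gwa_ideal_closed(2)[of "p - q" a "p' - q'"] by (simp add: algebra_simps)

lemma gwa_cong_left: "gwa_cong a p q \<Longrightarrow> gwa_cong a (r * p) (r * q)"
  unfolding gwa_cong_def using gwa_ideal_closed(5)[of "p - q" a r] by (simp add: algebra_simps)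

lemma gwa_cong_right: "gwa_cong a p q \<Longrightarrow> gwa_cong a (p * r) (q * r)"
  unfolding gwa_cong_def using gwa_ideal_closed(6)[of "p - q" a r] by (simp add: algebra_simps)

lemma gwa_cong_rel:
  "gwa_cong a (free_gen Gen_x * free_poly d) (free_poly (sigma_pow 1 d) * free_gen Gen_x)"
  "gwa_cong a (free_gen Gen_y * free_poly d) (free_poly (sigma_pow (-1) d) * free_gen Gen_y)"
  "gwa_cong a (free_gen Gen_x * free_gen Gen_y) (free_poly (sigma_pow 1 a))"
  "gwa_cong a (free_gen Gen_y * free_gen Gen_x) (free_poly a)"
  unfolding gwa_cong_def
  by (rule gwa_relations_ideal; auto simp: gwa_relations_def Let_def gwa_sigma_sigma_pow)+

lemma free_poly_mult: "free_poly (p * q) = free_poly p * free_poly q"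
  by (simp add: free_poly_poly_at fr.poly_at_mult)

definition has_normal_form :: "'k::field poly \<Rightarrow> 'k free_xyz \<Rightarrow> bool" where
  "has_normal_form a p \<longleftrightarrow> (\<exists>k f. gwa_cong a p (normal_form k f))"

lemma normal_form_superset:
  assumes "k \<le> l" "\<And>i. i \<notin> {- int k..int k} \<Longrightarrow> f i = 0"
  shows "normal_form k f = normal_form l f"
  unfolding normal_form_def by (rule sum.mono_neutral_left) (use assms in \<open>auto simp:
      free_poly_poly_at\<close>)

lemma normal_form_restrict:
  "normal_form k f = normal_form k (\<lambda>i. if i \<in> {- int k..int k} then f i else 0)"
  unfolding normal_form_def by (rule sum.cong) auto

lemma has_normal_form_add: assumes "has_normal_form a p" "has_normal_form a q" shows
    "has_normal_form a (p + q)"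
proof -
  from assms obtain k f l g where *: "gwa_cong a p (normal_form k f)" "gwa_cong a q (normal_form l g)"
    by (auto simp: has_normal_form_def)
  let ?m = "max k l"
  let ?f = "\<lambda>i. if i \<in> {- int k..int k} then f i else 0"
  let ?g = "\<lambda>i. if i \<in> {- int l..int l} then g i else 0"
  have "normal_form k f = normal_form ?m ?f" by (subst normal_form_restrict, rule
      normal_form_superset) auto
  moreover have "normal_form l g = normal_form ?m ?g" by (subst normal_form_restrict, rule
      normal_form_superset) auto
  moreover have "normal_form ?m ?f + normal_form ?m ?g = normal_form ?m (\<lambda>i. ?f i + ?g i)"
    unfolding normal_form_def by (simp only: free_poly_poly_at fr.poly_at_add distrib_right sum.distrib)
  ultimately show ?thesis using gwa_cong_add[OF *] by (auto simp: has_normal_form_def)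
qed

lemma has_normal_form_cong:
  "gwa_cong a p q \<Longrightarrow> has_normal_form a q \<Longrightarrow> has_normal_form a p"
  unfolding has_normal_form_def by (blast intro: gwa_cong_trans)

lemma has_normal_form_term: "has_normal_form a (free_poly d * xy_power i)"
proof -
  have "normal_form (nat \<bar>i\<bar>) (\<lambda>j. if j = i then d else 0)
     = (\<Sum>j\<in>{- int (nat \<bar>i\<bar>)..int (nat \<bar>i\<bar>)}. if j = i then free_poly d * xy_power i else 0)"
    unfolding normal_form_def by (rule sum.cong) (auto simp: free_poly_poly_at)
  also have "\<dots> = free_poly d * xy_power i" by (subst sum.delta) auto
  finally show ?thesis unfolding has_normal_form_def by (metis gwa_cong_refl)
qed

lemma has_normal_form_sum:
  "finite A \<Longrightarrow> (\<And>i. i \<in> A \<Longrightarrow> has_normal_form a (f i)) \<Longrightarrow> has_normal_form a (sum f A)"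
proof (induction A rule: finite_induct)
  case empty
  show ?case using has_normal_form_term[of a 0 0] by (simp add: free_poly_poly_at)
qed (auto intro: has_normal_form_add)

text \<open>Multiplication by \<open>x\<close> lengthens a power of \<open>x\<close>, and shortens a power of \<open>y\<close> at the cost of
  the factor \<open>xy = \<sigma>(a)\<close>; the situation for \<open>y\<close> is symmetric. In both cases a left polynomial
  factor is only shifted by \<open>\<sigma>\<close> or its inverse.\<close>

lemma has_normal_form_gen:
  fixes a :: "'k::field poly"
  shows "has_normal_form a (free_gen g * (free_poly d * xy_power i))"
proof (cases g)
  case Gen_z
  have "free_gen Gen_z * (free_poly d * xy_power i) = free_poly (pCons 0 d) * xy_power i"
    by (simp add: free_poly_poly_at fr.poly_at_pCons fr.s_0 mult.assoc)
  then show ?thesis using Gen_z has_normal_form_term by metis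
next
  case Gen_x
  have *: "gwa_cong a (free_gen Gen_x * (free_poly d * xy_power i)) (free_poly (sigma_pow 1 d) *
      (free_gen Gen_x * xy_power i))"
    using gwa_cong_right[OF gwa_cong_rel(1), of a d "xy_power i"] by (simp add: mult.assoc)
  show ?thesis
  proof (cases "i \<ge> 0")
    case True
    then have "free_gen Gen_x * xy_power i = xy_power (i + 1)"
        by (simp add: xy_power_def nat_add_distrib)
    with * show ?thesis using has_normal_form_cong has_normal_form_term Gen_x by metis
  next
    case False
    then obtain m where "i = - int (Suc m)" using negD[of i] by auto
    then have "i = - int (Suc m)" "i + 1 = - int m" by simp_all
    then have "(xy_power i :: 'k free_xyz) = free_gen Gen_y * xy_power (i + 1)"
        by (simp only: xy_power_nat power_Suc)
    then have "free_gen Gen_x * xy_power i = ((free_gen Gen_x * free_gen Gen_y) * xy_power (i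
        + 1) :: 'k free_xyz)"
      by (simp only: mult.assoc)
    then have "gwa_cong a (free_gen Gen_x * xy_power i) (free_poly (sigma_pow 1 a) * xy_power (i + 1))"
      using gwa_cong_right[OF gwa_cong_rel(3)] by metis
    from gwa_cong_trans[OF * gwa_cong_left[OF this]] 
    have "gwa_cong a (free_gen Gen_x * (free_poly d * xy_power i)) (free_poly (sigma_pow 1 d *
        sigma_pow 1 a) * xy_power (i + 1))"
      by (simp only: free_poly_mult mult.assoc)
    then show ?thesis using has_normal_form_cong has_normal_form_term Gen_x by metis
  qed
next
  case Gen_y
  have *: "gwa_cong a (free_gen Gen_y * (free_poly d * xy_power i)) (free_poly (sigma_pow (-1) d) *
      (free_gen Gen_y * xy_power i))"
    using gwa_cong_right[OF gwa_cong_rel(2), of a d "xy_power i"] by (simp add: mult.assoc)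
  show ?thesis
  proof (cases "i \<le> 0")
    case True
    then obtain m where "i = - int m" by (metis nonpos_int_cases)
    then have "i = - int m" "i - 1 = - int (Suc m)" by simp_all
    then have "free_gen Gen_y * xy_power i = xy_power (i - 1)" by (simp only: xy_power_nat power_Suc)
    with * show ?thesis using has_normal_form_cong has_normal_form_term Gen_y by metis
  next
    case False
    then obtain m where "i = int (Suc m)" by (metis pos_int_cases gr0_implies_Suc not_le)
    then have "i = int (Suc m)" "i - 1 = int m" by simp_all
    then have "(xy_power i :: 'k free_xyz) = free_gen Gen_x * xy_power (i - 1)"
        by (simp only: xy_power_nat power_Suc)
    then have "free_gen Gen_y * xy_power i = ((free_gen Gen_y * free_gen Gen_x) * xy_power (i - 1)
        :: 'k free_xyz)"
      by (simp only: mult.assoc)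
    then have "gwa_cong a (free_gen Gen_y * xy_power i) (free_poly a * xy_power (i - 1))"
      using gwa_cong_right[OF gwa_cong_rel(4)] by metis
    from gwa_cong_trans[OF * gwa_cong_left[OF this]] 
    have "gwa_cong a (free_gen Gen_y * (free_poly d * xy_power i)) (free_poly (sigma_pow (-1) d * a)
        * xy_power (i - 1))"
      by (simp only: free_poly_mult mult.assoc)
    then show ?thesis using has_normal_form_cong has_normal_form_term Gen_y by metis
  qed
qed

lemma has_normal_form_all: "has_normal_form a p"
proof (induction p rule: free_gen_induct)
  case one
  show ?case using has_normal_form_term[of a 1 0] by (simp add: free_poly_poly_at xy_power_def)
next
  case (scalar c p)
  then obtain k f where "gwa_cong a p (normal_form k f)" by (auto simp: has_normal_form_def)
  then have "gwa_cong a (free_scalar c * p) (free_scalar c * normal_form k f)" by (rule gwa_cong_left)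
  also have "free_scalar c * normal_form k f = normal_form k (\<lambda>i. Polynomial.smult c (f i))"
    by (simp add: normal_form_def sum_distrib_left free_poly_poly_at fr.poly_at_smult mult.assoc)
  finally show ?case by (auto simp: has_normal_form_def)
next
  case (gen g p)
  then obtain k f where "gwa_cong a p (normal_form k f)" by (auto simp: has_normal_form_def)
  then have "gwa_cong a (free_gen g * p) (free_gen g * normal_form k f)" by (rule gwa_cong_left)
  then show ?case
    by (rule has_normal_form_cong) (simp add: normal_form_def sum_distrib_left has_normal_form_sum
        has_normal_form_gen)
qed (rule has_normal_form_add)

lemma lower_factor_nonzero: "a \<noteq> 0 \<Longrightarrow> lower_factor a i \<noteq> 0"
  by (simp add: lower_factor_def)

text \<open>The terms of a normal form are mapped to different powers of \<open>t\<close>, with coefficients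
  multiplied by nonzero polynomials. So a normal form in the kernel has zero coefficients, and
  the presentation defines nothing smaller than the graded model.\<close>

lemma free_eval_std_gens_eq_0_iff:
  assumes "a \<noteq> 0" shows "free_eval (std_gens a) p = 0 \<longleftrightarrow> p \<in> gwa_ideal a"
proof
  assume 0: "free_eval (std_gens a) p = 0"
  obtain k f where *: "gwa_cong a p (normal_form k f)" using has_normal_form_all[of a p]
      by (auto simp: has_normal_form_def)
  then have "free_eval (std_gens a) p = free_eval (std_gens a) (normal_form k f)"
    using free_eval_gwa_ideal[OF gwa_triple_std_gens, of "p - normal_form k f"]
        by (simp add: gwa_cong_def free_eval_diff)
  then have "skew_coeff (free_eval (std_gens a) (normal_form k f)) i = 0" for i using 0 by simp
  then have "f i = 0" if "i \<in> {- int k..int k}" for i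
    using that lower_factor_nonzero[OF assms, of i] \<open>\<And>i. skew_coeff (free_eval (std_gens a)
        (normal_form k f)) i = 0\<close>[of i]
    by (simp add: skew_coeff_free_eval_normal_form)
  then have "normal_form k f = 0" by (simp add: normal_form_def free_poly_poly_at)
  with * show "p \<in> gwa_ideal a" by (simp add: gwa_cong_def)
qed (rule free_eval_gwa_ideal[OF gwa_triple_std_gens])

definition gwa_model :: "'k::field poly \<Rightarrow> 'k skew set" where
  "gwa_model a = {F. \<forall>i. lower_factor a i dvd skew_coeff F i}"

lemma range_free_eval_std_gens: "range (free_eval (std_gens a)) = gwa_model a"
proof
  show "range (free_eval (std_gens a)) \<subseteq> gwa_model a"
  proof
    fix F assume "F \<in> range (free_eval (std_gens a))"
    then obtain p where F: "F = free_eval (std_gens a) p" by auto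
    obtain k f where *: "gwa_cong a p (normal_form k f)" using has_normal_form_all[of a p]
        by (auto simp: has_normal_form_def)
    then have "F = free_eval (std_gens a) (normal_form k f)"
      using free_eval_gwa_ideal[OF gwa_triple_std_gens, of "p - normal_form k f"]
          by (simp add: gwa_cong_def free_eval_diff F)
    then show "F \<in> gwa_model a" by (auto simp: gwa_model_def skew_coeff_free_eval_normal_form)
  qed
  show "gwa_model a \<subseteq> range (free_eval (std_gens a))"
  proof
    fix F assume F: "F \<in> gwa_model a"
    obtain k :: nat where k: "\<And>i. skew_coeff F i \<noteq> 0 \<Longrightarrow> \<bar>i\<bar> \<le> int k"
    proof -
      let ?A = "(\<lambda>i. nat \<bar>i\<bar>) ` {i. skew_coeff F i \<noteq> 0}"
      have fin: "finite ?A" by (simp add: finite_skew_coeff)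
      have "nat \<bar>i\<bar> \<le> Max ?A" if "skew_coeff F i \<noteq> 0" for i
        using that by (intro Max_ge[OF fin]) auto
      then show ?thesis using that[of "Max ?A"] by (simp add: nat_le_iff)
    qed
    have "F = free_eval (std_gens a) (normal_form k (\<lambda>i. skew_coeff F i div lower_factor a i))"
    proof (rule skew_eqI)
      fix i
      have "lower_factor a i dvd skew_coeff F i" using F by (simp add: gwa_model_def)
      then show "skew_coeff F i = skew_coeff (free_eval (std_gens a) (normal_form k (\<lambda>i. skew_coeff
          F i div lower_factor a i))) i"
        using k[of i] by (cases "skew_coeff F i = 0") (auto simp: skew_coeff_free_eval_normal_form
            abs_le_iff)
    qed
    then show "F \<in> range (free_eval (std_gens a))" by blast
  qed
qed

section \<open>Commutators in the Veronese subrings\<close>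

text \<open>Only the two highest coefficients of \<open>p\<close> matter: the leading terms of \<open>p\<close> and of its shift
  cancel, and the next coefficient changes by \<open>i deg p\<close> times the leading coefficient. The
  induction peels off the constant coefficient.\<close>

lemma difference_degree_bound:
  fixes p :: "'k::field poly"
  shows "Polynomial.degree (p - sigma_pow i p) \<le> Polynomial.degree p - 1 \<and>
    Polynomial.coeff (p - sigma_pow i p) (Polynomial.degree p - 1)
      = of_int i * of_nat (Polynomial.degree p) * Polynomial.lead_coeff p"
proof (induction p)
  case (pCons c q)
  show ?case
  proof (cases "q = 0")
    case False
    let ?d = "q - sigma_pow i q" and ?e = "Polynomial.degree q"
    have eq: "pCons c q - sigma_pow i (pCons c q) = pCons 0 ?d
        + Polynomial.smult (of_int i) (sigma_pow i q)"
    proof -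
      have "sigma_pow i (pCons c q) = [:c:] + [:- of_int i, 1:] * sigma_pow i q"
        by (simp add: sigma_pow_def pcompose_pCons)
      then show ?thesis by simp
    qed
    have deg: "Polynomial.degree (pCons 0 ?d) \<le> ?e"
    proof (cases "?e = 0")
      case True
      then obtain b where "q = [:b:]" by (metis degree_eq_zeroE)
      then show ?thesis by simp
    next
      case False
      then show ?thesis using pCons.IH by (auto simp: degree_pCons_eq_if)
    qed
    have lc: "Polynomial.coeff (sigma_pow i q) ?e = Polynomial.lead_coeff q"
      using lead_coeff_comp[of "[:- of_int i, 1:]" q] by (simp add: sigma_pow_def degree_pcompose)
    have "Polynomial.coeff (pCons 0 ?d) ?e = of_int i * of_nat ?e * Polynomial.lead_coeff q"
    proof (cases ?e)
      case 0
      then obtain b where "q = [:b:]" by (metis degree_eq_zeroE)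
      then show ?thesis by simp
    next
      case (Suc e)
      then show ?thesis using pCons.IH by simp
    qed
    then have "Polynomial.coeff (pCons c q - sigma_pow i (pCons c q)) ?e
       = of_int i * of_nat (Suc ?e) * Polynomial.lead_coeff q"
      unfolding eq by (simp add: lc algebra_simps)
    moreover have "Polynomial.degree (pCons c q - sigma_pow i (pCons c q)) \<le> ?e"
      unfolding eq by (intro degree_add_le deg) (simp add: degree_smult_le order.trans)
    ultimately show ?thesis using False by simp
  qed simp
qed simp

lemma degree_minus_sigma_pow:
  fixes p :: "'k::field_char_0 poly"
  assumes "i \<noteq> 0" "Polynomial.degree p > 0"
  shows "Polynomial.degree (p - sigma_pow i p) = Polynomial.degree p - 1"
proof -
  have "Polynomial.coeff (p - sigma_pow i p) (Polynomial.degree p - 1) \<noteq> 0"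
    using difference_degree_bound[of p i] assms by auto
  then show ?thesis using difference_degree_bound[of p i] le_degree by (metis le_antisym)
qed

text \<open>This is \<open>x^m y^m\<close>, the product \<open>\<sigma>(a) \<dots> \<sigma>^m(a)\<close>.\<close>

definition upper_factor :: "'k::field poly \<Rightarrow> nat \<Rightarrow> 'k poly" where
  "upper_factor a m = (\<Prod>j<m. sigma_pow (int (Suc j)) a)"

lemma upper_factor_lower_factor: "sigma_pow (int m) (lower_factor a (- int m)) = upper_factor a m"
proof -
  have "sigma_pow (int m) (lower_factor a (- int m)) = (\<Prod>j<m. sigma_pow (int m - int j) a)"
    by (simp add: lower_factor_neg sigma_pow_prod)
  also have "\<dots> = (\<Prod>j<m. sigma_pow (int (Suc (m - Suc j))) a)"
    by (rule prod.cong) (auto simp: of_nat_diff)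
  also have "\<dots> = upper_factor a m"
    unfolding upper_factor_def by (rule prod.nat_diff_reindex)
  finally show ?thesis .
qed

lemma upper_factor_nonzero: "a \<noteq> 0 \<Longrightarrow> upper_factor a m \<noteq> 0"
  by (simp add: upper_factor_def)

lemma degree_upper_factor:
  "a \<noteq> 0 \<Longrightarrow> Polynomial.degree (upper_factor a m) = m * Polynomial.degree a"
  unfolding upper_factor_def by (subst degree_prod_sum_eq) auto

lemma upper_factor_dvd: "m \<le> n \<Longrightarrow> upper_factor a m dvd upper_factor a n"
  unfolding upper_factor_def by (intro prod_dvd_prod_subset) auto

lemma upper_factor_shift: "upper_factor a m dvd sigma_pow (- int n) (upper_factor a (n + m))"
proof -
  have "upper_factor a m = (\<Prod>j\<in>{n..<n + m}. sigma_pow (int (Suc j) - int n) a)"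
    unfolding upper_factor_def
    by (rule prod.reindex_bij_witness[of _ "\<lambda>j. j - n" "\<lambda>j. j + n"]) auto
  also have "\<dots> dvd (\<Prod>j<n + m. sigma_pow (int (Suc j) - int n) a)"
    by (intro prod_dvd_prod_subset) auto
  finally show ?thesis by (simp add: upper_factor_def sigma_pow_prod)
qed

text \<open>These will turn out to be exactly the coefficients of degree zero of the elements of
  \<open>[S, S]\<close>, for the \<open>n\<close>-th Veronese subring \<open>S\<close>.\<close>

definition commutator_traces :: "'k::field poly \<Rightarrow> nat \<Rightarrow> 'k poly set" where
  "commutator_traces a n = {P - sigma_pow (- int n) P | P. upper_factor a n dvd P}"

lemma commutator_traces_0:
  "0 \<in> commutator_traces a n" unfolding commutator_traces_def by (auto intro!: exI[of _ 0])

lemma commutator_traces_add: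
  "p \<in> commutator_traces a n \<Longrightarrow> q \<in> commutator_traces a n \<Longrightarrow> p + q \<in> commutator_traces a n"
  unfolding commutator_traces_def
  by (clarify, rule_tac x = "P + Pa" in exI) (simp add: dvd_add)

lemma commutator_traces_smult:
  "p \<in> commutator_traces a n \<Longrightarrow> Polynomial.smult c p \<in> commutator_traces a n"
  unfolding commutator_traces_def
  by (clarify, rule_tac x = "Polynomial.smult c P" in exI) (simp add: dvd_smult smult_diff_right)

lemma commutator_traces_uminus:
  "p \<in> commutator_traces a n \<Longrightarrow> - p \<in> commutator_traces a n"
  using commutator_traces_smult[of p a n "-1"] by simp

lemma smult_sum_right: "Polynomial.smult c (sum f A) = (\<Sum>i\<in>A. Polynomial.smult c (f i))"
  by (induction A rule: infinite_finite_induct) (auto simp: smult_add_right)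

lemma commutator_traces_sum:
  "(\<And>i. i \<in> A \<Longrightarrow> f i \<in> commutator_traces a n) \<Longrightarrow> sum f A \<in> commutator_traces a n"
  by (induction A rule: infinite_finite_induct) (auto intro: commutator_traces_add commutator_traces_0)

lemma commutator_traces_degree:
  fixes a :: "'k::field_char_0 poly"
  assumes "n > 0" "Polynomial.degree a > 0" "p \<in> commutator_traces a n" "p \<noteq> 0"
  shows "Polynomial.degree p \<ge> n * Polynomial.degree a - 1"
proof -
  have a: "a \<noteq> 0" using assms(2) by auto
  obtain P where P: "p = P - sigma_pow (- int n) P" "upper_factor a n dvd P" using assms(3)
      by (auto simp: commutator_traces_def)
  have "P \<noteq> 0" using P assms(4) by auto
  then have "n * Polynomial.degree a \<le> Polynomial.degree P"
    using dvd_imp_degree_le[OF P(2)] degree_upper_factor[OF a] by simp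
  moreover have "0 < n * Polynomial.degree a" using assms by simp
  ultimately have "Polynomial.degree P > 0" "n * Polynomial.degree a \<le> Polynomial.degree P"
    by linarith+
  then show ?thesis
    using degree_minus_sigma_pow[of "- int n" P] assms(1) unfolding P(1) by simp
qed

text \<open>The difference for \<open>nk\<close> steps is a sum of differences for \<open>n\<close> steps, taken at \<open>\<sigma>^(-nj)(P)\<close>
  for \<open>j < k\<close>. Each of these is still divisible by \<open>\<sigma>(a) \<dots> \<sigma>^n(a)\<close>, because \<open>P\<close> is divisible by
  the longer product.\<close>

lemma commutator_traces_telescope:
  "upper_factor a (n * k) dvd P \<Longrightarrow> P - sigma_pow (- int (n * k)) P \<in> commutator_traces a n"
proof (induction k arbitrary: P)
  case (Suc k)
  let ?Q = "sigma_pow (- int n) P"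
  have "upper_factor a n dvd P" using dvd_trans[OF upper_factor_dvd Suc.prems, of n] by simp
  then have 1: "P - ?Q \<in> commutator_traces a n" by (auto simp: commutator_traces_def)
  have "upper_factor a (n * k) dvd sigma_pow (- int n) (upper_factor a (n * Suc k))"
    using upper_factor_shift[of a "n * k" n] by simp
  also have "\<dots> dvd ?Q" using Suc.prems by (rule sigma_pow_dvd)
  finally have "?Q - sigma_pow (- int (n * k)) ?Q \<in> commutator_traces a n" by (rule Suc.IH)
  from commutator_traces_add[OF 1 this] show ?case by (simp add: algebra_simps)
qed (simp add: commutator_traces_0)

definition veronese :: "'k::field poly \<Rightarrow> nat \<Rightarrow> 'k skew set" where
  "veronese a n = {F \<in> gwa_model a. \<forall>i. skew_coeff F i \<noteq> 0 \<longrightarrow> int n dvd i}"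

text \<open>Sums of commutators already form a subspace when \<open>S\<close> is closed under scaling, since a
  scalar can be absorbed into one of the two factors.\<close>

inductive_set commutator_span :: "'k::field skew set \<Rightarrow> 'k skew set" for S where
  zero: "0 \<in> commutator_span S"
| step: "F \<in> S \<Longrightarrow> G \<in> S \<Longrightarrow> K \<in> commutator_span S \<Longrightarrow> (F * G - G * F) + K \<in> commutator_span S"

lemma commutator_span_comm:
  "F \<in> S \<Longrightarrow> G \<in> S \<Longrightarrow> F * G - G * F \<in> commutator_span S"
  using commutator_span.step[OF _ _ commutator_span.zero] by fastforce

lemma commutator_span_add:
  "K \<in> commutator_span S \<Longrightarrow> L \<in> commutator_span S \<Longrightarrow> K + L \<in> commutator_span S"
  by (induction K rule: commutator_span.induct) (auto simp: add.assoc intro: commutator_span.step)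

lemma commutator_span_sum:
  "(\<And>i. i \<in> A \<Longrightarrow> f i \<in> commutator_span S) \<Longrightarrow> sum f A \<in> commutator_span S"
  by (induction A rule: infinite_finite_induct) (auto intro: commutator_span_add commutator_span.zero)

text \<open>The components of degree \<open>i\<close> of \<open>F\<close> and \<open>-i\<close> of \<open>G\<close> contribute \<open>P\<close> to \<open>FG\<close> and \<open>\<sigma>^(-i)(P)\<close>
  to \<open>GF\<close>, where \<open>P\<close> or \<open>\<sigma>^(-i)(P)\<close> is divisible by \<open>\<sigma>(a) \<dots> \<sigma>^\<bar>i\<bar>(a)\<close> according to the sign of
  \<open>i\<close>.\<close>

lemma commutator_coeff_0:
  assumes F: "F \<in> veronese a n" and G: "G \<in> veronese a n"
  shows "skew_coeff (F * G - G * F) 0 \<in> commutator_traces a n"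
proof -
  \<comment> \<open>With a symmetric index set both products become sums over the same set.\<close>
  let ?S = "{i. skew_coeff F i \<noteq> 0} \<union> uminus ` {i. skew_coeff G i \<noteq> 0}"
  have fin: "finite ?S" by (simp add: finite_skew_coeff)
  have "skew_coeff (F * G) 0 = (\<Sum>i\<in>?S. skew_coeff F i * sigma_pow i (skew_coeff G (- i)))"
    by (subst skew_coeff_times_superset[OF fin]) auto
  moreover have "skew_coeff (G * F) 0 = (\<Sum>i\<in>?S. skew_coeff G (- i) * sigma_pow (- i) (skew_coeff F i))"
  proof -
    have "skew_coeff (G * F) 0 = (\<Sum>i\<in>uminus ` ?S. skew_coeff G i * sigma_pow i (skew_coeff F (0 - i)))"
    proof (rule skew_coeff_times_superset)
      show "{i. skew_coeff G i \<noteq> 0} \<subseteq> uminus ` ?S" by (force simp: image_iff)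
    qed (use fin in auto)
    also have "\<dots> = (\<Sum>i\<in>?S. skew_coeff G (- i) * sigma_pow (- i) (skew_coeff F i))"
      by (subst sum.reindex) (auto simp: inj_on_def)
    finally show ?thesis .
  qed
  ultimately have "skew_coeff (F * G - G * F) 0 =
     (\<Sum>i\<in>?S. skew_coeff F i * sigma_pow i (skew_coeff G (- i)) - skew_coeff G (- i) * sigma_pow (-
         i) (skew_coeff F i))"
    by (simp add: sum_subtractf)
  also have "\<dots> \<in> commutator_traces a n"
  proof (rule commutator_traces_sum)
    fix i
    define P where "P = skew_coeff F i * sigma_pow i (skew_coeff G (- i))"
    define Q where "Q = skew_coeff G (- i) * sigma_pow (- i) (skew_coeff F i)"
    have PQ: "Q = sigma_pow (- i) P" "P = sigma_pow i Q" by (auto simp: P_def Q_def)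
    have "P - Q \<in> commutator_traces a n"
    proof (cases "int n dvd i")
      case False
      then have "skew_coeff F i = 0" using F by (auto simp: veronese_def)
      then show ?thesis by (simp add: P_def Q_def commutator_traces_0)
    next
      case True
      then obtain l where l: "i = int n * l" by auto
      show ?thesis
      proof (cases "l \<ge> 0")
        case True
        then obtain k where k: "l = int k" by (metis zero_le_imp_eq_int)
        have "lower_factor a (- i) dvd skew_coeff G (- i)" using G
            by (auto simp: veronese_def gwa_model_def)
        then have "sigma_pow i (lower_factor a (- i)) dvd P" unfolding P_def
            by (intro dvd_mult sigma_pow_dvd)
        then have "upper_factor a (n * k) dvd P" using upper_factor_lower_factor[of "n * k" a]
            by (simp add: l k)
        from commutator_traces_telescope[OF this] show ?thesis by (simp add: PQ(1) l k)
      next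
        case False
        then obtain k where k: "l = - int k" by (metis nonpos_int_cases linear)
        have "lower_factor a i dvd skew_coeff F i" using F by (auto simp: veronese_def gwa_model_def)
        then have "sigma_pow (- i) (lower_factor a i) dvd Q" unfolding Q_def
            by (intro dvd_mult sigma_pow_dvd)
        then have "upper_factor a (n * k) dvd Q" using upper_factor_lower_factor[of "n * k" a]
            by (simp add: l k)
        from commutator_traces_uminus[OF commutator_traces_telescope[OF this]] show ?thesis
            by (simp add: PQ(2) l k)
      qed
    qed
    then show "skew_coeff F i * sigma_pow i (skew_coeff G (- i)) - skew_coeff G (- i) * sigma_pow (-
        i) (skew_coeff F i) \<in> commutator_traces a n"
      by (simp add: P_def Q_def)
  qed
  finally show ?thesis .
qed

lemma commutator_span_coeff_0:
  "K \<in> commutator_span (veronese a n) \<Longrightarrow> skew_coeff K 0 \<in> commutator_traces a n"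
proof (induction rule: commutator_span.induct)
  case (step F G K)
  then show ?case using commutator_coeff_0[of F a n G] commutator_traces_add
      by (metis skew_coeff_simps(2))
qed (simp add: commutator_traces_0)

lemma skew_monom_veronese:
  "skew_monom i f \<in> veronese a n \<longleftrightarrow> f = 0 \<or> (int n dvd i \<and> lower_factor a i dvd f)"
  by (auto simp: veronese_def gwa_model_def)

lemma skew_poly_veronese:
  "skew_poly f \<in> veronese a n" by (simp add: skew_poly_def skew_monom_veronese lower_factor_def)

text \<open>For \<open>P = f \<sigma>(a) \<dots> \<sigma>^n(a)\<close> the polynomial \<open>P - \<sigma>^(-n)(P)\<close> is the commutator of \<open>f x^n\<close> and
  \<open>y^n\<close>.\<close>

lemma commutator_traces_are_commutators: assumes "p \<in> commutator_traces a n" shows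
    "skew_poly p \<in> commutator_span (veronese a n)"
proof -
  obtain f where f: "p = upper_factor a n * f - sigma_pow (- int n) (upper_factor a n * f)"
    using assms by (auto simp: commutator_traces_def elim!: dvdE)
  let ?b = "lower_factor a (- int n)"
  have "skew_monom (int n) f * skew_monom (- int n) ?b - skew_monom (- int n) ?b * skew_monom (int
      n) f \<in> commutator_span (veronese a n)"
    by (rule commutator_span_comm) (simp_all add: skew_monom_veronese lower_factor_def)
  moreover have "skew_monom (int n) f * skew_monom (- int n) ?b - skew_monom (- int n) ?b *
      skew_monom (int n) f = skew_poly p"
    by (rule skew_eqI) (simp add: f upper_factor_lower_factor mult.commute flip:
        upper_factor_lower_factor)
  ultimately show ?thesis by simp
qed

text \<open>The commutator with \<open>z\<close> multiplies the component of degree \<open>i\<close> by \<open>i\<close>, which is invertible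
  in characteristic zero.\<close>

lemma skew_monom_commutator_span:
  fixes f :: "'k::field_char_0 poly"
  assumes "skew_monom i f \<in> veronese a n" "i \<noteq> 0" shows "skew_monom i f \<in> commutator_span (veronese
      a n)"
proof -
  let ?g = "Polynomial.smult (inverse (of_int i)) f"
  have "skew_monom i ?g \<in> veronese a n" using assms by (auto simp: skew_monom_veronese intro: dvd_smult)
  then have "skew_poly [:0, 1:] * skew_monom i ?g - skew_monom i ?g * skew_poly [:0, 1:] \<in>
      commutator_span (veronese a n)"
    by (intro commutator_span_comm skew_poly_veronese)
  moreover have "skew_poly [:0, 1:] * skew_monom i ?g - skew_monom i ?g * skew_poly [:0, 1:]
      = skew_monom i f"
    using assms(2) by (intro skew_eqI) (simp add: skew_poly_def sigma_pow_z)
  ultimately show ?thesis by simp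
qed

lemma veronese_decompose:
  fixes a :: "'k::field_char_0 poly"
  assumes "F \<in> veronese a n" shows "F - skew_poly (skew_coeff F 0) \<in> commutator_span (veronese a n)"
proof -
  let ?A = "{i. skew_coeff F i \<noteq> 0}"
  have "F - skew_poly (skew_coeff F 0) = (\<Sum>i\<in>?A - {0}. skew_monom i (skew_coeff F i))"
  proof (rule skew_eqI)
    fix j
    have "skew_coeff (\<Sum>i\<in>?A - {0}. skew_monom i (skew_coeff F i)) j = (\<Sum>i\<in>?A - {0}. if j
        = i then skew_coeff F i else 0)"
      by (simp add: skew_coeff_sum)
    then show "skew_coeff (F - skew_poly (skew_coeff F 0)) j = skew_coeff (\<Sum>i\<in>?A - {0}. skew_monom i
        (skew_coeff F i)) j"
      by (simp add: finite_skew_coeff)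
  qed
  also have "\<dots> \<in> commutator_span (veronese a n)"
    by (rule commutator_span_sum, rule skew_monom_commutator_span) (use assms in \<open>auto simp:
        veronese_def gwa_model_def\<close>)
  finally show ?thesis .
qed

text \<open>Leading terms are removed one after another by the trace that comes from
  \<open>\<sigma>(a) \<dots> \<sigma>^n(a) z^k\<close>, whose degree is \<open>n deg a - 1 + k\<close>.\<close>

lemma commutator_traces_reduce:
  fixes a :: "'k::field_char_0 poly"
  assumes "n > 0" "Polynomial.degree a > 0"
  shows "\<exists>q. (\<forall>j\<ge>n * Polynomial.degree a - 1. Polynomial.coeff q j = 0) \<and> p - q \<in> commutator_traces a n"
proof -
  let ?N = "n * Polynomial.degree a - 1"
  have a: "a \<noteq> 0" using assms(2) by auto
  have pos: "n * Polynomial.degree a > 0" using assms by simp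
  have "\<exists>q. (\<forall>j\<ge>?N. Polynomial.coeff q j = 0) \<and> p - q \<in> commutator_traces a n"
    if "\<forall>j\<ge>?N + k. Polynomial.coeff p j = 0" for k p
    using that
  proof (induction k arbitrary: p)
    case 0
    then show ?case using commutator_traces_0 by (intro exI[of _ p]) simp
  next
    case (Suc k)
    define P where "P = upper_factor a n * Polynomial.monom 1 k"
    define \<delta> where "\<delta> = P - sigma_pow (- int n) P"
    have "Polynomial.degree P = n * Polynomial.degree a + k"
      unfolding P_def using upper_factor_nonzero[OF a] degree_upper_factor[OF a]
      by (subst degree_mult_eq) (auto simp: degree_monom_eq)
    then have deg: "Polynomial.degree \<delta> = ?N + k"
      unfolding \<delta>_def using pos assms(1) by (subst degree_minus_sigma_pow) auto
    have "P \<noteq> 0" using upper_factor_nonzero[OF a] by (simp add: P_def)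
    moreover have "Polynomial.degree P - 1 = ?N + k" "Polynomial.degree P > 0"
      using \<open>Polynomial.degree P = _\<close> pos by simp_all
    ultimately have sigma_pow_ok: "Polynomial.coeff \<delta> (?N + k) \<noteq> 0"
      using difference_degree_bound[of P "- int n"] assms(1) unfolding \<delta>_def by simp
    have mem: "\<delta> \<in> commutator_traces a n" unfolding commutator_traces_def \<delta>_def
      by (rule CollectI, rule exI[of _ P]) (simp only: P_def dvd_triv_left simp_thms)
    define p' where "p' = p - Polynomial.smult (Polynomial.coeff p (?N + k) / Polynomial.coeff \<delta> (?N
        + k)) \<delta>"
    have "\<forall>j\<ge>?N + k. Polynomial.coeff p' j = 0"
    proof (intro allI impI)
      fix j assume "j \<ge> ?N + k"
      then consider "j = ?N + k" | "j \<ge> ?N + Suc k" by linarith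
      then show "Polynomial.coeff p' j = 0"
        using sigma_pow_ok Suc.prems deg by cases (auto simp: p'_def coeff_eq_0)
    qed
    from Suc.IH[OF this] obtain q where q: "\<forall>j\<ge>?N. Polynomial.coeff q j = 0"
        "p' - q \<in> commutator_traces a n" by blast
    have "p - q = (p' - q) + Polynomial.smult (Polynomial.coeff p (?N + k) / Polynomial.coeff \<delta> (?N
        + k)) \<delta>"
      by (simp add: p'_def)
    also have "\<dots> \<in> commutator_traces a n" by (rule commutator_traces_add[OF q(2)
        commutator_traces_smult[OF mem]])
    finally show ?case using q(1) by blast
  qed
  moreover have "\<forall>j\<ge>?N + Suc (Polynomial.degree p). Polynomial.coeff p j = 0"
    by (auto intro!: coeff_eq_0)
  ultimately show ?thesis by blast
qed

lemma homogeneous_system: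
  fixes A :: "'i \<Rightarrow> 'j \<Rightarrow> 'k::field"
  assumes "finite J" "finite I" "card J < card I"
  shows "\<exists>c. (\<exists>i\<in>I. c i \<noteq> 0) \<and> (\<forall>j\<in>J. (\<Sum>i\<in>I. c i * A i j) = 0)"
  using assms
proof (induction J arbitrary: I A rule: finite_induct)
  case empty
  then obtain i where "i \<in> I" by fastforce
  then show ?case by (intro exI[of _ "\<lambda>_. 1"]) auto
next
  case (insert l J)
  show ?case
  proof (cases "\<forall>i\<in>I. A i l = 0")
    case True
    from insert have "card J < card I" by simp
    from insert.IH[OF insert.prems(1) this, of A] True show ?thesis by auto
  next
    case False
    then obtain p where p: "p \<in> I" "A p l \<noteq> 0" by auto
    let ?I = "I - {p}"
    let ?A = "\<lambda>i j. A i j - A i l / A p l * A p j"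
    have "card J < card ?I" using insert p by simp
    from insert.IH[OF _ this, of ?A] insert.prems(1) obtain c where
      c: "\<exists>i\<in>?I. c i \<noteq> 0" "\<forall>j\<in>J. (\<Sum>i\<in>?I. c i * ?A i j) = 0" by auto
    define s where "s = (\<Sum>i\<in>?I. c i * A i l) / A p l"
    define c' where "c' = (\<lambda>i. if i = p then - s else c i)"
    have sum: "(\<Sum>i\<in>I. c' i * A i j) = (\<Sum>i\<in>?I. c i * A i j) - s * A p j" for j
    proof -
      have "(\<Sum>i\<in>I. c' i * A i j) = c' p * A p j + (\<Sum>i\<in>?I. c' i * A i j)"
        using insert.prems(1) p(1) by (rule sum.remove)
      also have "(\<Sum>i\<in>?I. c' i * A i j) = (\<Sum>i\<in>?I. c i * A i j)"
        by (rule sum.cong) (auto simp: c'_def)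
      finally show ?thesis by (simp add: c'_def)
    qed
    have "(\<Sum>i\<in>I. c' i * A i j) = 0" if "j \<in> insert l J" for j
    proof (cases "j = l")
      case True
      then show ?thesis using p(2) by (simp add: sum s_def)
    next
      case False
      then have "0 = (\<Sum>i\<in>?I. c i * ?A i j)" using c(2) that by auto
      also have "\<dots> = (\<Sum>i\<in>?I. c i * A i j) - s * A p j"
        by (simp add: s_def right_diff_distrib sum_subtractf sum_divide_distrib sum_distrib_right
            mult.assoc)
      finally show ?thesis by (simp add: sum)
    qed
    moreover have "\<exists>i\<in>I. c' i \<noteq> 0" using c(1) by (auto simp: c'_def)
    ultimately show ?thesis by blast
  qed
qed


definition subalg :: "'k::field skew set \<Rightarrow> bool" where
  "subalg S \<longleftrightarrow> (\<forall>c. skew_scalar c \<in> S) \<and> (\<forall>F\<in>S. \<forall>G\<in>S. F + G \<in> S \<and> F - G \<in> S \<and> F * G \<in> S)"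

definition subalg_hom :: "'k::field skew set \<Rightarrow> ('k skew \<Rightarrow> 'k skew) \<Rightarrow> bool" where
  "subalg_hom S h \<longleftrightarrow> (\<forall>c. h (skew_scalar c) = skew_scalar c)
     \<and> (\<forall>F\<in>S. \<forall>G\<in>S. h (F + G) = h F + h G \<and> h (F * G) = h F * h G)"

lemma subalg_0: "subalg S \<Longrightarrow> 0 \<in> S"
  unfolding subalg_def by (metis skew_scalar_simps(1))

lemma subalg_sum:
  "subalg S \<Longrightarrow> (\<And>i. i \<in> A \<Longrightarrow> f i \<in> S) \<Longrightarrow> sum f A \<in> S"
proof (induction A rule: infinite_finite_induct)
qed (auto simp: subalg_0, auto simp: subalg_def)

lemma subalg_hom_simps:
  assumes "subalg S" "subalg_hom S h"
  shows "h 0 = 0" "F \<in> S \<Longrightarrow> G \<in> S \<Longrightarrow> h (F - G) = h F - h G"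
proof -
  show "h 0 = 0" using assms(2) by (simp add: subalg_hom_def flip: skew_scalar_simps(1))
  assume *: "F \<in> S" "G \<in> S"
  then have "h ((F - G) + G) = h (F - G) + h G"
    using assms unfolding subalg_def subalg_hom_def by blast
  then show "h (F - G) = h F - h G" by (simp add: algebra_simps)
qed

lemma subalg_hom_sum:
  "subalg S \<Longrightarrow> subalg_hom S h \<Longrightarrow> (\<And>i. i \<in> A \<Longrightarrow> f i \<in> S) \<Longrightarrow> h (sum f A) = (\<Sum>i\<in>A. h (f i))"
proof (induction A rule: infinite_finite_induct)
  case (insert x A)
  then have "sum f A \<in> S" "f x \<in> S" by (auto intro: subalg_sum)
  with insert show ?case by (auto simp: subalg_hom_def)
qed (auto simp: subalg_hom_simps)

lemma commutator_span_hom: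
  assumes S: "subalg S" and h: "subalg_hom S h" "h ` S \<subseteq> T" and K: "K \<in> commutator_span S"
  shows "K \<in> S \<and> h K \<in> commutator_span T"
  using K
proof (induction rule: commutator_span.induct)
  case zero
  show ?case using S by (simp add: subalg_hom_simps[OF S h(1)] commutator_span.zero subalg_0)
next
  case (step F G K)
  have *: "F * G \<in> S" "G * F \<in> S" "F * G - G * F \<in> S" using S step by (auto simp: subalg_def)
  then have "h (F * G - G * F + K) = (h F * h G - h G * h F) + h K"
    using h(1) step subalg_hom_simps(2)[OF S h(1)] by (simp add: subalg_hom_def)
  then show ?case using * step h(2) S by (auto simp: subalg_def intro: commutator_span.step)
qed

lemma subalg_veronese_mult:
  assumes "F \<in> veronese a n" "G \<in> veronese a n" "F * G \<in> gwa_model a" shows "F * G \<in> veronese a n"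
proof -
  have "int n dvd m" if "skew_coeff (F * G) m \<noteq> 0" for m
  proof -
    from that obtain i where "skew_coeff F i * sigma_pow i (skew_coeff G (m - i)) \<noteq> 0"
      unfolding skew_coeff_times by (auto elim: sum.not_neutral_contains_not_neutral)
    then have "int n dvd i" "int n dvd m - i" using assms by (auto simp: veronese_def)
    then show ?thesis by (metis dvd_add diff_add_cancel)
  qed
  then show ?thesis using assms(3) by (auto simp: veronese_def)
qed

lemma subalg_gwa_model: "subalg (gwa_model a)"
proof -
  have "F + G \<in> gwa_model a \<and> F - G \<in> gwa_model a \<and> F * G \<in> gwa_model a" if "F \<in> gwa_model a"
      "G \<in> gwa_model a" for F G
    proof -
    from that obtain p q where "F = free_eval (std_gens a) p" "G = free_eval (std_gens a) q"
      unfolding range_free_eval_std_gens[symmetric] by blast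
    then have "F + G = free_eval (std_gens a) (p + q)" "F - G = free_eval (std_gens a) (p - q)"
        "F * G = free_eval (std_gens a) (p * q)"
      by (simp_all add: free_eval_add free_eval_diff free_eval_mult)
    then show ?thesis unfolding range_free_eval_std_gens[symmetric] by blast
  qed
  moreover have "skew_scalar c \<in> gwa_model a" for c unfolding range_free_eval_std_gens[symmetric]
      by (metis free_eval_scalar rangeI)
  ultimately show ?thesis by (auto simp: subalg_def)
qed

lemma subalg_veronese: "subalg (veronese a n)"
  unfolding subalg_def
proof (intro conjI allI ballI)
  show "skew_scalar c \<in> veronese a n" for c unfolding skew_scalar_def by (rule skew_poly_veronese)
  fix F G assume FG: "F \<in> veronese a n" "G \<in> veronese a n"
  have *: "int n dvd i" if "skew_coeff F i \<noteq> 0 \<or> skew_coeff G i \<noteq> 0" for i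
    using that FG by (auto simp: veronese_def)
  have R: "F \<in> gwa_model a" "G \<in> gwa_model a" using FG by (simp_all add: veronese_def)
  then have R': "F + G \<in> gwa_model a" "F - G \<in> gwa_model a" "F * G \<in> gwa_model a"
    using subalg_gwa_model[of a] unfolding subalg_def by simp_all
  show "F * G \<in> veronese a n" by (rule subalg_veronese_mult[OF FG R'(3)])
  have "skew_coeff F i + skew_coeff G i \<noteq> 0 \<Longrightarrow> int n dvd i" "skew_coeff F i - skew_coeff G i \<noteq> 0
      \<Longrightarrow> int n dvd i" for i
    by (rule *; auto)+
  then show "F + G \<in> veronese a n" "F - G \<in> veronese a n"
    using R'(1,2) by (simp_all add: veronese_def)
qed

lemma skew_poly_sum_monom:
  assumes "\<forall>j\<ge>N. Polynomial.coeff q j = 0"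
  shows "skew_poly q = (\<Sum>j<N. skew_scalar (Polynomial.coeff q j) * skew_poly (Polynomial.monom 1 j))"
proof (rule skew_eqI)
  fix i
  have "(\<Sum>j<N. Polynomial.smult (Polynomial.coeff q j) (Polynomial.monom 1 j)) = q"
    using assms by (intro poly_eqI) (auto simp: coeff_sum smult_monom not_less)
  then show "skew_coeff (skew_poly q) i = skew_coeff (\<Sum>j<N. skew_scalar (Polynomial.coeff q j) *
      skew_poly (Polynomial.monom 1 j)) i"
    by (simp only: skew_coeff_sum skew_coeff_skew_scalar_times skew_coeff_skew_poly if_True if_False
        smult_0_right sum.neutral_const
        split: if_split) simp
qed

text \<open>The classes of the powers of \<open>z\<close> below \<open>n deg a - 1\<close> span the source modulo commutators,
  so their images span the target modulo commutators. If \<open>m\<close> exceeded \<open>n\<close>, then some nonzero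
  polynomial of degree below \<open>m deg a - 1\<close> would be a commutator trace in the target.\<close>

lemma veronese_iso_le:
  fixes a :: "'k::field_char_0 poly"
  assumes pos: "n > 0" "m > 0" "Polynomial.degree a > 0"
    and h: "bij_betw h (veronese a n) (veronese a m)" "subalg_hom (veronese a n) h"
  shows "m \<le> n"
proof (rule ccontr)
  assume "\<not> m \<le> n"
  let ?N = "n * Polynomial.degree a - 1" and ?M = "m * Polynomial.degree a - 1"
  have "n * Polynomial.degree a < m * Polynomial.degree a" "0 < n * Polynomial.degree a"
    using \<open>\<not> m \<le> n\<close> pos by simp_all
  then have NM: "?N < ?M" by linarith
  define v where "v j = skew_coeff (h (skew_poly (Polynomial.monom 1 j))) 0" for j
  have "\<exists>q. p - (\<Sum>j<?N. Polynomial.smult (q j) (v j)) \<in> commutator_traces a m" for p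
  proof -
    obtain F where F: "F \<in> veronese a n" "h F = skew_poly p"
      using h(1) skew_poly_veronese[of p a m] by (metis bij_betw_imp_surj_on imageE)
    obtain q where q: "\<forall>j\<ge>?N. Polynomial.coeff q j = 0" "skew_coeff F 0 - q \<in> commutator_traces a n"
      using commutator_traces_reduce[OF pos(1,3)] by blast
    have eq: "F - skew_poly q = (F - skew_poly (skew_coeff F 0)) + skew_poly (skew_coeff F 0 - q)"
        by (simp add: skew_poly_simps)
    have "F - skew_poly q \<in> commutator_span (veronese a n)"
      unfolding eq by (rule commutator_span_add[OF veronese_decompose[OF F(1)]
          commutator_traces_are_commutators[OF q(2)]])
    then have "h (F - skew_poly q) \<in> commutator_span (veronese a m)"
      using commutator_span_hom[OF subalg_veronese h(2), of "veronese a m"] h(1)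
          by (auto simp: bij_betw_def)
    then have "skew_coeff (h (F - skew_poly q)) 0 \<in> commutator_traces a m"
        by (rule commutator_span_coeff_0)
    moreover have "h (F - skew_poly q) = skew_poly p - h (skew_poly q)"
      using subalg_hom_simps(2)[OF subalg_veronese h(2) F(1) skew_poly_veronese] F(2) by simp
    moreover have "h (skew_poly q) = (\<Sum>j<?N. skew_scalar (Polynomial.coeff q j) * h (skew_poly
        (Polynomial.monom 1 j)))"
    proof -
      have *: "skew_scalar c \<in> veronese a n" "skew_scalar c * skew_poly r \<in> veronese a n" for c r
        by (simp_all add: skew_scalar_def skew_poly_veronese flip: skew_poly_simps)
      have **: "h (skew_scalar c * skew_poly r) = skew_scalar c * h (skew_poly r)" for c r
        using h(2) *(1)[of c] skew_poly_veronese[of r a n] by (simp add: subalg_hom_def)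
      show ?thesis
        unfolding skew_poly_sum_monom[OF q(1)] ** [symmetric]
        by (rule subalg_hom_sum[OF subalg_veronese h(2)]) (rule *(2))
    qed
    ultimately have "p - (\<Sum>j<?N. Polynomial.smult (Polynomial.coeff q j) (v j)) \<in> commutator_traces a m"
      by (simp add: v_def skew_coeff_sum)
    then show ?thesis by blast
  qed
  then obtain A where A: "p - (\<Sum>j<?N. Polynomial.smult (A p j) (v j)) \<in> commutator_traces a m" for p
    by metis
  let ?e = "\<lambda>i. Polynomial.monom 1 i :: 'k poly"
  \<comment> \<open>More unknowns than equations: a nontrivial combination of low powers of \<open>z\<close> is trivial modulo
      commutators.\<close>
  obtain c where c: "\<exists>i<?M. c i \<noteq> 0" "\<forall>j<?N. (\<Sum>i<?M. c i * A (?e i) j) = 0"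
    using homogeneous_system[of "{..<?N}" "{..<?M}" "\<lambda>i. A (?e i)"] NM by auto
  define r where "r = (\<Sum>i<?M. Polynomial.smult (c i) (?e i))"
  have coeff_r: "Polynomial.coeff r i = (if i < ?M then c i else 0)" for i
  proof -
    have "Polynomial.coeff r i = (\<Sum>j<?M. if j = i then c j else 0)"
      unfolding r_def coeff_sum by (rule sum.cong) auto
    then show ?thesis by (simp only: sum.delta finite_lessThan lessThan_iff)
  qed
  have "r = (\<Sum>i<?M. Polynomial.smult (c i) (?e i - (\<Sum>j<?N. Polynomial.smult (A (?e i) j) (v j))))"
  proof -
    have "(\<Sum>i<?M. Polynomial.smult (c i) (\<Sum>j<?N. Polynomial.smult (A (?e i) j) (v j)))
      = (\<Sum>i<?M. \<Sum>j<?N. Polynomial.smult (c i * A (?e i) j) (v j))"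
      by (simp only: smult_sum_right smult_smult)
    also have "\<dots> = (\<Sum>j<?N. \<Sum>i<?M. Polynomial.smult (c i * A (?e i) j) (v j))"
      by (rule sum.swap)
    also have "\<dots> = (\<Sum>j<?N. Polynomial.smult (\<Sum>i<?M. c i * A (?e i) j) (v j))"
      by (simp only: smult_sum)
    also have "\<dots> = 0" by (rule sum.neutral) (use c(2) in auto)
    finally show ?thesis by (simp only: r_def smult_diff_right sum_subtractf diff_0_right)
  qed
  also have "\<dots> \<in> commutator_traces a m" by (intro commutator_traces_sum commutator_traces_smult A)
  finally have "r \<in> commutator_traces a m" .
  moreover have "r \<noteq> 0"
  proof -
    obtain i where "i < ?M" "c i \<noteq> 0" using c(1) by blast
    then have "Polynomial.coeff r i \<noteq> 0" by (simp only: coeff_r if_True not_False_eq_True)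
    then show ?thesis by auto
  qed
  ultimately have "Polynomial.degree r \<ge> ?M" using commutator_traces_degree[OF pos(2,3)] by simp
  then have "Polynomial.lead_coeff r = 0" unfolding coeff_r[of "Polynomial.degree r"]
      by (intro if_not_P) linarith
  then show False using \<open>r \<noteq> 0\<close> by (metis leading_coeff_0_iff)
qed

lemma veronese_iso_eq:
  fixes a :: "'k::field_char_0 poly"
  assumes pos: "n > 0" "m > 0" "Polynomial.degree a > 0"
    and h: "bij_betw h (veronese a n) (veronese a m)" "subalg_hom (veronese a n) h"
  shows "n = m"
proof (rule antisym)
  show "m \<le> n" by (rule veronese_iso_le[OF assms])
  let ?g = "inv_into (veronese a n) h"
  have g: "bij_betw ?g (veronese a m) (veronese a n)" using h(1) by (rule bij_betw_inv_into)
  have inv: "?g (h F) = F" if "F \<in> veronese a n" for F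
    using that h(1) by (simp add: bij_betw_inv_into_left)
  have "subalg_hom (veronese a m) ?g"
    unfolding subalg_hom_def
  proof (intro conjI allI ballI)
    show "?g (skew_scalar c) = skew_scalar c" for c
      using inv[of "skew_scalar c"] h(2) subalg_veronese[of a n]
          by (simp add: subalg_hom_def subalg_def)
    fix F G assume "F \<in> veronese a m" "G \<in> veronese a m"
    then obtain F' G' where FG: "F' \<in> veronese a n" "F = h F'" "G' \<in> veronese a n" "G = h G'"
      using h(1) by (metis bij_betw_imp_surj_on imageE)
    then have "F' + G' \<in> veronese a n" "F' * G' \<in> veronese a n"
      using subalg_veronese[of a n] by (auto simp: subalg_def)
    then show "?g (F + G) = ?g F + ?g G" "?g (F * G) = ?g F * ?g G"
      using h(2) inv FG by (metis subalg_hom_def)+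
  qed
  then show "n \<le> m" by (rule veronese_iso_le[OF pos(2,1,3) g])
qed

section \<open>Homomorphisms out of the graded model\<close>

lemma subalg_hom_D:
  assumes "subalg_hom S h"
  shows "h (skew_scalar c) = skew_scalar c" "F \<in> S \<Longrightarrow> G \<in> S \<Longrightarrow> h (F + G) = h F + h G"
    "F \<in> S \<Longrightarrow> G \<in> S \<Longrightarrow> h (F * G) = h F * h G"
  using assms by (auto simp: subalg_hom_def)

lemma subalg_D:
  assumes "subalg S"
  shows "skew_scalar c \<in> S" "F \<in> S \<Longrightarrow> G \<in> S \<Longrightarrow> F + G \<in> S" "F \<in> S \<Longrightarrow> G \<in> S \<Longrightarrow> F - G \<in> S"
    "F \<in> S \<Longrightarrow> G \<in> S \<Longrightarrow> F * G \<in> S"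
  using assms by (auto simp: subalg_def)

lemmas gwa_model_closed = subalg_D[OF subalg_gwa_model]

lemma std_gens_gwa_model: "std_gens a g \<in> gwa_model a"
  unfolding range_free_eval_std_gens[symmetric] by (metis free_eval_gen rangeI)

lemma free_eval_in_subalg:
  assumes "subalg S" "\<And>g. U g \<in> S" shows "free_eval U p \<in> S"
  by (induction p rule: free_gen_induct)
    (use subalg_D[OF assms(1)] assms(2) subalg_D(1)[OF assms(1), of 1] in
      \<open>auto simp: free_eval_mult free_eval_add skew_scalar_simps\<close>)

lemma hom_free_eval:
  assumes "subalg_hom (gwa_model a) h"
  shows "h (free_eval (std_gens a) p) = free_eval (\<lambda>g. h (std_gens a g)) p"
proof -
  have mem: "free_eval (std_gens a) q \<in> gwa_model a" for q using range_free_eval_std_gens[of a] by blast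
  show ?thesis
  proof (induction p rule: free_gen_induct)
    case one
    show ?case using subalg_hom_D(1)[OF assms, of 1] by (simp add: skew_scalar_simps)
  qed (simp_all add: free_eval_mult free_eval_add subalg_hom_D[OF assms] mem gwa_model_closed
      std_gens_gwa_model)
qed

lemma hom_unique:
  assumes "subalg_hom (gwa_model a) h" "subalg_hom (gwa_model a) h'" "\<And>g. h (std_gens a g)
      = h' (std_gens a g)"
    and "F \<in> gwa_model a"
  shows "h F = h' F"
proof -
  obtain p where "F = free_eval (std_gens a) p" using assms(4) range_free_eval_std_gens[of a] by auto
  then show ?thesis using hom_free_eval[OF assms(1)] hom_free_eval[OF assms(2)] assms(3) by simp
qed

text \<open>The value at the image of \<open>p\<close> is the evaluation of \<open>p\<close> at the new generators; it does not
  depend on \<open>p\<close>, because both evaluations vanish on the defining ideal and the first one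
  vanishes nowhere else.\<close>

lemma hom_exists:
  assumes "a \<noteq> 0" "gwa_triple a U" "\<And>g. U g \<in> gwa_model a"
  shows "\<exists>h. subalg_hom (gwa_model a) h \<and> h ` gwa_model a \<subseteq> gwa_model a \<and> (\<forall>g. h (std_gens a g) = U g)"
proof -
  define h where "h F = free_eval U (SOME p. free_eval (std_gens a) p = F)" for F
  have h: "h (free_eval (std_gens a) p) = free_eval U p" for p
  proof -
    define q where "q = (SOME q. free_eval (std_gens a) q = free_eval (std_gens a) p)"
    have "free_eval (std_gens a) q = free_eval (std_gens a) p" unfolding q_def by (rule someI) simp
    then have "free_eval (std_gens a) (q - p) = 0" by (simp add: free_eval_diff)
    then have "free_eval U (q - p) = 0" using free_eval_gwa_ideal[OF assms(2)]
        by (simp add: free_eval_std_gens_eq_0_iff[OF assms(1)])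
    then show ?thesis by (simp add: free_eval_diff h_def q_def)
  qed
  have "subalg_hom (gwa_model a) h"
    unfolding subalg_hom_def
  proof (intro conjI allI ballI)
    show "h (skew_scalar c) = skew_scalar c" for c using h[of "free_scalar c"] by simp
    fix F G assume "F \<in> gwa_model a" "G \<in> gwa_model a"
    then obtain p q where "F = free_eval (std_gens a) p" "G = free_eval (std_gens a) q"
      unfolding range_free_eval_std_gens[of a, symmetric] by blast
    then show "h (F + G) = h F + h G" "h (F * G) = h F * h G"
      by (simp_all add: h flip: free_eval_add free_eval_mult)
  qed
  moreover have "h F \<in> gwa_model a" if F: "F \<in> gwa_model a" for F
  proof -
    obtain p where "F = free_eval (std_gens a) p" using F unfolding range_free_eval_std_gens[of a,
        symmetric] by blast
    moreover have "free_eval U p \<in> gwa_model a" by (rule free_eval_in_subalg[OF subalg_gwa_model])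
        (rule assms(3))
    ultimately show ?thesis by (simp add: h)
  qed
  moreover have "h (std_gens a g) = U g" for g using h[of "free_gen g"] by simp
  ultimately show ?thesis by blast
qed

section \<open>The three-dimensional Lie subalgebra\<close>

text \<open>For monic quadratic \<open>a\<close> this shift of \<open>z\<close> makes \<open>[x, y]\<close> equal to \<open>-2h\<close> without a constant
  term, so that \<open>x, y, h\<close> span a Lie algebra.\<close>

definition sl2_h :: "'k::field poly \<Rightarrow> 'k skew" where
  "sl2_h a = skew_poly [:- ((1 - Polynomial.coeff a 1) / 2), 1:]"

definition sl2_vec :: "'k::field poly \<Rightarrow> 'k \<Rightarrow> 'k \<Rightarrow> 'k \<Rightarrow> 'k skew" where
  "sl2_vec a \<alpha> \<beta> \<gamma> = skew_scalar \<alpha> * skew_monom 1 1 + skew_scalar \<beta> * skew_monom (-1) a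
      + skew_scalar \<gamma> * sl2_h a"

definition sl2_part :: "'k::field poly \<Rightarrow> 'k skew set" where
  "sl2_part a = {sl2_vec a \<alpha> \<beta> \<gamma> | \<alpha> \<beta> \<gamma>. True}"

lemma sl2_vec_sl2_part [simp]:
  "sl2_vec a \<alpha> \<beta> \<gamma> \<in> sl2_part a" by (auto simp: sl2_part_def)

lemma sl2_h_std_gens: "sl2_h a = std_gens a Gen_z - skew_scalar ((1 - Polynomial.coeff a 1) / 2)"
  by (simp add: sl2_h_def skew_scalar_def flip: skew_poly_simps)

lemma sl2_part_gwa_model: "sl2_part a \<subseteq> gwa_model a"
  using std_gens_gwa_model[of a Gen_x] std_gens_gwa_model[of a Gen_y] std_gens_gwa_model[of a Gen_z]
  by (auto simp: sl2_part_def sl2_vec_def sl2_h_std_gens intro!: gwa_model_closed)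

lemma sl2_vec_mem [simp]:
  "sl2_vec a \<alpha> \<beta> \<gamma> \<in> gwa_model a" using sl2_part_gwa_model sl2_vec_sl2_part by blast

lemma sl2_vec_add:
  "sl2_vec a \<alpha> \<beta> \<gamma> + sl2_vec a \<alpha>' \<beta>' \<gamma>' = sl2_vec a (\<alpha> + \<alpha>') (\<beta> + \<beta>') (\<gamma> + \<gamma>')"
  by (simp add: sl2_vec_def skew_scalar_simps algebra_simps)

lemma sl2_vec_scale:
  "skew_scalar c * sl2_vec a \<alpha> \<beta> \<gamma> = sl2_vec a (c * \<alpha>) (c * \<beta>) (c * \<gamma>)"
  by (simp add: sl2_vec_def skew_scalar_simps distrib_left mult.assoc)

lemma sl2_vec_simps:
  "skew_monom 1 1 = sl2_vec a 1 0 0" "skew_monom (-1) a = sl2_vec a 0 1 0" "sl2_h a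
      = sl2_vec a 0 0 1" "0 = sl2_vec a 0 0 0"
  by (simp_all add: sl2_vec_def skew_scalar_simps)

lemma sl2_vec_eq_iff:
  assumes "a \<noteq> 0"
  shows "sl2_vec a \<alpha> \<beta> \<gamma> = sl2_vec a \<alpha>' \<beta>' \<gamma>' \<longleftrightarrow> \<alpha> = \<alpha>' \<and> \<beta> = \<beta>' \<and> \<gamma> = \<gamma>'"
proof
  assume eq: "sl2_vec a \<alpha> \<beta> \<gamma> = sl2_vec a \<alpha>' \<beta>' \<gamma>'"
  have "skew_coeff (sl2_vec a \<alpha> \<beta> \<gamma>) 1 = [:\<alpha>:]" "skew_coeff (sl2_vec a \<alpha> \<beta> \<gamma>) (-1)
      = Polynomial.smult \<beta> a"
    "Polynomial.coeff (skew_coeff (sl2_vec a \<alpha> \<beta> \<gamma>) 0) 1 = \<gamma>" for \<alpha> \<beta> \<gamma>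
    by (simp_all add: sl2_vec_def sl2_h_def)
  note * = this
  have "[:\<alpha>:] = [:\<alpha>':]" "Polynomial.smult \<beta> a = Polynomial.smult \<beta>' a" "\<gamma> = \<gamma>'"
    using * [of \<alpha> \<beta> \<gamma>] * [of \<alpha>' \<beta>' \<gamma>'] unfolding eq by metis+
  moreover from this(2) have "Polynomial.smult (\<beta> - \<beta>') a = 0" by (simp add: smult_diff_left)
  ultimately show "\<alpha> = \<alpha>' \<and> \<beta> = \<beta>' \<and> \<gamma> = \<gamma>'" using assms by simp
qed simp

text \<open>A monic quadratic polynomial with root \<open>0\<close> is written in terms of the number \<open>\<kappa>\<close> for which
  \<open>h = z - \<kappa>\<close>. This keeps the computations with the relations free of fractions.\<close>

locale quadratic =
  fixes a :: "'k::{alg_closed_field, field_char_0} poly" and \<kappa> :: 'k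
  assumes a: "a = [:0, 1 - 2 * \<kappa>, 1:]"
begin

lemma sl2_h_a: "sl2_h a = skew_poly [:- \<kappa>, 1:]" by (simp add: sl2_h_def a)

lemma a_nonzero: "a \<noteq> 0" by (simp add: a)

lemma sl2_vec_bracket:
  "sl2_vec a \<alpha> \<beta> \<gamma> * sl2_vec a \<alpha>' \<beta>' \<gamma>' - sl2_vec a \<alpha>' \<beta>' \<gamma>' * sl2_vec a \<alpha> \<beta> \<gamma>
   = sl2_vec a (\<gamma> * \<alpha>' - \<alpha> * \<gamma>') (\<beta> * \<gamma>' - \<gamma> * \<beta>') (- 2 * (\<alpha> * \<beta>' - \<beta> * \<alpha>'))"
  unfolding sl2_vec_def sl2_h_a skew_scalar_def skew_poly_def
  by (rule skew_eqI)
    (auto simp: a sigma_pow_def pcompose_pCons algebra_simps smult_add_right)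

lemma poly_at_a: "sk.poly_at Z a = Z * (skew_scalar (1 - 2 * \<kappa>) + Z)"
  by (simp add: a sk.poly_at_pCons sk.s_0 sk.s_1)

lemma poly_at_sigma_pow_a:
  "sk.poly_at Z (sigma_pow 1 a) = skew_scalar (2 * \<kappa>) + Z * (skew_scalar (- 1 - 2 * \<kappa>) + Z)"
proof -
  have "sigma_pow 1 a = [:2 * \<kappa>, - 1 - 2 * \<kappa>, 1:]" by (simp add: a sigma_pow_def pcompose_pCons)
  then show ?thesis by (simp add: sk.poly_at_pCons sk.s_1)
qed

text \<open>Conjugating automorphisms are carried along with their inverses, because restricted to the
  model they are inverse to each other while as total functions they need not be.\<close>

definition inverse_pair :: "('k skew \<Rightarrow> 'k skew) \<Rightarrow> ('k skew \<Rightarrow> 'k skew) \<Rightarrow> bool" where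
  "inverse_pair \<psi> \<psi>' \<longleftrightarrow> subalg_hom (gwa_model a) \<psi> \<and> subalg_hom (gwa_model a) \<psi>'
      \<and> \<psi> ` gwa_model a \<subseteq> gwa_model a \<and> \<psi>' ` gwa_model a \<subseteq> gwa_model a
     \<and> \<psi> ` sl2_part a \<subseteq> sl2_part a \<and> \<psi>' ` sl2_part a \<subseteq> sl2_part a
     \<and> (\<forall>F\<in>gwa_model a. \<psi>' (\<psi> F) = F \<and> \<psi> (\<psi>' F) = F)"

lemma subalg_hom_comp:
  assumes "subalg_hom (gwa_model a) \<phi>" "subalg_hom (gwa_model a) \<psi>" "\<psi> ` gwa_model a \<subseteq> gwa_model a"
  shows "subalg_hom (gwa_model a) (\<phi> \<circ> \<psi>)"
  using assms unfolding subalg_hom_def image_subset_iff comp_def by simp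

lemma inverse_pair_id: "inverse_pair id id" by (auto simp: inverse_pair_def subalg_hom_def)

lemma inverse_pair_comp:
  "inverse_pair \<psi> \<psi>' \<Longrightarrow> inverse_pair \<chi> \<chi>' \<Longrightarrow> inverse_pair (\<psi> \<circ> \<chi>) (\<chi>' \<circ> \<psi>')"
  unfolding inverse_pair_def by (auto intro!: subalg_hom_comp simp: image_subset_iff)

lemma hom_sl2_vec:
  assumes "subalg_hom (gwa_model a) \<psi>"
  shows "\<psi> (sl2_vec a \<alpha> \<beta> \<gamma>) = skew_scalar \<alpha> * \<psi> (skew_monom 1 1)
      + skew_scalar \<beta> * \<psi> (skew_monom (-1) a) + skew_scalar \<gamma> * \<psi> (sl2_h a)"
proof -
  have "skew_monom 1 1 \<in> gwa_model a" "skew_monom (-1) a \<in> gwa_model a" "sl2_h a \<in> gwa_model a"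
      by (simp_all add: sl2_vec_simps[of a])
  then show ?thesis
    by (simp add: sl2_vec_def subalg_hom_D[OF assms] gwa_model_closed)
qed

lemma hom_scale:
  "subalg_hom (gwa_model a) \<psi> \<Longrightarrow> F \<in> gwa_model a \<Longrightarrow> \<psi> (skew_scalar c * F) = skew_scalar c * \<psi> F"
  by (simp add: subalg_hom_D gwa_model_closed)

text \<open>This is \<open>exp (s ad x)\<close>: the series stops after the quadratic term, with \<open>h \<mapsto> h - s x\<close> and
  \<open>y \<mapsto> y - 2 s h + s\<^sup>2 x\<close>.\<close>

lemma exp_hom:
  "\<exists>\<psi>. subalg_hom (gwa_model a) \<psi> \<and> \<psi> ` gwa_model a \<subseteq> gwa_model a \<and>
     (\<forall>\<alpha> \<beta> \<gamma>. \<psi> (sl2_vec a \<alpha> \<beta> \<gamma>) = sl2_vec a (\<alpha> - \<gamma> * s + \<beta> * s\<^sup>2) \<beta> (\<gamma> - 2 * s * \<beta>))"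
proof -
  define U where "U = (\<lambda>g. case g of Gen_x \<Rightarrow> sl2_vec a 1 0 0 | Gen_y \<Rightarrow> sl2_vec a (s\<^sup>2) 1 (- 2 * s)
    | Gen_z \<Rightarrow> sl2_vec a (- s) 0 1 + skew_scalar \<kappa>)"
  have "gwa_triple a U"
    unfolding gwa_triple_def U_def gwa_sigma_sigma_pow gwa_gen.case poly_at_a poly_at_sigma_pow_a
        sl2_vec_def sl2_h_a skew_scalar_def skew_poly_def
    by (intro conjI; rule skew_eqI)
      (auto simp: a sigma_pow_def pcompose_pCons algebra_simps skew_coeff_one
        smult_add_right power2_eq_square numeral_poly)
  moreover have "U g \<in> gwa_model a" for g by (cases g) (auto simp: U_def intro!: gwa_model_closed)
  ultimately obtain \<psi> where \<psi>: "subalg_hom (gwa_model a) \<psi>" "\<psi> ` gwa_model a \<subseteq> gwa_model a"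
      "\<And>g. \<psi> (std_gens a g) = U g"
    using hom_exists[OF a_nonzero] by metis
  have x: "\<psi> (skew_monom 1 1) = sl2_vec a 1 0 0" and y: "\<psi> (skew_monom (-1) a)
      = sl2_vec a (s\<^sup>2) 1 (- 2 * s)"
    using \<psi>(3)[of Gen_x] \<psi>(3)[of Gen_y] by (simp_all add: U_def)
  have "sl2_h a + skew_scalar \<kappa> = std_gens a Gen_z" by (simp add: sl2_h_std_gens a)
  then have "\<psi> (sl2_h a) + skew_scalar \<kappa> = U Gen_z"
    by (metis \<psi>(1,3) subalg_hom_D(1,2) gwa_model_closed(1) sl2_vec_mem sl2_vec_simps(3))
  then have h: "\<psi> (sl2_h a) = sl2_vec a (- s) 0 1" by (simp add: U_def)
  have "\<psi> (sl2_vec a \<alpha> \<beta> \<gamma>) = sl2_vec a (\<alpha> - \<gamma> * s + \<beta> * s\<^sup>2) \<beta> (\<gamma> - 2 * s * \<beta>)" for \<alpha> \<beta> \<gamma>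
    unfolding hom_sl2_vec[OF \<psi>(1)] x y h sl2_vec_scale sl2_vec_add by (simp add: algebra_simps)
  with \<psi> show ?thesis by blast
qed

text \<open>The nontrivial element of the Weyl group of the torus that fixes \<open>h\<close>.\<close>

lemma swap_hom:
  "\<exists>\<psi>. subalg_hom (gwa_model a) \<psi> \<and> \<psi> ` gwa_model a \<subseteq> gwa_model a \<and>
     (\<forall>\<alpha> \<beta> \<gamma>. \<psi> (sl2_vec a \<alpha> \<beta> \<gamma>) = sl2_vec a \<beta> \<alpha> (- \<gamma>))"
proof -
  define U where "U = (\<lambda>g. case g of Gen_x \<Rightarrow> sl2_vec a 0 1 0 | Gen_y \<Rightarrow> sl2_vec a 1 0 0
    | Gen_z \<Rightarrow> sl2_vec a 0 0 (-1) + skew_scalar \<kappa>)"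
  have "gwa_triple a U"
    unfolding gwa_triple_def U_def gwa_sigma_sigma_pow gwa_gen.case poly_at_a poly_at_sigma_pow_a
        sl2_vec_def sl2_h_a skew_scalar_def skew_poly_def
    by (intro conjI; rule skew_eqI)
      (auto simp: a sigma_pow_def pcompose_pCons algebra_simps skew_coeff_one
        smult_add_right power2_eq_square numeral_poly)
  moreover have "U g \<in> gwa_model a" for g by (cases g) (auto simp: U_def intro!: gwa_model_closed)
  ultimately obtain \<psi> where \<psi>: "subalg_hom (gwa_model a) \<psi>" "\<psi> ` gwa_model a \<subseteq> gwa_model a"
      "\<And>g. \<psi> (std_gens a g) = U g"
    using hom_exists[OF a_nonzero] by metis
  have x: "\<psi> (skew_monom 1 1) = sl2_vec a 0 1 0" and y: "\<psi> (skew_monom (-1) a) = sl2_vec a 1 0 0"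
    using \<psi>(3)[of Gen_x] \<psi>(3)[of Gen_y] by (simp_all add: U_def)
  have "sl2_h a + skew_scalar \<kappa> = std_gens a Gen_z" by (simp add: sl2_h_std_gens a)
  then have "\<psi> (sl2_h a) + skew_scalar \<kappa> = U Gen_z"
    by (metis \<psi>(1,3) subalg_hom_D(1,2) gwa_model_closed(1) sl2_vec_mem sl2_vec_simps(3))
  then have h: "\<psi> (sl2_h a) = sl2_vec a 0 0 (- 1)" by (simp add: U_def)
  have "\<psi> (sl2_vec a \<alpha> \<beta> \<gamma>) = sl2_vec a \<beta> \<alpha> (- \<gamma>)" for \<alpha> \<beta> \<gamma>
    unfolding hom_sl2_vec[OF \<psi>(1)] x y h sl2_vec_scale sl2_vec_add by (simp add: algebra_simps)
  with \<psi> show ?thesis by blast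
qed

lemma hom_id_on_sl2_part:
  assumes "subalg_hom (gwa_model a) \<psi>" "\<And>\<alpha> \<beta> \<gamma>. \<psi> (sl2_vec a \<alpha> \<beta> \<gamma>) = sl2_vec a \<alpha> \<beta> \<gamma>" "F \<in> gwa_model a"
  shows "\<psi> F = F"
proof -
  have "\<psi> (std_gens a g) = std_gens a g" for g
  proof (cases g)
    case Gen_z
    have "std_gens a Gen_z = sl2_vec a 0 0 1 + skew_scalar \<kappa>"
        by (simp add: sl2_h_std_gens a flip: sl2_vec_simps)
    then show ?thesis using Gen_z assms(2)
      by (simp add: subalg_hom_D[OF assms(1)] gwa_model_closed del: std_gens.simps)
  qed (use assms(2)[of 1 0 0] assms(2)[of 0 1 0] in \<open>simp_all flip: sl2_vec_simps\<close>)
  then show ?thesis using hom_unique[OF assms(1), of id F] assms(3) by (simp add: subalg_hom_def)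
qed

lemma inverse_pairI:
  assumes "subalg_hom (gwa_model a) \<psi>" "\<psi> ` gwa_model a \<subseteq> gwa_model a"
      "\<And>\<alpha> \<beta> \<gamma>. \<psi> (sl2_vec a \<alpha> \<beta> \<gamma>) \<in> sl2_part a"
    "subalg_hom (gwa_model a) \<psi>'" "\<psi>' ` gwa_model a \<subseteq> gwa_model a"
        "\<And>\<alpha> \<beta> \<gamma>. \<psi>' (sl2_vec a \<alpha> \<beta> \<gamma>) \<in> sl2_part a"
    "\<And>\<alpha> \<beta> \<gamma>. \<psi>' (\<psi> (sl2_vec a \<alpha> \<beta> \<gamma>)) = sl2_vec a \<alpha> \<beta> \<gamma>" "\<And>\<alpha> \<beta> \<gamma>. \<psi> (\<psi>' (sl2_vec a \<alpha> \<beta> \<gamma>))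
        = sl2_vec a \<alpha> \<beta> \<gamma>"
  shows "inverse_pair \<psi> \<psi>'"
  unfolding inverse_pair_def
  using assms hom_id_on_sl2_part[OF subalg_hom_comp[OF assms(4,1,2)]] hom_id_on_sl2_part[OF
      subalg_hom_comp[OF assms(1,4,5)]]
  by (auto simp: sl2_part_def)

text \<open>Equivalence of two vectors of \<open>W\<close> under automorphisms, in coordinates with respect to
  \<open>x, y, h\<close>.\<close>

definition reach :: "'k \<Rightarrow> 'k \<Rightarrow> 'k \<Rightarrow> 'k \<Rightarrow> 'k \<Rightarrow> 'k \<Rightarrow> bool" where
  "reach \<alpha> \<beta> \<gamma> \<alpha>' \<beta>' \<gamma>' \<longleftrightarrow> (\<exists>\<psi> \<psi>'. inverse_pair \<psi> \<psi>' \<and> \<psi> (sl2_vec a \<alpha> \<beta> \<gamma>) = sl2_vec a \<alpha>' \<beta>' \<gamma>')"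

lemma reach_refl: "reach \<alpha> \<beta> \<gamma> \<alpha> \<beta> \<gamma>"
  unfolding reach_def using inverse_pair_id by force

lemma reach_trans:
  "reach \<alpha> \<beta> \<gamma> \<alpha>' \<beta>' \<gamma>' \<Longrightarrow> reach \<alpha>' \<beta>' \<gamma>' \<alpha>'' \<beta>'' \<gamma>'' \<Longrightarrow> reach \<alpha> \<beta> \<gamma> \<alpha>'' \<beta>'' \<gamma>''"
  unfolding reach_def using inverse_pair_comp by (metis comp_apply)

lemma reach_exp:
  "reach \<alpha> \<beta> \<gamma> (\<alpha> - \<gamma> * s + \<beta> * s\<^sup>2) \<beta> (\<gamma> - 2 * s * \<beta>)"
proof -
  obtain \<psi> \<psi>' where 1: "subalg_hom (gwa_model a) \<psi>" "\<psi> ` gwa_model a \<subseteq> gwa_model a"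
      "\<And>\<alpha> \<beta> \<gamma>. \<psi> (sl2_vec a \<alpha> \<beta> \<gamma>) = sl2_vec a (\<alpha> - \<gamma> * s + \<beta> * s\<^sup>2) \<beta> (\<gamma> - 2 * s * \<beta>)"
    and 2: "subalg_hom (gwa_model a) \<psi>'" "\<psi>' ` gwa_model a \<subseteq> gwa_model a"
      "\<And>\<alpha> \<beta> \<gamma>. \<psi>' (sl2_vec a \<alpha> \<beta> \<gamma>) = sl2_vec a (\<alpha> - \<gamma> * (- s) + \<beta> * (- s)\<^sup>2) \<beta> (\<gamma> - 2 * (- s) * \<beta>)"
    using exp_hom[of s] exp_hom[of "- s"] by metis
  have "inverse_pair \<psi> \<psi>'"
    by (rule inverse_pairI[OF 1(1,2) _ 2(1,2)]) (simp_all add: 1(3) 2(3) algebra_simps power2_eq_square)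
  with 1(3) show ?thesis unfolding reach_def by blast
qed

lemma reach_swap: "reach \<alpha> \<beta> \<gamma> \<beta> \<alpha> (- \<gamma>)"
proof -
  obtain \<psi> where 1: "subalg_hom (gwa_model a) \<psi>" "\<psi> ` gwa_model a \<subseteq> gwa_model a"
      "\<And>\<alpha> \<beta> \<gamma>. \<psi> (sl2_vec a \<alpha> \<beta> \<gamma>) = sl2_vec a \<beta> \<alpha> (- \<gamma>)"
    using swap_hom by metis
  have "inverse_pair \<psi> \<psi>"
    by (rule inverse_pairI[OF 1(1,2) _ 1(1,2)]) (simp_all add: 1(3))
  with 1(3) show ?thesis unfolding reach_def by blast
qed

text \<open>The invariant \<open>\<gamma>\<^sup>2 - 4 \<alpha> \<beta>\<close> decides which of the two cases occurs. If \<open>\<beta> \<noteq> 0\<close>, the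
  exponential with parameter \<open>\<gamma> / (2 \<beta>)\<close> removes the coordinate of \<open>h\<close>. If a coordinate of \<open>x\<close>
  remains, an exponential whose parameter is a square root removes it, and a swap followed by a
  third exponential leaves a multiple of \<open>h\<close>.\<close>

lemma reach_normal:
  assumes "\<alpha> \<noteq> 0 \<or> \<beta> \<noteq> 0 \<or> \<gamma> \<noteq> 0"
  shows "\<exists>c. c \<noteq> 0 \<and> (reach \<alpha> \<beta> \<gamma> c 0 0 \<or> reach \<alpha> \<beta> \<gamma> 0 0 c)"
proof -
  have 0: "reach \<alpha> 0 \<gamma> 0 0 \<gamma>" if "\<gamma> \<noteq> 0" for \<alpha> \<gamma>
    using reach_exp[of \<alpha> 0 \<gamma> "\<alpha> / \<gamma>"] that by simp
  show ?thesis
  proof (cases "\<beta> = 0")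
    case True
    then show ?thesis using assms 0 reach_refl[of \<alpha> 0 0] by (cases "\<gamma> = 0") auto
  next
    case False
    define \<alpha>' where "\<alpha>' = \<alpha> - \<gamma>\<^sup>2 / (4 * \<beta>)"
    have 1: "reach \<alpha> \<beta> \<gamma> \<alpha>' \<beta> 0"
    proof -
      have "\<alpha> - \<gamma> * (\<gamma> / (2 * \<beta>)) + \<beta> * (\<gamma> / (2 * \<beta>))\<^sup>2 = \<alpha>'"
        using False by (simp add: \<alpha>'_def field_simps power2_eq_square)
      moreover have "\<gamma> - 2 * (\<gamma> / (2 * \<beta>)) * \<beta> = 0" using False by simp
      ultimately show ?thesis using reach_exp[of \<alpha> \<beta> \<gamma> "\<gamma> / (2 * \<beta>)"] by simp
    qed
    show ?thesis
    proof (cases "\<alpha>' = 0")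
      case True
      then have "reach \<alpha> \<beta> \<gamma> \<beta> 0 0" using reach_trans[OF 1 reach_swap] by simp
      then show ?thesis using False by blast
    next
      case nz: False
      obtain r where r: "r\<^sup>2 = - \<alpha>' / \<beta>" using nth_root_exists[of 2 "- \<alpha>' / \<beta>"] by auto
      then have "r \<noteq> 0" using nz False by auto
      have "\<alpha>' - 0 * r + \<beta> * r\<^sup>2 = 0" using False by (simp add: r)
      then have 2: "reach \<alpha>' \<beta> 0 0 \<beta> (- 2 * r * \<beta>)" using reach_exp[of \<alpha>' \<beta> 0 r] by simp
      have 3: "reach 0 \<beta> (- 2 * r * \<beta>) \<beta> 0 (2 * r * \<beta>)" using reach_swap[of 0 \<beta> "- 2 * r * \<beta>"] by simp
      have nz': "2 * r * \<beta> \<noteq> 0" using \<open>r \<noteq> 0\<close> False by simp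
      have "reach \<alpha> \<beta> \<gamma> 0 0 (2 * r * \<beta>)"
        by (rule reach_trans[OF 1 reach_trans[OF 2 reach_trans[OF 3 0[OF nz']]]])
      with nz' show ?thesis by blast
    qed
  qed
qed

end

section \<open>Automorphisms of finite order\<close>

context quadratic begin

definition finite_order_aut :: "nat \<Rightarrow> ('k skew \<Rightarrow> 'k skew) \<Rightarrow> bool" where
  "finite_order_aut n g \<longleftrightarrow> n > 0 \<and> subalg_hom (gwa_model a) g \<and> g ` gwa_model a \<subseteq> gwa_model a
      \<and> g ` sl2_part a \<subseteq> sl2_part a
     \<and> (\<forall>F\<in>gwa_model a. (g ^^ n) F = F)"

lemma finite_order_aut_D:
  assumes "finite_order_aut n g"
  shows "n > 0" "subalg_hom (gwa_model a) g" "F \<in> gwa_model a \<Longrightarrow> g F \<in> gwa_model a" "w \<in> sl2_part a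
      \<Longrightarrow> g w \<in> sl2_part a"
    "F \<in> gwa_model a \<Longrightarrow> (g ^^ n) F = F"
  using assms by (auto simp: finite_order_aut_def)

lemma finite_order_aut_inj: assumes "finite_order_aut n g" "F \<in> gwa_model a" "g F = 0" shows "F = 0"
proof -
  obtain m where m: "n = Suc m" using finite_order_aut_D(1)[OF assms(1)] by (cases n) auto
  have "(g ^^ k) 0 = 0" for k
    by (induction k) (simp_all add: subalg_hom_simps(1)[OF subalg_gwa_model finite_order_aut_D(2)[OF
        assms(1)]])
  then have "(g ^^ n) F = 0" using assms(3) by (simp add: m funpow_swap1)
  then show ?thesis using finite_order_aut_D(5)[OF assms(1,2)] by simp
qed

text \<open>The vector \<open>q(g) v\<close>, for a polynomial \<open>q\<close> in the linear map \<open>g\<close>.\<close>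

definition poly_of_map :: "('k skew \<Rightarrow> 'k skew) \<Rightarrow> 'k poly \<Rightarrow> 'k skew \<Rightarrow> 'k skew" where
  "poly_of_map g q v = (\<Sum>i\<le>Polynomial.degree q. skew_scalar (Polynomial.coeff q i) * (g ^^ i) v)"

lemma poly_of_map_superset:
  "Polynomial.degree q \<le> m \<Longrightarrow> poly_of_map g q v = (\<Sum>i\<le>m. skew_scalar (Polynomial.coeff q i) * (g ^^
      i) v)"
  unfolding poly_of_map_def by (rule sum.mono_neutral_left) (auto simp: skew_scalar_simps coeff_eq_0)

lemma funpow_sl2_part: assumes "finite_order_aut n g" "v \<in> sl2_part a" shows "(g ^^ i) v \<in> sl2_part a"
  by (induction i) (use assms finite_order_aut_D(4) in auto)

lemma sl2_part_closed:
  "u \<in> sl2_part a \<Longrightarrow> v \<in> sl2_part a \<Longrightarrow> u + v \<in> sl2_part a" "u \<in> sl2_part a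
      \<Longrightarrow> skew_scalar c * u \<in> sl2_part a"
  by (auto simp: sl2_part_def sl2_vec_add sl2_vec_scale) (metis sl2_vec_add sl2_vec_scale)+

lemma sl2_part_sum:
  "(\<And>i. i \<in> A \<Longrightarrow> f i \<in> sl2_part a) \<Longrightarrow> sum f A \<in> sl2_part a"
  by (induction A rule: infinite_finite_induct) (auto intro: sl2_part_closed simp:
      sl2_vec_simps(4)[of a])

lemma poly_of_map_sl2_part:
  "finite_order_aut n g \<Longrightarrow> v \<in> sl2_part a \<Longrightarrow> poly_of_map g q v \<in> sl2_part a"
  unfolding poly_of_map_def by (intro sl2_part_sum sl2_part_closed funpow_sl2_part)

lemma poly_of_map_linear_factor:
  assumes g: "finite_order_aut n g" and v: "v \<in> sl2_part a"
  shows "poly_of_map g ([:- r, 1:] * q) v = g (poly_of_map g q v) - skew_scalar r * poly_of_map g q v"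
proof -
  let ?m = "Suc (Polynomial.degree q)"
  have gwa_model: "(g ^^ i) v \<in> gwa_model a" for i using funpow_sl2_part[OF g v] sl2_part_gwa_model
      by blast
  have "Polynomial.degree ([:- r, 1:] * q) \<le> ?m"
    by (rule order_trans[OF degree_mult_le]) simp
  then have "poly_of_map g ([:- r, 1:] * q) v
     = (\<Sum>i\<le>?m. skew_scalar (Polynomial.coeff (pCons 0 q) i) * (g ^^ i) v - skew_scalar r *
         (skew_scalar (Polynomial.coeff q i) * (g ^^ i) v))"
    by (simp only: poly_of_map_superset, intro sum.cong refl)
      (simp add: skew_scalar_simps left_diff_distrib mult.assoc)
  also have "\<dots> = (\<Sum>i\<le>?m. skew_scalar (Polynomial.coeff (pCons 0 q) i) * (g ^^ i) v)
     - skew_scalar r * (\<Sum>i\<le>?m. skew_scalar (Polynomial.coeff q i) * (g ^^ i) v)"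
    by (simp only: sum_subtractf sum_distrib_left)
  also have "(\<Sum>i\<le>?m. skew_scalar (Polynomial.coeff q i) * (g ^^ i) v) = poly_of_map g q v"
    by (rule poly_of_map_superset[symmetric]) simp
  also have "(\<Sum>i\<le>?m. skew_scalar (Polynomial.coeff (pCons 0 q) i) * (g ^^ i) v)
     = (\<Sum>i\<le>Polynomial.degree q. g (skew_scalar (Polynomial.coeff q i) * (g ^^ i) v))"
    by (simp del: sum.atMost_Suc add: sum.atMost_Suc_shift skew_scalar_simps hom_scale[OF
        finite_order_aut_D(2)[OF g] gwa_model])
  also have "\<dots> = g (poly_of_map g q v)"
    unfolding poly_of_map_def
    by (rule subalg_hom_sum[OF subalg_gwa_model finite_order_aut_D(2)[OF g], symmetric]) (simp add:
        gwa_model_closed gwa_model)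
  finally show ?thesis .
qed

text \<open>Linear factors of \<open>q\<close> are applied one after another; the last nonzero vector on the way to
  \<open>0\<close> is an eigenvector.\<close>

lemma eigenvector_of_annihilator:
  assumes g: "finite_order_aut n g"
  shows "q \<noteq> 0 \<Longrightarrow> v \<in> sl2_part a \<Longrightarrow> v \<noteq> 0 \<Longrightarrow> poly_of_map g q v = 0 \<Longrightarrow> \<exists>w\<in>sl2_part a. w \<noteq> 0 \<and> (\<exists>r. g w
      = skew_scalar r * w)"
proof (induction "Polynomial.degree q" arbitrary: q)
  case 0
  then obtain c where c: "q = [:c:]" by (metis degree_eq_zeroE)
  have "skew_scalar (inverse c) * (skew_scalar c * v) = v" using 0 c
    by (simp only: mult.assoc[symmetric] skew_scalar_simps(4)[symmetric]) (simp add: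
        skew_scalar_simps(2))
  then show ?case using 0 c by (simp add: poly_of_map_def)
next
  case (Suc d)
  then obtain r where "poly q r = 0" using alg_closed_imp_poly_has_root[of q] by auto
  then obtain q' where q: "q = [:- r, 1:] * q'" by (metis poly_eq_0_iff_dvd dvdE)
  with Suc have "q' \<noteq> 0" by auto
  have "Polynomial.degree q = Polynomial.degree [:- r, 1:] + Polynomial.degree q'"
    unfolding q by (rule degree_mult_eq) (use \<open>q' \<noteq> 0\<close> in auto)
  then have deg: "d = Polynomial.degree q'" using Suc(2) by simp
  show ?case
  proof (cases "poly_of_map g q' v = 0")
    case True
    show ?thesis by (rule Suc.hyps(1)[OF deg \<open>q' \<noteq> 0\<close> Suc.prems(2,3) True])
  next
    case False
    have "g (poly_of_map g q' v) = skew_scalar r * poly_of_map g q' v"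
      using Suc.prems(4) poly_of_map_linear_factor[OF g Suc.prems(2), of r q'] by (simp add: q)
    then show ?thesis using False poly_of_map_sl2_part[OF g Suc.prems(2)] by blast
  qed
qed

lemma eigenvector:
  assumes g: "finite_order_aut n g" shows "\<exists>w\<in>sl2_part a. w \<noteq> 0 \<and> (\<exists>r. g w = skew_scalar r * w)"
proof -
  let ?q = "Polynomial.monom 1 n - 1 :: 'k poly"
  let ?v = "sl2_vec a 1 0 0"
  have n: "n > 0" by (rule finite_order_aut_D(1)[OF g])
  have nz: "?v \<noteq> 0" by (simp add: sl2_vec_simps(4)[of a] sl2_vec_eq_iff[OF a_nonzero])
  have "Polynomial.coeff ?q n = 1" using n by (simp add: coeff_1)
  then have "?q \<noteq> 0" by (metis coeff_0 zero_neq_one)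
  have "Polynomial.degree ?q \<le> n" by (intro degree_diff_le) (simp_all add: degree_monom_le)
  then have "poly_of_map g ?q ?v = (\<Sum>i\<le>n. skew_scalar (Polynomial.coeff ?q i) * (g ^^ i) ?v)"
      by (rule poly_of_map_superset)
  also have "\<dots> = (\<Sum>i\<le>n. (if i = n then (g ^^ n) ?v else 0) - (if i = 0 then ?v else 0))"
    using n by (intro sum.cong) (auto simp: coeff_1 skew_scalar_simps)
  also have "\<dots> = 0" using n finite_order_aut_D(5)[OF g sl2_vec_mem] by (simp add: sum_subtractf)
  finally show ?thesis using eigenvector_of_annihilator[OF g \<open>?q \<noteq> 0\<close> sl2_vec_sl2_part nz] by blast
qed

lemma finite_order_aut_conj:
  assumes g: "finite_order_aut n g" and c: "inverse_pair \<psi> \<psi>'"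
  shows "finite_order_aut n (\<psi> \<circ> g \<circ> \<psi>')"
proof -
  note c' = c[unfolded inverse_pair_def image_subset_iff] and g'
      = g[unfolded finite_order_aut_def image_subset_iff]
  have pow: "F \<in> gwa_model a \<Longrightarrow> ((\<psi> \<circ> g \<circ> \<psi>') ^^ k) F = \<psi> ((g ^^ k) (\<psi>' F))
      \<and> (g ^^ k) (\<psi>' F) \<in> gwa_model a" for F k
    by (induction k) (use c' g' in auto)
  show ?thesis
    unfolding finite_order_aut_def
  proof (intro conjI ballI)
    show "subalg_hom (gwa_model a) (\<psi> \<circ> g \<circ> \<psi>')"
      using c' g' by (intro subalg_hom_comp) (auto simp: image_subset_iff)
    show "((\<psi> \<circ> g \<circ> \<psi>') ^^ n) F = F" if "F \<in> gwa_model a" for F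
      using pow[OF that, of n] g' c' that by simp
  qed (use c' g' in auto)
qed

text \<open>The form in which conjugacy to an automorphism that fixes \<open>h\<close> is composed with further
  conjugations.\<close>

definition conj_fixes_h :: "('k skew \<Rightarrow> 'k skew) \<Rightarrow> bool" where
  "conj_fixes_h g \<longleftrightarrow> (\<exists>\<psi> \<psi>'. inverse_pair \<psi> \<psi>' \<and> \<psi> (g (\<psi>' (sl2_h a))) = sl2_h a)"

lemma conj_fixes_h_conj:
  assumes c: "inverse_pair \<psi> \<psi>'" and f: "conj_fixes_h (\<psi> \<circ> g \<circ> \<psi>')"
  shows "conj_fixes_h g"
proof -
  obtain \<chi> \<chi>' where \<chi>: "inverse_pair \<chi> \<chi>'" "\<chi> ((\<psi> \<circ> g \<circ> \<psi>') (\<chi>' (sl2_h a))) = sl2_h a"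
    using f unfolding conj_fixes_h_def by blast
  then show ?thesis
    unfolding conj_fixes_h_def using inverse_pair_comp[OF \<chi>(1) c] by force
qed

lemma conj_eigen:
  assumes "inverse_pair \<psi> \<psi>'" "finite_order_aut n g" "w \<in> gwa_model a" "g w = skew_scalar r * w"
  shows "(\<psi> \<circ> g \<circ> \<psi>') (\<psi> w) = skew_scalar r * \<psi> w"
  using assms hom_scale[of \<psi> w r] by (simp add: inverse_pair_def)

lemma bracket_hom:
  assumes "finite_order_aut n g" "u * v - v * u = w" "u \<in> gwa_model a" "v \<in> gwa_model a"
  shows "g u * g v - g v * g u = g w"
  using subalg_hom_D[OF finite_order_aut_D(2)[OF assms(1)]] subalg_hom_simps(2)[OF subalg_gwa_model
      finite_order_aut_D(2)[OF assms(1)]]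
    gwa_model_closed assms by metis

lemma sl2_part_E: assumes "w \<in> sl2_part a" obtains \<alpha> \<beta> \<gamma> where "w = sl2_vec a \<alpha> \<beta> \<gamma>"
  using assms by (auto simp: sl2_part_def)

lemma hom_basis:
  "subalg_hom (gwa_model a) g \<Longrightarrow> g (sl2_vec a \<alpha> \<beta> \<gamma>)
     = skew_scalar \<alpha> * g (sl2_vec a 1 0 0) + skew_scalar \<beta> * g (sl2_vec a 0 1 0)
         + skew_scalar \<gamma> * g (sl2_vec a 0 0 1)"
  using hom_sl2_vec unfolding sl2_vec_simps[of a] .

text \<open>From \<open>[h, x] = x\<close> it follows that \<open>g h = h + \<alpha> x\<close>. For \<open>r \<noteq> 1\<close> the vector
  \<open>h + \<alpha> / (1 - r) x\<close> is fixed and an exponential moves it to \<open>h\<close>. For \<open>r = 1\<close> the powers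
  satisfy \<open>g^k h = h + k \<alpha> x\<close>, so finite order and characteristic zero give \<open>\<alpha> = 0\<close>.\<close>

lemma conj_fixes_h_x:
  assumes g: "finite_order_aut n g" and x: "g (sl2_vec a 1 0 0) = skew_scalar r * sl2_vec a 1 0 0"
  shows "conj_fixes_h g"
proof -
  obtain \<alpha> \<beta> \<gamma> where h: "g (sl2_vec a 0 0 1) = sl2_vec a \<alpha> \<beta> \<gamma>"
      using finite_order_aut_D(4)[OF g sl2_vec_sl2_part] by (rule sl2_part_E)
  have "r \<noteq> 0"
  proof
    assume "r = 0"
    then have "sl2_vec a 1 0 0 = 0" using finite_order_aut_inj[OF g sl2_vec_mem] x
        by (simp add: skew_scalar_simps)
    then show False by (simp add: sl2_vec_simps(4)[of a] sl2_vec_eq_iff[OF a_nonzero])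
  qed
  have "sl2_vec a 0 0 1 * sl2_vec a 1 0 0 - sl2_vec a 1 0 0 * sl2_vec a 0 0 1 = sl2_vec a 1 0 0"
      by (simp add: sl2_vec_bracket)
  from bracket_hom[OF g this] have "sl2_vec a \<alpha> \<beta> \<gamma> * sl2_vec a r 0 0 - sl2_vec a r 0 0 * sl2_vec a
      \<alpha> \<beta> \<gamma> = sl2_vec a r 0 0"
    by (simp add: x h sl2_vec_scale)
  then have "\<gamma> = 1" "\<beta> = 0" using \<open>r \<noteq> 0\<close> by (simp_all add: sl2_vec_bracket sl2_vec_eq_iff[OF
      a_nonzero])
  with h have h: "g (sl2_vec a 0 0 1) = sl2_vec a \<alpha> 0 1" by simp
  show ?thesis
  proof (cases "r = 1")
    case False
    define \<mu> where "\<mu> = \<alpha> / (1 - r)"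
    have \<mu>: "\<alpha> + r * \<mu> = \<mu>" using False by (simp add: \<mu>_def field_simps)
    have "g (sl2_vec a \<mu> 0 1) = skew_scalar \<mu> * (skew_scalar r * sl2_vec a 1 0 0)
        + skew_scalar 0 * g (sl2_vec a 0 1 0) + skew_scalar 1 * sl2_vec a \<alpha> 0 1"
      by (simp only: hom_basis[OF finite_order_aut_D(2)[OF g], of \<mu> 0 1] x h)
    also have "\<dots> = sl2_vec a \<mu> 0 1"
      using \<mu> by (simp add: skew_scalar_simps(1) sl2_vec_scale sl2_vec_add algebra_simps)
    finally have fixed: "g (sl2_vec a \<mu> 0 1) = sl2_vec a \<mu> 0 1" .
    have "reach \<mu> 0 1 0 0 1" using reach_exp[of \<mu> 0 1 \<mu>] by simp
    then obtain \<psi> \<psi>' where c: "inverse_pair \<psi> \<psi>'" "\<psi> (sl2_vec a \<mu> 0 1)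
        = sl2_vec a 0 0 1" unfolding reach_def by blast
    have "\<psi>' (sl2_vec a 0 0 1) = sl2_vec a \<mu> 0 1" using c by (metis inverse_pair_def sl2_vec_mem)
    then show ?thesis unfolding conj_fixes_h_def sl2_vec_simps(3)[of a] using c fixed by metis
  next
    case True
    have "(g ^^ k) (sl2_vec a 0 0 1) = sl2_vec a (of_nat k * \<alpha>) 0 1" for k
    proof (induction k)
      case (Suc k)
      have "g (sl2_vec a (of_nat k * \<alpha>) 0 1)
          = skew_scalar (of_nat k * \<alpha>) * (skew_scalar r * sl2_vec a 1 0 0)
              + skew_scalar 0 * g (sl2_vec a 0 1 0) + skew_scalar 1 * sl2_vec a \<alpha> 0 1"
        by (simp only: hom_basis[OF finite_order_aut_D(2)[OF g], of "of_nat k * \<alpha>" 0 1] x h)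
      also have "\<dots> = sl2_vec a (of_nat (Suc k) * \<alpha>) 0 1"
        using True by (simp add: skew_scalar_simps(1) sl2_vec_scale sl2_vec_add algebra_simps)
      finally show ?case using Suc by simp
    qed simp
    from this[of n] have "of_nat n * \<alpha> = 0"
      using finite_order_aut_D(5)[OF g sl2_vec_mem] by (simp add: sl2_vec_eq_iff[OF a_nonzero])
    then have "\<alpha> = 0" using finite_order_aut_D(1)[OF g] by simp
    then show ?thesis unfolding conj_fixes_h_def sl2_vec_simps(3)[of a] using h inverse_pair_id by force
  qed
qed

lemma eigen_unscale:
  assumes g: "finite_order_aut n g" and w: "w \<in> gwa_model a" and e: "g (skew_scalar c * w)
      = skew_scalar r * (skew_scalar c * w)" and "c \<noteq> 0"
  shows "g w = skew_scalar r * w"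
proof -
  have "skew_scalar c * g w = skew_scalar r * (skew_scalar c * w)"
      using e hom_scale[OF finite_order_aut_D(2)[OF g] w] by simp
  then have "skew_scalar (inverse c) * (skew_scalar c * g w) = skew_scalar (inverse c) *
      (skew_scalar r * (skew_scalar c * w))" by simp
  then have "skew_scalar (inverse c * c) * g w = skew_scalar (inverse c * r * c) * w"
    by (simp only: skew_scalar_simps mult.assoc)
  moreover have "inverse c * c = 1" "inverse c * r * c = r" using \<open>c \<noteq> 0\<close> by (simp_all add: field_simps)
  ultimately show ?thesis by (simp only: skew_scalar_simps(2) mult_1_left)
qed

text \<open>The eigenvector is moved to a multiple of \<open>x\<close> or of \<open>h\<close>. The case of \<open>h\<close> is left as a
  hypothesis, since its proof for the eigenvalue \<open>-1\<close> falls back on the eigenvalue \<open>1\<close>.\<close>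

lemma conj_fixes_h_normalise:
  assumes g: "finite_order_aut n g" and w: "w \<in> sl2_part a" "w \<noteq> 0" "g w = skew_scalar r * w"
    and k: "\<And>g. finite_order_aut n g \<Longrightarrow> g (sl2_vec a 0 0 1) = skew_scalar r * sl2_vec a 0 0 1
        \<Longrightarrow> conj_fixes_h g"
  shows "conj_fixes_h g"
proof -
  obtain \<alpha> \<beta> \<gamma> where abc: "w = sl2_vec a \<alpha> \<beta> \<gamma>" using w(1) by (rule sl2_part_E)
  then have "\<alpha> \<noteq> 0 \<or> \<beta> \<noteq> 0 \<or> \<gamma> \<noteq> 0" using w(2) by (auto simp: sl2_vec_simps(4)[of a])
  from reach_normal[OF this] obtain c \<psi> \<psi>' where c: "c \<noteq> 0" "inverse_pair \<psi> \<psi>'"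
    "\<psi> w = skew_scalar c * sl2_vec a 1 0 0 \<or> \<psi> w = skew_scalar c * sl2_vec a 0 0 1"
    unfolding reach_def abc by (auto simp: sl2_vec_scale)
  have finite_order_aut: "finite_order_aut n (\<psi> \<circ> g \<circ> \<psi>')" by (rule finite_order_aut_conj[OF g c(2)])
  have e: "(\<psi> \<circ> g \<circ> \<psi>') (\<psi> w) = skew_scalar r * \<psi> w" by (rule conj_eigen[OF c(2) g _ w(3)]) (simp
      add: abc)
  from c(3) have "conj_fixes_h (\<psi> \<circ> g \<circ> \<psi>')"
  proof
    assume *: "\<psi> w = skew_scalar c * sl2_vec a 1 0 0"
    show ?thesis by (rule conj_fixes_h_x[OF finite_order_aut]) (rule eigen_unscale[OF
        finite_order_aut sl2_vec_mem _ c(1)], use e * in simp)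
  next
    assume *: "\<psi> w = skew_scalar c * sl2_vec a 0 0 1"
    show ?thesis by (rule k[OF finite_order_aut]) (rule eigen_unscale[OF finite_order_aut
        sl2_vec_mem _ c(1)], use e * in simp)
  qed
  then show ?thesis by (rule conj_fixes_h_conj[OF c(2)])
qed

lemma conj_fixes_h_h1: assumes "finite_order_aut n g" "g (sl2_vec a 0 0 1)
    = skew_scalar 1 * sl2_vec a 0 0 1" shows "conj_fixes_h g"
  unfolding conj_fixes_h_def sl2_vec_simps(3)[of a] using assms(2) inverse_pair_id
      by (force simp: skew_scalar_simps)

text \<open>As \<open>g x\<close> is an eigenvector of \<open>ad (r h)\<close> with eigenvalue \<open>1\<close>, the number \<open>r\<close> is \<open>1\<close> or
  \<open>-1\<close>. In the second case \<open>g\<close> maps \<open>x\<close> to \<open>\<beta> y\<close> and \<open>y\<close> to \<open>\<beta>\<inverse> x\<close>, so that \<open>x + \<beta> y\<close> is fixed.\<close>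

lemma conj_fixes_h_h:
  assumes g: "finite_order_aut n g" and h: "g (sl2_vec a 0 0 1) = skew_scalar r * sl2_vec a 0 0 1"
  shows "conj_fixes_h g"
proof -
  obtain \<alpha> \<beta> \<gamma> where x: "g (sl2_vec a 1 0 0) = sl2_vec a \<alpha> \<beta> \<gamma>"
      using finite_order_aut_D(4)[OF g sl2_vec_sl2_part] by (rule sl2_part_E)
  have xnz: "sl2_vec a \<alpha> \<beta> \<gamma> \<noteq> 0"
  proof
    assume "sl2_vec a \<alpha> \<beta> \<gamma> = 0"
    then have "sl2_vec a 1 0 0 = 0" using finite_order_aut_inj[OF g sl2_vec_mem] x by simp
    then show False by (simp add: sl2_vec_simps(4)[of a] sl2_vec_eq_iff[OF a_nonzero])
  qed
  have "sl2_vec a 0 0 1 * sl2_vec a 1 0 0 - sl2_vec a 1 0 0 * sl2_vec a 0 0 1 = sl2_vec a 1 0 0"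
      by (simp add: sl2_vec_bracket)
  from bracket_hom[OF g this] have "sl2_vec a 0 0 r * sl2_vec a \<alpha> \<beta> \<gamma> - sl2_vec a \<alpha> \<beta> \<gamma> * sl2_vec a
      0 0 r = sl2_vec a \<alpha> \<beta> \<gamma>"
    by (simp add: x h sl2_vec_scale)
  then have 1: "r * \<alpha> = \<alpha>" "- r * \<beta> = \<beta>" "\<gamma> = 0" by (auto simp: sl2_vec_bracket sl2_vec_eq_iff[OF
      a_nonzero])
  show ?thesis
  proof (cases "r = 1")
    case True
    then show ?thesis using conj_fixes_h_h1[OF g] h by simp
  next
    case False
    then have "\<alpha> = 0" using 1(1) by simp
    then have "\<beta> \<noteq> 0" using xnz 1(3) by (auto simp: sl2_vec_simps(4)[of a])
    then have r: "r = -1" using 1(2) by (metis mult_cancel_right1 minus_equation_iff)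
    obtain \<alpha>' \<beta>' \<gamma>' where y: "g (sl2_vec a 0 1 0) = sl2_vec a \<alpha>' \<beta>' \<gamma>'"
        using finite_order_aut_D(4)[OF g sl2_vec_sl2_part] by (rule sl2_part_E)
    have "sl2_vec a 1 0 0 * sl2_vec a 0 1 0 - sl2_vec a 0 1 0 * sl2_vec a 1 0 0
        = sl2_vec a 0 0 (- 2)" by (simp add: sl2_vec_bracket)
    from bracket_hom[OF g this]
    have "sl2_vec a 0 \<beta> 0 * sl2_vec a \<alpha>' \<beta>' \<gamma>' - sl2_vec a \<alpha>' \<beta>' \<gamma>' * sl2_vec a 0 \<beta> 0
        = g (skew_scalar (- 2) * sl2_vec a 0 0 1)"
      by (simp add: x y 1(3) \<open>\<alpha> = 0\<close> sl2_vec_scale)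
    also have "\<dots> = sl2_vec a 0 0 2" by (simp only: hom_scale[OF finite_order_aut_D(2)[OF g]
        sl2_vec_mem] h) (simp add: sl2_vec_scale r)
    finally have "\<beta> * \<alpha>' = 1" "\<beta> * \<gamma>' = 0" by (auto simp: sl2_vec_bracket sl2_vec_eq_iff[OF a_nonzero])
    then have "\<gamma>' = 0" using \<open>\<beta> \<noteq> 0\<close> by simp
    have "sl2_vec a 0 0 1 * sl2_vec a 0 1 0 - sl2_vec a 0 1 0 * sl2_vec a 0 0 1
        = sl2_vec a 0 (- 1) 0" by (simp add: sl2_vec_bracket)
    from bracket_hom[OF g this]
    have "sl2_vec a 0 0 r * sl2_vec a \<alpha>' \<beta>' \<gamma>' - sl2_vec a \<alpha>' \<beta>' \<gamma>' * sl2_vec a 0 0 r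
        = g (skew_scalar (- 1) * sl2_vec a 0 1 0)"
      by (simp add: h y sl2_vec_scale)
    also have "\<dots> = sl2_vec a (- \<alpha>') (- \<beta>') (- \<gamma>')"
      by (simp only: hom_scale[OF finite_order_aut_D(2)[OF g] sl2_vec_mem] y) (simp add: sl2_vec_scale)
    finally have "\<beta>' = 0" by (simp add: sl2_vec_bracket sl2_vec_eq_iff[OF a_nonzero] r)
    have "g (sl2_vec a 1 \<beta> 0) = skew_scalar 1 * sl2_vec a \<alpha> \<beta> \<gamma> + skew_scalar \<beta> * sl2_vec a \<alpha>' \<beta>' \<gamma>'
        + skew_scalar 0 * g (sl2_vec a 0 0 1)"
      by (simp only: hom_basis[OF finite_order_aut_D(2)[OF g], of 1 \<beta> 0] x y)
    also have "\<dots> = sl2_vec a 1 \<beta> 0"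
      using \<open>\<beta> * \<alpha>' = 1\<close> \<open>\<beta>' = 0\<close> \<open>\<gamma>' = 0\<close> \<open>\<alpha> = 0\<close> 1(3)
      by (simp add: skew_scalar_simps(1) sl2_vec_scale sl2_vec_add)
    finally have fixed: "g (sl2_vec a 1 \<beta> 0) = skew_scalar 1 * sl2_vec a 1 \<beta> 0"
        by (simp add: skew_scalar_simps(2))
    have "sl2_vec a 1 \<beta> 0 \<noteq> 0" by (simp add: sl2_vec_simps(4)[of a] sl2_vec_eq_iff[OF a_nonzero])
    from conj_fixes_h_normalise[OF g sl2_vec_sl2_part this fixed conj_fixes_h_h1] show ?thesis .
  qed
qed

lemma finite_order_aut_conj_fixes_h: assumes g: "finite_order_aut n g" shows "conj_fixes_h g"
proof -
  obtain w r where "w \<in> sl2_part a" "w \<noteq> 0" "g w = skew_scalar r * w" using eigenvector[OF g] by blast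
  then show ?thesis using conj_fixes_h_normalise[OF g, of w r] conj_fixes_h_h by blast
qed

text \<open>The action of the torus that fixes \<open>h\<close>, given by the grading.\<close>

definition torus :: "'k \<Rightarrow> 'k skew \<Rightarrow> 'k skew" where
  "torus \<zeta> F = Abs_skew (\<lambda>i. Polynomial.smult (\<zeta> powi i) (skew_coeff F i))"

lemma skew_coeff_torus:
  "skew_coeff (torus \<zeta> F) i = Polynomial.smult (\<zeta> powi i) (skew_coeff F i)"
proof -
  have "finite {i. Polynomial.smult (\<zeta> powi i) (skew_coeff F i) \<noteq> 0}"
    by (rule finite_subset[OF _ finite_skew_coeff[of F]]) auto
  then show ?thesis unfolding torus_def by (subst Abs_skew_inverse) auto
qed

lemma torus_hom: assumes "\<zeta> \<noteq> 0" shows "subalg_hom S (torus \<zeta>)"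
  unfolding subalg_hom_def
proof (intro conjI allI ballI)
  show "torus \<zeta> (skew_scalar c) = skew_scalar c" for c by (rule skew_eqI) (simp add:
      skew_coeff_torus skew_scalar_def)
  show "torus \<zeta> (F + G) = torus \<zeta> F + torus \<zeta> G" for F G by (rule skew_eqI) (simp add:
      skew_coeff_torus smult_add_right)
  show "torus \<zeta> (F * G) = torus \<zeta> F * torus \<zeta> G" for F G
  proof (rule skew_eqI)
    fix m
    have "skew_coeff (torus \<zeta> F * torus \<zeta> G) m
      = (\<Sum>i | skew_coeff F i \<noteq> 0. Polynomial.smult (\<zeta> powi i) (skew_coeff F i) * sigma_pow i
          (Polynomial.smult (\<zeta> powi (m - i)) (skew_coeff G (m - i))))"
      by (subst skew_coeff_times_superset[of "{i. skew_coeff F i \<noteq> 0}"]) (auto simp: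
          skew_coeff_torus finite_skew_coeff)
    also have "\<dots> = (\<Sum>i | skew_coeff F i \<noteq> 0. Polynomial.smult (\<zeta> powi m) (skew_coeff F i * sigma_pow
        i (skew_coeff G (m - i))))"
    proof (rule sum.cong[OF refl])
      fix i
      have "\<zeta> powi i * \<zeta> powi (m - i) = \<zeta> powi m" using assms by (simp flip: power_int_add)
      then show "Polynomial.smult (\<zeta> powi i) (skew_coeff F i) * sigma_pow i (Polynomial.smult (\<zeta>
          powi (m - i)) (skew_coeff G (m - i)))
        = Polynomial.smult (\<zeta> powi m) (skew_coeff F i * sigma_pow i (skew_coeff G (m - i)))"
        by (simp add: mult.commute)
    qed
    also have "\<dots> = skew_coeff (torus \<zeta> (F * G)) m" by (simp only: skew_coeff_torus skew_coeff_times
        smult_sum_right)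
    finally show "skew_coeff (torus \<zeta> (F * G)) m = skew_coeff (torus \<zeta> F * torus \<zeta> G) m" ..
  qed
qed

text \<open>An automorphism that fixes \<open>h\<close> preserves the eigenspaces of \<open>ad h\<close> in \<open>W\<close>, which are
  lines; \<open>[x, y] = -2h\<close> forces the eigenvalues on \<open>x\<close> and \<open>y\<close> to be inverse to each other.\<close>

lemma fixes_h_torus:
  assumes g: "finite_order_aut n g" and h: "g (sl2_vec a 0 0 1) = sl2_vec a 0 0 1"
  shows "\<exists>\<zeta>. \<zeta> \<noteq> 0 \<and> (\<forall>F\<in>gwa_model a. g F = torus \<zeta> F)"
proof -
  obtain \<alpha> \<beta> \<gamma> where x: "g (sl2_vec a 1 0 0) = sl2_vec a \<alpha> \<beta> \<gamma>"
      using finite_order_aut_D(4)[OF g sl2_vec_sl2_part] by (rule sl2_part_E)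
  obtain \<alpha>' \<beta>' \<gamma>' where y: "g (sl2_vec a 0 1 0) = sl2_vec a \<alpha>' \<beta>' \<gamma>'"
      using finite_order_aut_D(4)[OF g sl2_vec_sl2_part] by (rule sl2_part_E)
  have "sl2_vec a 0 0 1 * sl2_vec a 1 0 0 - sl2_vec a 1 0 0 * sl2_vec a 0 0 1 = sl2_vec a 1 0 0"
      by (simp add: sl2_vec_bracket)
  from bracket_hom[OF g this] have x0: "\<beta> = 0" "\<gamma> = 0"
    by (auto simp: x h sl2_vec_bracket sl2_vec_eq_iff[OF a_nonzero])
  have "sl2_vec a 0 0 1 * sl2_vec a 0 1 0 - sl2_vec a 0 1 0 * sl2_vec a 0 0 1
      = skew_scalar (- 1) * sl2_vec a 0 1 0"
    by (simp add: sl2_vec_bracket sl2_vec_scale)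
  from bracket_hom[OF g this]
  have "sl2_vec a 0 0 1 * sl2_vec a \<alpha>' \<beta>' \<gamma>' - sl2_vec a \<alpha>' \<beta>' \<gamma>' * sl2_vec a 0 0 1
      = skew_scalar (- 1) * sl2_vec a \<alpha>' \<beta>' \<gamma>'"
    by (simp only: hom_scale[OF finite_order_aut_D(2)[OF g] sl2_vec_mem] y h sl2_vec_mem)
  then have y0: "\<alpha>' = 0" "\<gamma>' = 0"
    by (auto simp: sl2_vec_bracket sl2_vec_scale sl2_vec_eq_iff[OF a_nonzero])
  have "sl2_vec a 1 0 0 * sl2_vec a 0 1 0 - sl2_vec a 0 1 0 * sl2_vec a 1 0 0
      = skew_scalar (- 2) * sl2_vec a 0 0 1"
    by (simp add: sl2_vec_bracket sl2_vec_scale)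
  from bracket_hom[OF g this]
  have "sl2_vec a \<alpha> \<beta> \<gamma> * sl2_vec a \<alpha>' \<beta>' \<gamma>' - sl2_vec a \<alpha>' \<beta>' \<gamma>' * sl2_vec a \<alpha> \<beta> \<gamma>
      = skew_scalar (- 2) * sl2_vec a 0 0 1"
    by (simp only: hom_scale[OF finite_order_aut_D(2)[OF g] sl2_vec_mem] x y h sl2_vec_mem)
  then have xy: "\<alpha> * \<beta>' = 1"
    by (simp add: x0 y0 sl2_vec_bracket sl2_vec_scale sl2_vec_eq_iff[OF a_nonzero])
  then have "\<alpha> \<noteq> 0" by auto
  have "g (std_gens a i) = torus \<alpha> (std_gens a i)" for i
  proof (cases i)
    case Gen_x
    then show ?thesis using x x0
      by (simp add: sl2_vec_simps(1)[of a]) (rule skew_eqI, simp add: skew_coeff_torus sl2_vec_def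
          sl2_h_def)
  next
    case Gen_y
    have "\<beta>' = inverse \<alpha>" using xy by (metis inverse_unique)
    then show ?thesis using Gen_y y y0
      by (simp add: sl2_vec_simps(2)[of a]) (rule skew_eqI, simp add: skew_coeff_torus sl2_vec_def
          sl2_h_def power_int_minus)
  next
    case Gen_z
    have "std_gens a Gen_z = sl2_vec a 0 0 1 + skew_scalar \<kappa>"
        by (simp add: sl2_h_std_gens a flip: sl2_vec_simps)
    then have "g (std_gens a Gen_z) = std_gens a Gen_z"
      using h by (simp add: subalg_hom_D[OF finite_order_aut_D(2)[OF g]] gwa_model_closed del:
          std_gens.simps)
    moreover have "torus \<alpha> (std_gens a Gen_z) = std_gens a Gen_z"
        by (rule skew_eqI) (simp add: skew_coeff_torus)
    ultimately show ?thesis using Gen_z by simp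
  qed
  then show ?thesis
    using hom_unique[OF finite_order_aut_D(2)[OF g] torus_hom[OF \<open>\<alpha> \<noteq> 0\<close>]] \<open>\<alpha> \<noteq> 0\<close> by blast
qed

lemma torus_torus: "torus \<zeta> (torus \<eta> F) = torus (\<zeta> * \<eta>) F"
  by (rule skew_eqI) (simp add: skew_coeff_torus power_int_mult_distrib)

text \<open>A conjugate of \<open>g\<close> acts on the component of degree \<open>i\<close> by \<open>\<zeta>^i\<close>. As the order of \<open>\<zeta>\<close> is
  the order of \<open>g\<close>, the fixed components are those of degree divisible by \<open>n\<close>.\<close>

lemma fixed_ring_veronese:
  assumes g: "finite_order_aut n g" and ord: "\<And>k. (\<forall>F\<in>gwa_model a. (g ^^ k) F = F) \<longleftrightarrow> n dvd k"
  shows "\<exists>\<psi>. bij_betw \<psi> {F \<in> gwa_model a. g F = F} (veronese a n) \<and> subalg_hom (gwa_model a) \<psi>"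
proof -
  obtain \<psi> \<psi>' where c: "inverse_pair \<psi> \<psi>'" "\<psi> (g (\<psi>' (sl2_h a))) = sl2_h a"
    using finite_order_aut_conj_fixes_h[OF g] unfolding conj_fixes_h_def by blast
  let ?g = "\<psi> \<circ> g \<circ> \<psi>'"
  have finite_order_aut: "finite_order_aut n ?g" by (rule finite_order_aut_conj[OF g c(1)])
  obtain \<zeta> where \<zeta>: "\<zeta> \<noteq> 0" "\<And>F. F \<in> gwa_model a \<Longrightarrow> ?g F = torus \<zeta> F"
    using fixes_h_torus[OF finite_order_aut] c(2) by (auto simp: sl2_vec_simps(3)[of a])
  note c' = c(1)[unfolded inverse_pair_def image_subset_iff] and g'
      = g[unfolded finite_order_aut_def image_subset_iff]
  have step: "g u = \<psi>' (torus \<zeta> (\<psi> u))" if "u \<in> gwa_model a" for u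
    using that \<zeta>(2)[of "\<psi> u", symmetric] c' g' by simp
  have pow: "F \<in> gwa_model a \<Longrightarrow> (g ^^ k) F = \<psi>' (torus (\<zeta> ^ k) (\<psi> F)) \<and> (g ^^ k) F \<in> gwa_model a" for F k
  proof (induction k)
    case 0
    have "torus 1 (\<psi> F) = \<psi> F" by (rule skew_eqI) (simp add: skew_coeff_torus)
    then show ?case using 0 c' by simp
  next
    case (Suc k)
    have "g ((g ^^ k) F) = \<psi>' (torus \<zeta> (\<psi> ((g ^^ k) F)))" by (rule step) (use Suc in blast)
    moreover have "\<psi> ((g ^^ k) F) = torus (\<zeta> ^ k) (\<psi> F)"
    proof -
      have "torus (\<zeta> ^ k) (\<psi> F) \<in> gwa_model a"
        using Suc.prems c' by (auto simp: gwa_model_def skew_coeff_torus intro: dvd_smult)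
      moreover have "(g ^^ k) F = \<psi>' (torus (\<zeta> ^ k) (\<psi> F))" using Suc by blast
      ultimately show ?thesis using c' by simp
    qed
    moreover have "g ((g ^^ k) F) \<in> gwa_model a" using Suc g' by blast
    ultimately show ?case by (simp add: torus_torus)
  qed
  have root: "\<zeta> ^ k = 1 \<longleftrightarrow> n dvd k" for k
  proof
    assume "\<zeta> ^ k = 1"
    moreover have "torus 1 F = F" for F by (rule skew_eqI) (simp add: skew_coeff_torus)
    ultimately have "\<forall>F\<in>gwa_model a. (g ^^ k) F = F" using pow c' by simp
    then show "n dvd k" using ord by simp
  next
    assume "n dvd k"
    then have id: "\<forall>F\<in>gwa_model a. (g ^^ k) F = F" using ord by simp
    let ?x = "sl2_vec a 1 0 0"
    have x: "?x = \<psi> (\<psi>' ?x)" "\<psi>' ?x \<in> gwa_model a" using c' by simp_all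
    have torus_gwa_model: "torus (\<zeta> ^ k) ?x \<in> gwa_model a"
      using sl2_vec_mem[of a 1 0 0] by (auto simp: gwa_model_def skew_coeff_torus intro: dvd_smult)
    have "\<psi>' ?x = \<psi>' (torus (\<zeta> ^ k) ?x)" using pow[OF x(2), of k] id x by simp
    then have "?x = torus (\<zeta> ^ k) ?x" using c' torus_gwa_model by (metis sl2_vec_mem)
    then have "skew_coeff ?x 1 = skew_coeff (torus (\<zeta> ^ k) ?x) 1" by simp
    then show "\<zeta> ^ k = 1" by (simp add: skew_coeff_torus sl2_vec_def sl2_h_def)
  qed
  have rooti: "\<zeta> powi i = 1 \<longleftrightarrow> int n dvd i" for i
  proof (cases "i \<ge> 0")
    case True
    then obtain k where "i = int k" by (metis zero_le_imp_eq_int)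
    then show ?thesis using root[of k] by simp
  next
    case False
    then obtain k where "i = - int k" by (metis nonpos_int_cases linear)
    then show ?thesis using root[of k] by (simp add: power_int_minus)
  qed
  have torus_fixed: "torus \<zeta> F = F \<longleftrightarrow> (\<forall>i. skew_coeff F i \<noteq> 0 \<longrightarrow> int n dvd i)" for F
  proof -
    have "torus \<zeta> F = F \<longleftrightarrow> (\<forall>i. Polynomial.smult (\<zeta> powi i) (skew_coeff F i) = skew_coeff F i)"
      by (metis skew_coeff_torus skew_eqI)
    also have "\<dots> \<longleftrightarrow> (\<forall>i. Polynomial.smult (\<zeta> powi i - 1) (skew_coeff F i) = 0)"
      by (simp add: smult_diff_left)
    also have "\<dots> \<longleftrightarrow> (\<forall>i. skew_coeff F i \<noteq> 0 \<longrightarrow> int n dvd i)" using rooti by auto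
    finally show ?thesis .
  qed
  have "bij_betw \<psi> {F \<in> gwa_model a. g F = F} (veronese a n)"
  proof (rule bij_betw_byWitness[of _ \<psi>'])
    show "\<psi> ` {F \<in> gwa_model a. g F = F} \<subseteq> veronese a n"
    proof clarify
      fix F assume F: "F \<in> gwa_model a" "g F = F"
      then have "torus \<zeta> (\<psi> F) = \<psi> F" using \<zeta>(2)[of "\<psi> F"] c' by simp
      then show "\<psi> F \<in> veronese a n" using F c' by (simp add: veronese_def torus_fixed)
    qed
    show "\<psi>' ` veronese a n \<subseteq> {F \<in> gwa_model a. g F = F}"
    proof clarify
      fix F assume "F \<in> veronese a n"
      then have F: "F \<in> gwa_model a" "torus \<zeta> F = F" by (simp_all add: veronese_def torus_fixed)
      then have "\<psi> (g (\<psi>' F)) = F" using \<zeta>(2)[of F] by simp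
      then show "\<psi>' F \<in> gwa_model a \<and> g (\<psi>' F) = \<psi>' F" using F c' g' by metis
    qed
  qed (use c' in \<open>auto simp: veronese_def\<close>)
  then show ?thesis using c' by blast
qed

end

section \<open>Cosets and filtered automorphisms\<close>

lemma gwa_proj_hom: "gwa_proj a \<in> ring_hom free_xyz (gwa a)"
  unfolding gwa_proj_def[abs_def] gwa_def using ideal.rcos_ring_hom[OF ideal_gwa] .

lemma carrier_gwa: "carrier (gwa a) = range (gwa_proj a)"
  by (auto simp: gwa_def FactRing_def A_RCOSETS_def' gwa_proj_def)

lemma gwa_proj_eq_iff: "gwa_proj a p = gwa_proj a q \<longleftrightarrow> p - q \<in> gwa_ideal a"
  using ring.quotient_eq_iff_same_a_r_cos[OF ring_free ideal_gwa, of p q a]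
  by (simp add: gwa_proj_def a_minus_def)

lemma gwa_proj_ops:
  "gwa_proj a p \<oplus>\<^bsub>gwa a\<^esub> gwa_proj a q = gwa_proj a (p + q)"
  "gwa_proj a p \<otimes>\<^bsub>gwa a\<^esub> gwa_proj a q = gwa_proj a (p * q)"
  using ring_hom_memE(2,3)[OF gwa_proj_hom[of a], of p q] by simp_all

definition gwa_to_model :: "'k::field poly \<Rightarrow> 'k free_xyz set \<Rightarrow> 'k skew" where
  "gwa_to_model a A = free_eval (std_gens a) (SOME p. gwa_proj a p = A)"

lemma gwa_to_model_proj: "gwa_to_model a (gwa_proj a p) = free_eval (std_gens a) p"
proof -
  define q where "q = (SOME q. gwa_proj a q = gwa_proj a p)"
  have "gwa_proj a q = gwa_proj a p" unfolding q_def by (rule someI) simp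
  then have "free_eval (std_gens a) (q - p) = 0"
    using free_eval_gwa_ideal[OF gwa_triple_std_gens] by (simp add: gwa_proj_eq_iff)
  then show ?thesis by (simp add: gwa_to_model_def q_def free_eval_diff)
qed

text \<open>Fixed rings of cosets are compared through bijections onto subalgebras of the skew Laurent
  ring, which preserve operations and scalars.\<close>

definition represents :: "'k::field poly \<Rightarrow> 'k free_xyz set ring \<Rightarrow> 'k skew set \<Rightarrow> ('k free_xyz set \<Rightarrow>
    'k skew) \<Rightarrow> bool" where
  "represents a S T \<theta> \<longleftrightarrow> bij_betw \<theta> (carrier S) T
     \<and> (\<forall>u\<in>carrier S. \<forall>v\<in>carrier S. u \<oplus>\<^bsub>S\<^esub> v \<in> carrier S \<and> \<theta> (u \<oplus>\<^bsub>S\<^esub> v) = \<theta> u + \<theta> v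
          \<and> u \<otimes>\<^bsub>S\<^esub> v \<in> carrier S \<and> \<theta> (u \<otimes>\<^bsub>S\<^esub> v) = \<theta> u * \<theta> v)
     \<and> (\<forall>c. gwa_scalar a c \<in> carrier S \<and> \<theta> (gwa_scalar a c) = skew_scalar c)"

lemma represents_gwa: assumes "a \<noteq> 0" shows "represents a (gwa a) (gwa_model a) (gwa_to_model a)"
  unfolding represents_def
proof (intro conjI ballI allI)
  show "bij_betw (gwa_to_model a) (carrier (gwa a)) (gwa_model a)"
    unfolding bij_betw_def inj_on_def
  proof (intro conjI ballI impI)
    fix A B assume "A \<in> carrier (gwa a)" "B \<in> carrier (gwa a)" "gwa_to_model a A = gwa_to_model a B"
    moreover from this obtain p q where "A = gwa_proj a p" "B = gwa_proj a q"
      by (auto simp: carrier_gwa)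
    ultimately show "A = B"
      by (simp add: gwa_to_model_proj gwa_proj_eq_iff free_eval_diff flip:
          free_eval_std_gens_eq_0_iff[OF assms])
  next
    show "gwa_to_model a ` carrier (gwa a) = gwa_model a"
      by (simp add: carrier_gwa image_image gwa_to_model_proj range_free_eval_std_gens)
  qed
qed (auto simp: carrier_gwa gwa_proj_ops gwa_to_model_proj free_eval_add free_eval_mult gwa_scalar_def)

lemma represents_iso:
  assumes S: "represents a S T \<theta>" and S': "represents a S' T' \<theta>'" and iso:
      "h \<in> alg_iso (gwa_scalar a) S (gwa_scalar a) S'"
  shows "\<exists>f. bij_betw f T T' \<and> subalg_hom T f"
proof -
  let ?g = "inv_into (carrier S) \<theta>"
  let ?f = "\<theta>' \<circ> h \<circ> ?g"
  have h: "h \<in> ring_iso S S'" "\<And>c. h (gwa_scalar a c) = gwa_scalar a c" using iso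
      by (auto simp: alg_iso_def)
  have b: "bij_betw \<theta> (carrier S) T" "bij_betw \<theta>' (carrier S') T'" using S S'
      by (auto simp: represents_def)
  have "bij_betw ?f T T'"
    by (rule bij_betw_trans[OF bij_betw_inv_into[OF b(1)]
          bij_betw_trans[OF ring_iso_memE(5)[OF h(1)] b(2)]])
  moreover have g: "?g (\<theta> u) = u" if "u \<in> carrier S" for u
    using b(1) that by (simp add: bij_betw_inv_into_left)
  have "subalg_hom T ?f"
    unfolding subalg_hom_def
  proof (intro conjI allI ballI)
    show "?f (skew_scalar c) = skew_scalar c" for c
    proof -
      have "?g (skew_scalar c) = gwa_scalar a c" using g[of "gwa_scalar a c"] S
          by (simp add: represents_def)
      then show ?thesis using h(2) S' by (simp add: represents_def)
    qed
    fix F G assume "F \<in> T" "G \<in> T"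
    then obtain u v where uv: "u \<in> carrier S" "F = \<theta> u" "v \<in> carrier S" "G = \<theta> v"
      unfolding bij_betw_imp_surj_on[OF b(1), symmetric] by blast
    have closed: "u \<oplus>\<^bsub>S\<^esub> v \<in> carrier S" "u \<otimes>\<^bsub>S\<^esub> v \<in> carrier S"
      and sum: "F + G = \<theta> (u \<oplus>\<^bsub>S\<^esub> v)" "F * G = \<theta> (u \<otimes>\<^bsub>S\<^esub> v)"
      using S uv by (simp_all add: represents_def)
    have h_closed: "h u \<in> carrier S'" "h v \<in> carrier S'"
      using ring_iso_memE(1)[OF h(1)] uv(1,3) by blast+
    have S'_ops: "\<theta>' (h u \<oplus>\<^bsub>S'\<^esub> h v) = \<theta>' (h u) + \<theta>' (h v)"
      "\<theta>' (h u \<otimes>\<^bsub>S'\<^esub> h v) = \<theta>' (h u) * \<theta>' (h v)"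
      using S' h_closed unfolding represents_def by blast+
    have h_ops: "h (u \<oplus>\<^bsub>S\<^esub> v) = h u \<oplus>\<^bsub>S'\<^esub> h v" "h (u \<otimes>\<^bsub>S\<^esub> v) = h u \<otimes>\<^bsub>S'\<^esub> h v"
      by (rule ring_iso_memE(2,3)[OF h(1) uv(1,3)])+
    have "?f F = \<theta>' (h u)" "?f G = \<theta>' (h v)"
      unfolding comp_apply uv(2,4) g[OF uv(1)] g[OF uv(3)] by simp_all
    moreover have "?f (F + G) = \<theta>' (h u) + \<theta>' (h v)" "?f (F * G) = \<theta>' (h u) * \<theta>' (h v)"
      unfolding comp_apply sum g[OF closed(1)] g[OF closed(2)] h_ops by (rule S'_ops)+
    ultimately show "?f (F + G) = ?f F + ?f G" "?f (F * G) = ?f F * ?f G" by (simp_all only:)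
  qed
  ultimately show ?thesis by blast
qed

lemma group_Aut_fl: "group (Aut_fl a)"
proof -
  let ?S = "carrier (gwa a)"
  have R: "ring (gwa a)" unfolding gwa_def using ideal.quotient_is_ring[OF ideal_gwa] .
  have sel: "carrier (Aut_fl a) = {\<phi> \<in> Bij ?S. \<phi> \<in> alg_iso (gwa_scalar a) (gwa a) (gwa_scalar a) (gwa a)
        \<and> (\<forall>r\<in>?S. gwa_degree a (\<phi> r) = gwa_degree a r)}"
    by (simp add: Aut_fl_def)
  have scal: "gwa_scalar a c \<in> ?S" for c by (simp add: carrier_gwa gwa_scalar_def)
  have "subgroup (carrier (Aut_fl a)) (BijGroup ?S)"
  proof (rule group.subgroupI[OF group_BijGroup])
    show "carrier (Aut_fl a) \<subseteq> carrier (BijGroup ?S)" by (auto simp: sel BijGroup_def)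
    have id: "(\<lambda>r\<in>?S. r) \<in> carrier (Aut_fl a)"
      by (auto simp: sel id_Bij alg_iso_def scal intro!: ring.ring_iso_restrict[OF R] ring_iso_set_refl
          ring.ring_iso_restrict[OF R, of id])
    then show "carrier (Aut_fl a) \<noteq> {}" by blast
    fix \<phi> assume \<phi>: "\<phi> \<in> carrier (Aut_fl a)"
    then have bij: "bij_betw \<phi> ?S ?S" "\<phi> \<in> Bij ?S" by (auto simp: sel Bij_def)
    let ?\<psi> = "\<lambda>r\<in>?S. inv_into ?S \<phi> r"
    have inv_mem: "inv_into ?S \<phi> r \<in> ?S" and inv_right: "\<phi> (inv_into ?S \<phi> r) = r" if "r \<in> ?S" for r
      using bij(1) that by (auto simp: bij_betw_def inv_into_into f_inv_into_f)
    have "inv_into ?S \<phi> \<in> ring_iso (gwa a) (gwa a)"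
      using \<phi> by (intro ring_iso_set_sym[OF R]) (auto simp: sel alg_iso_def)
    then have "?\<psi> \<in> ring_iso (gwa a) (gwa a)" by (rule ring.ring_iso_restrict[OF R]) simp
    moreover have "?\<psi> (gwa_scalar a c) = gwa_scalar a c" for c
    proof -
      have "\<phi> (gwa_scalar a c) = gwa_scalar a c" using \<phi> by (auto simp: sel alg_iso_def)
      then show ?thesis using scal bij(1) by (metis bij_betw_inv_into_left restrict_apply')
    qed
    moreover have "gwa_degree a (?\<psi> r) = gwa_degree a r" if "r \<in> ?S" for r
    proof -
      have "gwa_degree a (\<phi> (inv_into ?S \<phi> r)) = gwa_degree a (inv_into ?S \<phi> r)"
        using \<phi> inv_mem[OF that] by (auto simp: sel)
      then show ?thesis using that by (simp add: inv_right)
    qed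
    ultimately have "?\<psi> \<in> carrier (Aut_fl a)"
      using restrict_inv_into_Bij[OF bij(2)] by (auto simp: sel alg_iso_def)
    then show "inv\<^bsub>BijGroup ?S\<^esub> \<phi> \<in> carrier (Aut_fl a)" by (simp only: inv_BijGroup[OF bij(2)])
    fix \<chi> assume \<chi>: "\<chi> \<in> carrier (Aut_fl a)"
    have \<chi>B: "\<chi> \<in> Bij ?S" and \<chi>S: "\<And>r. r \<in> ?S \<Longrightarrow> \<chi> r \<in> ?S" using \<chi>
        by (auto simp: sel Bij_def bij_betw_def)
    have "\<phi> \<circ> \<chi> \<in> ring_iso (gwa a) (gwa a)"
      using \<phi> \<chi> by (intro ring_iso_set_trans) (auto simp: sel alg_iso_def)
    then have "compose ?S \<phi> \<chi> \<in> ring_iso (gwa a) (gwa a)"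
      by (rule ring.ring_iso_restrict[OF R]) (simp add: compose_def)
    moreover have "compose ?S \<phi> \<chi> (gwa_scalar a c) = gwa_scalar a c" for c
      using \<phi> \<chi> scal by (simp add: compose_def sel alg_iso_def)
    moreover have "gwa_degree a (compose ?S \<phi> \<chi> r) = gwa_degree a r" if "r \<in> ?S" for r
      using \<phi> \<chi> \<chi>S[OF that] that by (simp add: compose_def sel)
    ultimately show "\<phi> \<otimes>\<^bsub>BijGroup ?S\<^esub> \<chi> \<in> carrier (Aut_fl a)"
      using bij(2) \<chi>B compose_Bij[OF bij(2) \<chi>B] by (simp add: BijGroup_def sel alg_iso_def)
  qed
  then have "group ((BijGroup ?S)\<lparr>carrier := carrier (Aut_fl a)\<rparr>)"
    by (rule subgroup.subgroup_is_group[OF _ group_BijGroup])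
  then show ?thesis by (simp add: Aut_fl_def)
qed

lemma Aut_fl_ops:
  "\<one>\<^bsub>Aut_fl a\<^esub> = (\<lambda>r\<in>carrier (gwa a). r)"
  "\<phi> \<in> carrier (Aut_fl a) \<Longrightarrow> \<chi> \<in> carrier (Aut_fl a) \<Longrightarrow> r \<in> carrier (gwa a) \<Longrightarrow> (\<phi> \<otimes>\<^bsub>Aut_fl a\<^esub> \<chi>) r
      = \<phi> (\<chi> r)"
  by (auto simp: Aut_fl_def BijGroup_def compose_def)

lemma Aut_fl_D:
  assumes "\<phi> \<in> carrier (Aut_fl a)"
  shows "\<phi> \<in> extensional (carrier (gwa a))" "\<phi> \<in> ring_iso (gwa a) (gwa a)"
    "\<phi> (gwa_scalar a c) = gwa_scalar a c"
    "r \<in> carrier (gwa a) \<Longrightarrow> gwa_degree a (\<phi> r) = gwa_degree a r"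
    "r \<in> carrier (gwa a) \<Longrightarrow> \<phi> r \<in> carrier (gwa a)"
  using assms by (auto simp: Aut_fl_def alg_iso_def Bij_def bij_betw_def)

lemma filtration_mono:
  "m \<le> m' \<Longrightarrow> gwa_filtration a m \<subseteq> gwa_filtration a m'"
  unfolding gwa_filtration_def by (rule image_mono) auto

lemma filtration_iff:
  assumes "r \<in> carrier (gwa a)"
  shows "r \<in> gwa_filtration a m \<longleftrightarrow> gwa_degree a r \<le> m"
proof
  assume "gwa_degree a r \<le> m"
  obtain p where p: "r = gwa_proj a p" using assms by (auto simp: carrier_gwa)
  let ?w = "word_weight (Polynomial.degree a)"
  have "r \<in> gwa_filtration a (Max (?w ` Poly_Mapping.keys p))"
    unfolding gwa_filtration_def p by (intro imageI) auto
  then have "r \<in> gwa_filtration a (gwa_degree a r)" unfolding gwa_degree_def by (rule LeastI)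
  then show "r \<in> gwa_filtration a m" using filtration_mono[OF \<open>gwa_degree a r \<le> m\<close>] by blast
qed (simp add: gwa_degree_def Least_le)

context quadratic begin

lemma degree_a: "Polynomial.degree a = 2" by (simp add: a)

text \<open>All generators have weight \<open>2\<close> when \<open>deg a = 2\<close>, so only the empty word and the generators
  have weight at most \<open>2\<close>.\<close>

lemma gwa_to_model_filtration:
  assumes "r \<in> gwa_filtration a 2"
  shows "\<exists>w\<in>sl2_part a. \<exists>c. gwa_to_model a r = w + skew_scalar c"
proof -
  obtain q where q: "r = gwa_proj a q" "\<And>w. w \<in> Poly_Mapping.keys q \<Longrightarrow> word_weight 2 w \<le> 2"
    using assms unfolding gwa_filtration_def degree_a by auto
  define V where "V = {w + skew_scalar c | w c. w \<in> sl2_part a}"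
  have V0: "sl2_vec a \<alpha> \<beta> \<gamma> + skew_scalar c \<in> V" for \<alpha> \<beta> \<gamma> c by (auto simp: V_def)
  have V1: "u + v \<in> V" if uv: "u \<in> V" "v \<in> V" for u v
  proof -
    obtain \<alpha> \<beta> \<gamma> c \<alpha>' \<beta>' \<gamma>' c' where "u = sl2_vec a \<alpha> \<beta> \<gamma> + skew_scalar c" "v = sl2_vec a \<alpha>' \<beta>' \<gamma>'
        + skew_scalar c'"
      using uv by (auto simp: V_def sl2_part_def)
    then have "u + v = sl2_vec a (\<alpha> + \<alpha>') (\<beta> + \<beta>') (\<gamma> + \<gamma>') + skew_scalar (c + c')"
      by (simp add: skew_scalar_simps flip: sl2_vec_add)
    then show ?thesis using V0 by simp
  qed
  have V2: "skew_scalar d * u \<in> V" if u: "u \<in> V" for u d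
  proof -
    obtain \<alpha> \<beta> \<gamma> c where "u = sl2_vec a \<alpha> \<beta> \<gamma> + skew_scalar c" using u
        by (auto simp: V_def sl2_part_def)
    then have "skew_scalar d * u = sl2_vec a (d * \<alpha>) (d * \<beta>) (d * \<gamma>) + skew_scalar (d * c)"
      by (simp add: skew_scalar_simps distrib_left flip: sl2_vec_scale)
    then show ?thesis using V0 by simp
  qed
  have std_gens: "std_gens a g \<in> V" for g
  proof (cases g)
    case Gen_x
    then show ?thesis using V0[of 1 0 0 0] by (simp add: skew_scalar_simps sl2_vec_simps(1)[of a])
  next
    case Gen_y
    then show ?thesis using V0[of 0 1 0 0] by (simp add: skew_scalar_simps sl2_vec_simps(2)[of a])
  next
    case Gen_z
    have "std_gens a Gen_z = sl2_vec a 0 0 1 + skew_scalar \<kappa>"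
        by (simp add: sl2_h_std_gens a flip: sl2_vec_simps)
    then show ?thesis using V0 Gen_z by metis
  qed
  have word: "wordval (std_gens a) w \<in> V" if "word_weight 2 w \<le> 2" for w
  proof -
    have "word_weight 2 w = 2 * length (letters w)"
      unfolding word_weight_def
    proof (induction "letters w" arbitrary: w)
      case (Cons g l)
      then show ?case using Cons(1)[of "Word l"] by (cases g) (simp_all flip: Cons(2))
    qed simp
    then have "length (letters w) \<le> 1" using that by simp
    then consider "letters w = []" | g where "letters w = [g]" by (cases "letters w") auto
    then show ?thesis
    proof cases
      case 1
      then show ?thesis using V0[of 0 0 0 1] by (simp add: wordval_def skew_scalar_simps flip:
          sl2_vec_simps(4))
    qed (simp add: wordval_def std_gens)
  qed
  have "(\<Sum>w\<in>A. skew_scalar (Poly_Mapping.lookup q w) * wordval (std_gens a) w) \<in> V" if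
      "A \<subseteq> Poly_Mapping.keys q" for A
    using finite_subset[OF that finite_keys] that
  proof (induction A rule: finite_induct)
    case empty
    show ?case using V0[of 0 0 0 0] by (simp add: skew_scalar_simps flip: sl2_vec_simps(4))
  qed (auto intro!: V1 V2 word q(2))
  then have "free_eval (std_gens a) q \<in> V" unfolding free_eval_def by blast
  then show ?thesis by (auto simp: q(1) gwa_to_model_proj V_def)
qed

text \<open>The generators lie in the second step of the filtration, hence so do their images, and
  these are elements of \<open>W\<close> plus a scalar. Scalars disappear in commutators, and \<open>W = [W, W]\<close>;
  therefore \<open>W\<close> itself is preserved.\<close>

lemma transport_Aut_fl:
  assumes \<phi>: "\<phi> \<in> carrier (Aut_fl a)"
  shows "\<exists>g. (\<forall>r\<in>carrier (gwa a). g (gwa_to_model a r) = gwa_to_model a (\<phi> r))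
      \<and> subalg_hom (gwa_model a) g \<and> g ` gwa_model a \<subseteq> gwa_model a \<and> g ` sl2_part a \<subseteq> sl2_part a"
proof -
  let ?S = "carrier (gwa a)"
  have represents: "represents a (gwa a) (gwa_model a) (gwa_to_model a)"
      by (rule represents_gwa[OF a_nonzero])
  then have bij: "bij_betw (gwa_to_model a) ?S (gwa_model a)" by (simp add: represents_def)
  define g where "g F = gwa_to_model a (\<phi> (inv_into ?S (gwa_to_model a) F))" for F
  have g: "g (gwa_to_model a r) = gwa_to_model a (\<phi> r)" if "r \<in> ?S" for r
    using bij that by (simp add: g_def bij_betw_inv_into_left)
  have surj: "\<exists>r\<in>?S. F = gwa_to_model a r" if "F \<in> gwa_model a" for F
    using bij that by (metis bij_betw_imp_surj_on imageE)
  have hom: "subalg_hom (gwa_model a) g"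
    unfolding subalg_hom_def
  proof (intro conjI allI ballI)
    show "g (skew_scalar c) = skew_scalar c" for c
      using g[of "gwa_scalar a c"] represents Aut_fl_D(3)[OF \<phi>] by (simp add: represents_def)
    fix F G assume "F \<in> gwa_model a" "G \<in> gwa_model a"
    then obtain u v where uv: "u \<in> ?S" "F = gwa_to_model a u" "v \<in> ?S" "G = gwa_to_model a v"
        using surj by metis
    have 1: "F + G = gwa_to_model a (u \<oplus>\<^bsub>gwa a\<^esub> v)" "u \<oplus>\<^bsub>gwa a\<^esub> v \<in> ?S"
      and 2: "F * G = gwa_to_model a (u \<otimes>\<^bsub>gwa a\<^esub> v)" "u \<otimes>\<^bsub>gwa a\<^esub> v \<in> ?S"
      using represents uv by (simp_all add: represents_def)
    have m: "\<phi> u \<in> ?S" "\<phi> v \<in> ?S" using Aut_fl_D(5)[OF \<phi>] uv by auto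
    show "g (F + G) = g F + g G"
      unfolding 1(1) g[OF 1(2)] using ring_iso_memE(3)[OF Aut_fl_D(2)[OF \<phi>] uv(1,3)] represents m g
          uv by (simp add: represents_def)
    show "g (F * G) = g F * g G"
      unfolding 2(1) g[OF 2(2)] using ring_iso_memE(2)[OF Aut_fl_D(2)[OF \<phi>] uv(1,3)] represents m g
          uv by (simp add: represents_def)
  qed
  have gRR: "g ` gwa_model a \<subseteq> gwa_model a"
    using surj g Aut_fl_D(5)[OF \<phi>] bij by (force simp: bij_betw_def)
  have gV: "\<exists>w\<in>sl2_part a. \<exists>c. g (std_gens a i) = w + skew_scalar c" for i
  proof -
    have "gwa_proj a (free_gen i) \<in> gwa_filtration a 2"
      unfolding gwa_filtration_def
      by (rule imageI) (cases i; simp add: free_gen_def a word_weight_def)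
    moreover have m: "gwa_proj a (free_gen i) \<in> ?S" by (simp add: carrier_gwa)
    ultimately have "\<phi> (gwa_proj a (free_gen i)) \<in> gwa_filtration a 2"
      using Aut_fl_D(4,5)[OF \<phi>] by (simp add: filtration_iff)
    then show ?thesis using gwa_to_model_filtration g[OF m] by (simp add: gwa_to_model_proj)
  qed
  have gW: "\<exists>w\<in>sl2_part a. \<exists>c. g u = w + skew_scalar c" if "u \<in> {sl2_vec a 1 0 0, sl2_vec a 0 1 0,
      sl2_vec a 0 0 1}" for u
  proof -
    have "g (sl2_vec a 0 0 1) = g (std_gens a Gen_z) - skew_scalar \<kappa>"
    proof -
      have "sl2_vec a 0 0 1 = std_gens a Gen_z - skew_scalar \<kappa>"
          by (simp add: sl2_h_std_gens a flip: sl2_vec_simps)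
      then show ?thesis
        using subalg_hom_simps(2)[OF subalg_gwa_model hom std_gens_gwa_model gwa_model_closed(1), of
            Gen_z \<kappa>] subalg_hom_D(1)[OF hom]
        by (simp del: std_gens.simps)
    qed
    moreover obtain w c where "w \<in> sl2_part a" "g (std_gens a Gen_z) = w + skew_scalar c" using gV
        by blast
    ultimately have "g (sl2_vec a 0 0 1) = w + skew_scalar (c - \<kappa>)" by (simp add: skew_scalar_simps)
    then show ?thesis
      using that gV[of Gen_x] gV[of Gen_y] \<open>w \<in> sl2_part a\<close> by (auto simp: sl2_vec_simps(1,2)[of a])
  qed
  have br: "g w \<in> sl2_part a" if uvw: "u * v - v * u = w" "u \<in> {sl2_vec a 1 0 0, sl2_vec a 0 1 0,
      sl2_vec a 0 0 1}"
    "v \<in> {sl2_vec a 1 0 0, sl2_vec a 0 1 0, sl2_vec a 0 0 1}" for u v w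
  proof -
    obtain \<alpha> \<beta> \<gamma> c where u: "g u = sl2_vec a \<alpha> \<beta> \<gamma> + skew_scalar c" using gW[OF uvw(2)]
        by (auto simp: sl2_part_def)
    obtain \<alpha>' \<beta>' \<gamma>' c' where v: "g v = sl2_vec a \<alpha>' \<beta>' \<gamma>' + skew_scalar c'" using gW[OF uvw(3)]
        by (auto simp: sl2_part_def)
    have m: "u \<in> gwa_model a" "v \<in> gwa_model a" using uvw by auto
    have "g w = g u * g v - g v * g u"
      using uvw(1) m subalg_hom_simps(2)[OF subalg_gwa_model hom, of "u * v"
          "v * u"] subalg_hom_D(3)[OF hom]
      by (auto simp: gwa_model_closed)
    also have "\<dots> = sl2_vec a \<alpha> \<beta> \<gamma> * sl2_vec a \<alpha>' \<beta>' \<gamma>' - sl2_vec a \<alpha>' \<beta>' \<gamma>' * sl2_vec a \<alpha> \<beta> \<gamma>"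
      unfolding u v by (simp add: distrib_left distrib_right sk.s_comm[of c "sl2_vec a \<alpha>' \<beta>' \<gamma>'"]
          sk.s_comm[of c' "sl2_vec a \<alpha> \<beta> \<gamma>"] sk.s_comm[of c "skew_scalar c'"])
    finally show ?thesis by (simp add: sl2_vec_bracket)
  qed
  have "g (sl2_vec a 1 0 0) \<in> sl2_part a"
    by (rule br[of "sl2_vec a 0 0 1" "sl2_vec a 1 0 0"]) (simp_all add: sl2_vec_bracket)
  moreover have "g (sl2_vec a 0 (-1) 0) \<in> sl2_part a"
    by (rule br[of "sl2_vec a 0 0 1" "sl2_vec a 0 1 0"]) (simp_all add: sl2_vec_bracket)
  moreover have "g (sl2_vec a 0 0 (-2)) \<in> sl2_part a"
    by (rule br[of "sl2_vec a 1 0 0" "sl2_vec a 0 1 0"]) (simp_all add: sl2_vec_bracket)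
  ultimately have "skew_scalar \<alpha> * g (sl2_vec a 1 0 0) + skew_scalar (- \<beta>) * g (sl2_vec a 0 (-1) 0)
      + skew_scalar (- \<gamma> / 2) * g (sl2_vec a 0 0 (-2)) \<in> sl2_part a" for \<alpha> \<beta> \<gamma>
    by (intro sl2_part_closed)
  moreover have "skew_scalar \<alpha> * g (sl2_vec a 1 0 0) + skew_scalar (- \<beta>) * g (sl2_vec a 0 (-1) 0)
      + skew_scalar (- \<gamma> / 2) * g (sl2_vec a 0 0 (-2))
     = g (sl2_vec a \<alpha> \<beta> \<gamma>)" for \<alpha> \<beta> \<gamma>
    by (simp add: sl2_vec_scale sl2_vec_add sl2_vec_mem flip: hom_scale[OF hom sl2_vec_mem]
        subalg_hom_D(2)[OF hom sl2_vec_mem sl2_vec_mem])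
  ultimately have "g ` sl2_part a \<subseteq> sl2_part a" by (auto simp: sl2_part_def)
  with g hom gRR show ?thesis by blast
qed

end

section \<open>Fixed rings of finite cyclic groups\<close>

lemma cyclic_groups_iso:
  assumes G: "group G" "cyclic_group G" and H: "group H" "cyclic_group H"
    and fin: "finite (carrier G)" and card: "card (carrier G) = card (carrier H)"
  shows "G \<cong> H"
proof -
  interpret G: group G by (rule G)
  interpret H: group H by (rule H)
  obtain x where x: "x \<in> carrier G" "carrier G = range (\<lambda>n::int. x [^]\<^bsub>G\<^esub> n)"
    using G.cyclic_group G(2) by blast
  obtain y where y: "y \<in> carrier H" "carrier H = range (\<lambda>n::int. y [^]\<^bsub>H\<^esub> n)"
    using H.cyclic_group H(2) by blast
  have ord: "G.ord x = H.ord y"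
    using G.generate_pow_card[OF x(1)] H.generate_pow_card[OF y(1)] card
    by (simp add: G.generate_pow[OF x(1)] H.generate_pow[OF y(1)] x(2) y(2) full_SetCompr_eq)
  define f where "f u = y [^]\<^bsub>H\<^esub> (SOME n::int. x [^]\<^bsub>G\<^esub> n = u)" for u
  have f: "f (x [^]\<^bsub>G\<^esub> n) = y [^]\<^bsub>H\<^esub> n" for n :: int
  proof -
    define m where "m = (SOME m::int. x [^]\<^bsub>G\<^esub> m = x [^]\<^bsub>G\<^esub> n)"
    have "x [^]\<^bsub>G\<^esub> m = x [^]\<^bsub>G\<^esub> n" unfolding m_def by (rule someI) simp
    then have "y [^]\<^bsub>H\<^esub> m = y [^]\<^bsub>H\<^esub> n"
      using G.int_pow_eq[OF x(1)] H.int_pow_eq[OF y(1)] ord by simp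
    then show ?thesis by (simp add: f_def m_def)
  qed
  have "f \<in> iso G H"
  proof (rule isoI)
    show "f \<in> hom G H"
      using x y by (auto simp: hom_def f simp flip: G.int_pow_mult H.int_pow_mult)
    show "bij_betw f (carrier G) (carrier H)"
      unfolding bij_betw_def
    proof
      show "inj_on f (carrier G)"
        unfolding inj_on_def x(2)
        using G.int_pow_eq[OF x(1)] H.int_pow_eq[OF y(1)] ord by (auto simp: f)
      show "f ` carrier G = carrier H" unfolding x(2) y(2) by (simp add: image_image f)
    qed
  qed
  then show ?thesis by (auto simp: is_iso_def)
qed

context quadratic begin

text \<open>Being fixed by the group amounts to being fixed by a generator, whose order is the order
  of the group.\<close>

lemma represents_fixed_ring:
  assumes "finite_cyclic_subgroup G (Aut_fl a)"
  shows "card G > 0 \<and> (\<exists>\<theta>. represents a (gwa_fixed_ring a G) (veronese a (card G)) \<theta>)"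
proof -
  let ?K = "(Aut_fl a)\<lparr>carrier := G\<rparr>" and ?S = "carrier (gwa a)"
  have sub: "subgroup G (Aut_fl a)" and fin: "finite G" and cyc: "cyclic_group ?K"
    using assms by (auto simp: finite_cyclic_subgroup_def)
  interpret K: group ?K by (rule subgroup.subgroup_is_group[OF sub group_Aut_fl])
  have GA: "\<phi> \<in> carrier (Aut_fl a)" if "\<phi> \<in> G" for \<phi> using sub that by (rule subgroup.mem_carrier)
  obtain x where x: "x \<in> G" "G = range (\<lambda>n::int. x [^]\<^bsub>?K\<^esub> n)"
    using K.cyclic_group cyc by auto
  have xK: "x \<in> carrier ?K" using x by simp
  have gen: "generate ?K {x} = G" using K.generate_pow[OF xK] x(2) by (simp add: full_SetCompr_eq)
  let ?n = "card G"
  have ord: "K.ord x = ?n" using K.generate_pow_card[OF xK] gen by simp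
  have n: "?n > 0" using fin x(1) by (auto simp: card_gt_0_iff)
  have nat_gen: "G = {x [^]\<^bsub>?K\<^esub> k | k. k \<in> (UNIV :: nat set)}"
    using K.generate_pow_nat[OF xK] gen ord n by simp
  obtain g where g: "\<And>r. r \<in> ?S \<Longrightarrow> g (gwa_to_model a r) = gwa_to_model a (x r)"
      "subalg_hom (gwa_model a) g" "g ` gwa_model a \<subseteq> gwa_model a" "g ` sl2_part a \<subseteq> sl2_part a"
    using transport_Aut_fl[OF GA[OF x(1)]] by (elim exE conjE) (rule that; assumption?; blast)
  have represents: "represents a (gwa a) (gwa_model a) (gwa_to_model a)"
      by (rule represents_gwa[OF a_nonzero])
  then have bij: "bij_betw (gwa_to_model a) ?S (gwa_model a)" by (simp add: represents_def)
  have inj: "gwa_to_model a u = gwa_to_model a v \<longleftrightarrow> u = v" if "u \<in> ?S" "v \<in> ?S" for u v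
    using bij that by (auto simp: bij_betw_def inj_on_def)
  have surj: "gwa_model a = gwa_to_model a ` ?S" using bij by (simp add: bij_betw_def)
  have pow: "(x [^]\<^bsub>?K\<^esub> k) r = (x ^^ k) r \<and> (x ^^ k) r \<in> ?S \<and> (g ^^ k) (gwa_to_model a r)
      = gwa_to_model a ((x ^^ k) r)"
    if "r \<in> ?S" for r and k :: nat
    using that
  proof (induction k arbitrary: r)
    case 0
    then show ?case by (simp add: Aut_fl_ops)
  next
    case (Suc k)
    have xr: "x r \<in> ?S" by (rule Aut_fl_D(5)[OF GA[OF x(1)] Suc.prems])
    have "x [^]\<^bsub>?K\<^esub> k \<in> G" using K.nat_pow_closed[OF xK, of k] by simp
    then have "(x [^]\<^bsub>?K\<^esub> Suc k) r = (x [^]\<^bsub>?K\<^esub> k) (x r)"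
      using Aut_fl_ops(2)[OF GA GA[OF x(1)] Suc.prems] by simp
    then show ?case using Suc.IH[OF xr] g(1)[OF Suc.prems] by (simp add: funpow_swap1)
  qed
  have ext: "\<phi> = \<one>\<^bsub>Aut_fl a\<^esub> \<longleftrightarrow> (\<forall>r\<in>?S. \<phi> r = r)" if "\<phi> \<in> G" for \<phi>
    using Aut_fl_D(1)[OF GA[OF that]] unfolding Aut_fl_ops
    by (auto intro!: extensionalityI[of _ ?S])
  have ordg: "(\<forall>F\<in>gwa_model a. (g ^^ k) F = F) \<longleftrightarrow> ?n dvd k" for k
  proof -
    have "(\<forall>F\<in>gwa_model a. (g ^^ k) F = F) \<longleftrightarrow> (\<forall>r\<in>?S. (x [^]\<^bsub>?K\<^esub> k) r = r)"
      unfolding surj using pow[of _ k] inj by auto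
    also have "\<dots> \<longleftrightarrow> x [^]\<^bsub>?K\<^esub> k = \<one>\<^bsub>Aut_fl a\<^esub>" using ext[of "x [^]\<^bsub>?K\<^esub> k"] K.nat_pow_closed[OF xK, of
        k] by simp
    also have "\<dots> \<longleftrightarrow> ?n dvd k" using K.pow_eq_id[OF xK, of k] ord by simp
    finally show ?thesis .
  qed
  have "\<forall>F\<in>gwa_model a. (g ^^ ?n) F = F" using ordg[of ?n] by simp
  then have finite_order_aut: "finite_order_aut ?n g" unfolding finite_order_aut_def using n g(2-4)
      by (intro conjI)
  obtain \<psi> where \<psi>: "bij_betw \<psi> {F \<in> gwa_model a. g F = F} (veronese a ?n)" "subalg_hom (gwa_model a) \<psi>"
    using fixed_ring_veronese[OF finite_order_aut ordg] by (elim exE conjE)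
  have fixed: "carrier (gwa_fixed_ring a G) = {r \<in> ?S. x r = r}"
  proof -
    have "\<phi> r = r" if r: "r \<in> ?S" "x r = r" and \<phi>: "\<phi> \<in> G" for r \<phi>
    proof -
      obtain k :: nat where k: "\<phi> = x [^]\<^bsub>?K\<^esub> k" using \<phi> nat_gen by blast
      have "(x ^^ k) r = r" by (induction k) (simp_all add: r)
      then show ?thesis using pow[OF r(1), of k] k by simp
    qed
    then show ?thesis using x(1) by (auto simp: gwa_fixed_ring_def)
  qed
  have sel: "ring.add (gwa_fixed_ring a G) = ring.add (gwa a)" "monoid.mult (gwa_fixed_ring a G)
      = monoid.mult (gwa a)"
    by (simp_all add: gwa_fixed_ring_def)
  have img: "bij_betw (gwa_to_model a) {r \<in> ?S. x r = r} {F \<in> gwa_model a. g F = F}"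
  proof (rule bij_betw_subset[OF bij])
    have "x r \<in> ?S" if "r \<in> ?S" for r by (rule Aut_fl_D(5)[OF GA[OF x(1)] that])
    then show "gwa_to_model a ` {r \<in> ?S. x r = r} = {F \<in> gwa_model a. g F = F}"
      unfolding surj using g(1) inj by auto
  qed auto
  have iso: "x \<in> ring_iso (gwa a) (gwa a)" by (rule Aut_fl_D(2)[OF GA[OF x(1)]])
  have "represents a (gwa_fixed_ring a G) (veronese a ?n) (\<psi> \<circ> gwa_to_model a)"
    unfolding represents_def fixed sel
  proof (intro conjI ballI allI)
    show "bij_betw (\<psi> \<circ> gwa_to_model a) {r \<in> ?S. x r = r} (veronese a ?n)"
        by (rule bij_betw_trans[OF img \<psi>(1)])
    fix c
    show "gwa_scalar a c \<in> {r \<in> ?S. x r = r}" using represents Aut_fl_D(3)[OF GA[OF x(1)]]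
        by (simp add: represents_def)
    show "(\<psi> \<circ> gwa_to_model a) (gwa_scalar a c) = skew_scalar c"
        using represents subalg_hom_D(1)[OF \<psi>(2)] by (simp add: represents_def)
  next
    fix u v assume "u \<in> {r \<in> ?S. x r = r}" "v \<in> {r \<in> ?S. x r = r}"
    then have uv: "u \<in> ?S" "v \<in> ?S" "x u = u" "x v = v" by auto
    have m: "gwa_to_model a u \<in> gwa_model a" "gwa_to_model a v \<in> gwa_model a" using uv surj by auto
    have r: "u \<oplus>\<^bsub>gwa a\<^esub> v \<in> ?S" "gwa_to_model a (u \<oplus>\<^bsub>gwa a\<^esub> v) = gwa_to_model a u + gwa_to_model a v"
      "u \<otimes>\<^bsub>gwa a\<^esub> v \<in> ?S" "gwa_to_model a (u \<otimes>\<^bsub>gwa a\<^esub> v) = gwa_to_model a u * gwa_to_model a v"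
      using represents uv by (simp_all add: represents_def)
    show "u \<oplus>\<^bsub>gwa a\<^esub> v \<in> {r \<in> ?S. x r = r}" using r ring_iso_memE(3)[OF iso uv(1,2)] uv by simp
    show "u \<otimes>\<^bsub>gwa a\<^esub> v \<in> {r \<in> ?S. x r = r}" using r ring_iso_memE(2)[OF iso uv(1,2)] uv by simp
    show "(\<psi> \<circ> gwa_to_model a) (u \<oplus>\<^bsub>gwa a\<^esub> v) = (\<psi> \<circ> gwa_to_model a) u + (\<psi> \<circ> gwa_to_model a) v"
      using r(2) subalg_hom_D(2)[OF \<psi>(2) m] by simp
    show "(\<psi> \<circ> gwa_to_model a) (u \<otimes>\<^bsub>gwa a\<^esub> v) = (\<psi> \<circ> gwa_to_model a) u * (\<psi> \<circ> gwa_to_model a) v"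
      using r(4) subalg_hom_D(3)[OF \<psi>(2) m] by simp
  qed
  with n show ?thesis by blast
qed

end

theorem corollary2p11:
  fixes a :: "'k::{alg_closed_field, field_char_0} poly"
    and G H :: "('k free_xyz set \<Rightarrow> 'k free_xyz set) set"
  assumes "Polynomial.lead_coeff a = 1"
    and "Polynomial.poly a 0 = 0"
    and "Polynomial.degree a = 2"
    and "finite_cyclic_subgroup G (Aut_fl a)"
    and "finite_cyclic_subgroup H (Aut_fl a)"
  shows "(gwa_subalg_isomorphic a (gwa_fixed_ring a G) (gwa_fixed_ring a H)
            \<longrightarrow> (Aut_fl a)\<lparr>carrier := G\<rparr> \<cong> (Aut_fl a)\<lparr>carrier := H\<rparr>)
       \<and> (gwa_subalg_isomorphic a (gwa_fixed_ring a H) (gwa a)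
            \<longrightarrow> H = {\<one>\<^bsub>Aut_fl a\<^esub>})"
proof -
  let ?\<kappa> = "(1 - Polynomial.coeff a 1) / 2"
  have "a = [:0, 1 - 2 * ?\<kappa>, 1:]"
  proof (rule poly_eqI)
    fix i
    show "Polynomial.coeff a i = Polynomial.coeff [:0, 1 - 2 * ?\<kappa>, 1:] i"
    proof (cases "i > 2")
      case True
      then have "Polynomial.degree [:0, 1 - 2 * ?\<kappa>, 1:] < i" by simp
      then show ?thesis using True assms(3) by (simp only: coeff_eq_0)
    next
      case False
      then have "i = 0 \<or> i = Suc 0 \<or> i = Suc (Suc 0)" by arith
      moreover have "Polynomial.coeff a 0 = 0" using assms(2) by (simp add: poly_0_coeff_0)
      moreover have "Polynomial.coeff a (Suc (Suc 0)) = 1" using assms(1,3)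
          by (simp add: numeral_2_eq_2)
      ultimately show ?thesis by (elim disjE) (simp_all add: field_simps)
    qed
  qed
  then interpret quadratic a ?\<kappa> by unfold_locales
  have deg: "Polynomial.degree a > 0" using assms(3) by simp
  obtain \<theta>G \<theta>H where n: "card G > 0" "card H > 0"
    and \<theta>: "represents a (gwa_fixed_ring a G) (veronese a (card G)) \<theta>G"
        "represents a (gwa_fixed_ring a H) (veronese a (card H)) \<theta>H"
    using represents_fixed_ring[OF assms(4)] represents_fixed_ring[OF assms(5)] by blast
  have SS1: "veronese a 1 = gwa_model a" by (auto simp: veronese_def)
  have sub: "subgroup G (Aut_fl a)" "subgroup H (Aut_fl a)"
    "cyclic_group ((Aut_fl a)\<lparr>carrier := G\<rparr>)" "cyclic_group ((Aut_fl a)\<lparr>carrier := H\<rparr>)" "finite G"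
    using assms(4,5) by (auto simp: finite_cyclic_subgroup_def)
  show ?thesis
  proof (intro conjI impI)
    assume "gwa_subalg_isomorphic a (gwa_fixed_ring a G) (gwa_fixed_ring a H)"
    then have "\<exists>f. bij_betw f (veronese a (card G)) (veronese a (card H))
        \<and> subalg_hom (veronese a (card G)) f"
      using represents_iso[OF \<theta>(1,2)] by (auto simp: gwa_subalg_isomorphic_def)
    then have "card G = card H" using veronese_iso_eq[OF n deg] by blast
    then show "(Aut_fl a)\<lparr>carrier := G\<rparr> \<cong> (Aut_fl a)\<lparr>carrier := H\<rparr>"
      using sub subgroup.subgroup_is_group[OF _ group_Aut_fl] by (intro cyclic_groups_iso) auto
  next
    assume "gwa_subalg_isomorphic a (gwa_fixed_ring a H) (gwa a)"
    then have "\<exists>f. bij_betw f (veronese a (card H)) (veronese a 1) \<and> subalg_hom (veronese a (card H)) f"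
      using represents_iso[OF \<theta>(2) represents_gwa[OF a_nonzero]] unfolding SS1
      by (auto simp: gwa_subalg_isomorphic_def)
    then have "card H = 1" using veronese_iso_eq[OF n(2) _ deg, of 1] by auto
    then obtain \<phi> where "H = {\<phi>}" by (auto simp: card_1_singleton_iff)
    then show "H = {\<one>\<^bsub>Aut_fl a\<^esub>}" using subgroup.one_closed[OF sub(2)] by auto
  qed
qed

end
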